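(* Fix an integer $m\ge 1$. For each $N\ge 1$ let $x_{ij}=x^{(N)}_{ij}$, $1\le i,j\le N$, be independent complex random variables such that $\mathbf{E}\,x_{ij}=0$, $\mathbf{E}|x_{ij}|^2=1$ and $\mathbf{E}|x_{ij}|^4\le B$ for some constant $B<\infty$ independent of $N$ (and of $i,j$). Assume moreover that for every $\alpha>0$ $$L_N(\alpha)=N^{-2}\sum_{1\le i,j\le N}\mathbf{E}\,|x_{ij}|^4\,\mathbb{I}\{|x_{ij}|>\alpha\sqrt N\}\to 0\quad\text{as }N\to\infty .$$ Let $\mathbf{X}=(N^{-1/2}x_{ij})_{1\le i,j\le N}$, let $\lambda_1,\dots,\lambda_N$ be the eigenvalues of the Hermitian positive semi-definite matrix $\mathbf{X}^m(\mathbf{X}^* )^m$, and let $F^{(m)}_N(x)=N^{-1}\sum_{k=1}^N\mathbb{I}\{\lambda_k\le x\}$. Then the limit $G^{(m)}(x)=\lim_{N\to\infty}\mathbf{E}\,F^{(m)}_N(x)$ exists, the function $G^{(m)}$ is a distribution function (of a probability measure on $\mathbb{R}$), and it has moments $$M^{(m)}_p=\int_{\mathbb{R}}x^p\,dG^{(m)}(x)=\frac{1}{mp+1}\binom{pm+p}{p},\qquad p=0,1,2,\dots$$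
   Context: $\mathbf{X}^*$ is the adjoint (conjugate transpose) of $\mathbf{X}$, and $\mathbb{I}\{A\}$ is the indicator function of the event $A$. Eigenvalues are counted with multiplicity. The random variables $x_{ij}=x_{ij}^{(N)}$ may depend on $N$. *)

theory Defs
  imports
    "HOL-Probability.Probability"
    "HOL-Computational_Algebra.Fundamental_Theorem_Algebra"
    "Jordan_Normal_Form.Char_Poly"
    "Jordan_Normal_Form.Schur_Decomposition"
begin

(* Rows and columns of an N x N array are indexed by {0..<N}, as in Jordan_Normal_Form. *)

definition lindeberg4 ::
  "(nat \<Rightarrow> 'a measure) \<Rightarrow> (nat \<Rightarrow> nat \<Rightarrow> nat \<Rightarrow> 'a \<Rightarrow> complex) \<Rightarrow> nat \<Rightarrow> real \<Rightarrow> real" where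
  "lindeberg4 M x N \<alpha> =
     (\<Sum>i<N. \<Sum>j<N. \<integral>\<omega>. cmod (x N i j \<omega>) ^ 4 *
        indicator {\<omega>. cmod (x N i j \<omega>) > \<alpha> * sqrt (real N)} \<omega> \<partial>M N) / real N ^ 2"

definition scaled_matrix ::
  "(nat \<Rightarrow> nat \<Rightarrow> nat \<Rightarrow> 'a \<Rightarrow> complex) \<Rightarrow> nat \<Rightarrow> 'a \<Rightarrow> complex mat" where
  "scaled_matrix x N \<omega> = mat N N (\<lambda>(i, j). x N i j \<omega> / complex_of_real (sqrt (real N)))"

definition power_covariance :: "nat \<Rightarrow> complex mat \<Rightarrow> complex mat" where
  "power_covariance m X = (X ^\<^sub>m m) * (mat_adjoint X ^\<^sub>m m)"

definition eigenvalue_mset :: "complex mat \<Rightarrow> complex multiset" where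
  "eigenvalue_mset A = proots (char_poly A)"

(* Only used for Hermitian A, whose eigenvalues are real: Re is then merely the
   coercion from complex to real. *)
definition spectral_distribution :: "complex mat \<Rightarrow> real \<Rightarrow> real" where
  "spectral_distribution A t =
     real (size {# z \<in># eigenvalue_mset A. Re z \<le> t #}) / real (dim_row A)"

end

theory Submission
  imports Defs "HOL-Complex_Analysis.Conformal_Mappings"
begin

text \<open>
  Method of moments. The Lindeberg condition allows a cut-off level $\alpha_N \sqrt N$ with
  $\alpha_N \to 0$ such that, with probability tending to one, no entry is changed. The moments of
  the mean spectral distribution are normalised expected traces of words in $X$ and $X^*$, that is,
  sums over closed walks. Only the walks that traverse a tree with each edge used exactly once in
  each direction survive in the limit; means of order $N^{-3/2}$ created by the cut-off need no
  recentring, since a walk using some edge only once is negligible as well. For the word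
  $(X^m (X^*)^m)^p$ the surviving walks are counted by the Fuss--Catalan numbers. These grow at most
  exponentially, so the characteristic functions converge and the spectral distributions converge
  weakly. Convergence at every point follows because the limit law has no atoms: its moment
  generating function satisfies $M = 1 + z M^{m+1}$.
\<close>

section \<open>Closed walks on trees and Raney numbers\<close>

text \<open>With only fourth moments at hand, traces of high powers need not be integrable, so the
  cut-off comes before any moment is taken. A scaled cut-off entry is at most \<alpha>; an edge used
  twice then has weight about 1/N, one used k > 2 times at most \<alpha>^(k-2)/N, one used once at
  most B/(\<alpha>^3 N^2), so every defect of a walk costs a small factor. In exchange some entry
  changes, with probability at most L_N(\<alpha>)/\<alpha>^4 by Markov's inequality and a union
  bound over the N^2 entries. Hence \<alpha> may tend to zero only slowly, which a diagonal choice
  \<alpha> = 1/k achieves. For m > 1 the word does not alternate, so not every non-crossing pairing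
  is admissible; what makes the admissible ones countable is that an unfinished pairing contributes
  a power of M whose exponent depends only on its stack and on the position in the word. Convergence
  is claimed at every t, which a jump of the limit could spoil. Of the limit only the moments are
  known, so atoms are excluded through its transform and not through a density.\<close>

text \<open>A word in $X$ and $X^*$ is a list of letters, \<open>False\<close> standing for $X$ and \<open>True\<close> for $X^*$.
  A step from \<open>c\<close> to \<open>v\<close> along \<open>X\<close> reads the entry \<open>(c, v)\<close>; along $X^*$ it reads the conjugate of the
  entry \<open>(v, c)\<close>.\<close>

definition walk_edge :: "bool \<Rightarrow> nat \<Rightarrow> nat \<Rightarrow> nat \<times> nat" where
  "walk_edge l c v = (if l then (v, c) else (c, v))"

fun walk_steps :: "nat \<Rightarrow> bool list \<Rightarrow> nat list \<Rightarrow> ((nat \<times> nat) \<times> bool) list" where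
  "walk_steps c (l # w) (v # vs) = (walk_edge l c v, l) # walk_steps v w vs"
| "walk_steps c _ _ = []"

fun stack_steps :: "nat \<Rightarrow> (bool \<times> nat) list \<Rightarrow> ((nat \<times> nat) \<times> bool) list" where
  "stack_steps c [] = []"
| "stack_steps c ((b, u) # st) = (walk_edge b u c, b) # stack_steps u st"

text \<open>Continuations of a depth-first traversal of a tree: \<open>V\<close> is the set of visited vertices, \<open>c\<close> the
  current one, and the stack is the path back to the root, an item \<open>(b, u)\<close> recording that the
  edge from \<open>u\<close> was opened by the letter \<open>b\<close>. A step either visits a new vertex or closes the edge
  on top of the stack, which takes the opposite letter.\<close>

fun tree_walks :: "nat \<Rightarrow> nat set \<Rightarrow> nat \<Rightarrow> (bool \<times> nat) list \<Rightarrow> bool list \<Rightarrow> nat list set" where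
  "tree_walks N V c st [] = (if st = [] then {[]} else {})"
| "tree_walks N V c st (l # w) =
     (\<Union>v\<in>{..<N} - V. (#) v ` tree_walks N (insert v V) v ((l, c) # st) w) \<union>
     (case st of [] \<Rightarrow> {} | (b, u) # st' \<Rightarrow>
        if b \<noteq> l then (#) u ` tree_walks N V u st' w else {})"

text \<open>The shape of a traversal without its vertex labels: from the empty stack this counts the
  non-crossing pairings of the word in which partners are opposite letters.\<close>

fun pairings :: "bool list \<Rightarrow> bool list \<Rightarrow> nat" where
  "pairings s [] = (if s = [] then 1 else 0)"
| "pairings s (l # w) = pairings (l # s) w +
     (case s of [] \<Rightarrow> 0 | b # s' \<Rightarrow> if b \<noteq> l then pairings s' w else 0)"

definition stack_ok :: "nat set \<Rightarrow> nat \<Rightarrow> (bool \<times> nat) list \<Rightarrow> bool" where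
  "stack_ok V c st \<longleftrightarrow> distinct (c # map snd st) \<and> set (c # map snd st) \<subseteq> V"

lemma pairings_eq_0: "length w < length s \<Longrightarrow> pairings s w = 0"
proof (induction w arbitrary: s)
  case (Cons l w)
  then show ?case by (auto split: list.split)
qed simp

lemma stack_ok_push: "stack_ok V c st \<Longrightarrow> v \<notin> V \<Longrightarrow> stack_ok (insert v V) v ((l, c) # st)"
  by (auto simp: stack_ok_def)

lemma stack_ok_pop: "stack_ok V c ((b, u) # st) \<Longrightarrow> stack_ok V u st"
  by (auto simp: stack_ok_def)

lemma finite_tree_walks: "finite (tree_walks N V c st w)"
  by (induction N V c st w rule: tree_walks.induct) (auto split: list.split)

text \<open>Labels and shape separate: whatever the shape, the i-th push, counted from 0, has N -
  card V - i unvisited vertices to choose from. Truncated subtraction is right here, the product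
  vanishing once the vertices run out.\<close>

lemma card_tree_walks:
  assumes "finite V" "V \<subseteq> {..<N}" "stack_ok V c st"
  shows "card (tree_walks N V c st w) =
    pairings (map fst st) w * (\<Prod>i<(length w - length st) div 2. N - card V - i)"
  using assms
proof (induction w arbitrary: V c st)
  case Nil
  then show ?case by simp
next
  case (Cons l w)
  let ?q = "\<lambda>n w st. \<Prod>i<(length w - length st) div 2. n - i :: nat"
  let ?push = "\<Union>v\<in>{..<N} - V. (#) v ` tree_walks N (insert v V) v ((l, c) # st) w"
  let ?pop = "case st of [] \<Rightarrow> {} | (b, u) # st' \<Rightarrow>
        if b \<noteq> l then (#) u ` tree_walks N V u st' w else {}"
  have "card ?push = (\<Sum>v\<in>{..<N} - V. card ((#) v ` tree_walks N (insert v V) v ((l, c) # st) w))"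
    by (rule card_UN_disjoint) (auto intro: finite_tree_walks)
  also have "\<dots> = (\<Sum>v\<in>{..<N} - V. pairings (l # map fst st) w * ?q (N - Suc (card V)) w ((l, c) # st))"
  proof (rule sum.cong[OF refl])
    fix v assume v: "v \<in> {..<N} - V"
    have "card ((#) v ` tree_walks N (insert v V) v ((l, c) # st) w) =
        card (tree_walks N (insert v V) v ((l, c) # st) w)"
      by (rule card_image) auto
    also have "\<dots> = pairings (l # map fst st) w * ?q (N - Suc (card V)) w ((l, c) # st)"
      using Cons.prems v by (subst Cons.IH) (auto intro: stack_ok_push)
    finally show "card ((#) v ` tree_walks N (insert v V) v ((l, c) # st) w) = \<dots>" .
  qed
  also have "\<dots> = (N - card V) * (pairings (l # map fst st) w * ?q (N - Suc (card V)) w ((l, c) # st))"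
    using Cons.prems by (simp add: card_Diff_subset)
  also have "\<dots> = pairings (l # map fst st) w * ?q (N - card V) (l # w) st"
  \<comment> \<open>With too few letters left the number of factors does not drop by one after a
    push, but then no pairing exists and both sides are zero.\<close>
  proof (cases "length w < length (l # map fst st)")
    case True
    then show ?thesis using pairings_eq_0[of w "l # map fst st"] by simp
  next
    case False
    then have "(length (l # w) - length st) div 2 = Suc ((length w - length ((l, c) # st)) div 2)"
      by simp
    then show ?thesis
      by (simp only: prod.lessThan_Suc_shift) (simp add: mult_ac)
  qed
  finally have push: "card ?push = pairings (l # map fst st) w * ?q (N - card V) (l # w) st" .
  have pop: "card ?pop = (case map fst st of [] \<Rightarrow> 0 | b # s' \<Rightarrow> if b \<noteq> l then pairings s' w else 0)
      * ?q (N - card V) (l # w) st"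
  proof (cases st)
    case (Cons bu st')
    obtain b u where [simp]: "bu = (b, u)" by (cases bu)
    have "card ((#) u ` tree_walks N V u st' w) = card (tree_walks N V u st' w)"
      by (rule card_image) auto
    also have "\<dots> = pairings (map fst st') w * ?q (N - card V) w st'"
      using Cons.prems Cons stack_ok_pop[of V c b u st'] by (intro Cons.IH) auto
    finally show ?thesis using Cons by simp
  qed simp
  have "card (?push \<union> ?pop) = card ?push + card ?pop"
  proof (rule card_Un_disjoint)
    \<comment> \<open>A push moves outside \<open>V\<close>, a pop back to a stack vertex inside
      it.\<close>
    show "?push \<inter> ?pop = {}" using Cons.prems
      by (auto simp: stack_ok_def split: list.splits if_splits)
  qed (auto intro!: finite_tree_walks split: list.split)
  then show ?case
    unfolding push pop tree_walks.simps by (simp add: algebra_simps)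
qed

lemma tree_walks_props:
  assumes "vs \<in> tree_walks N V c st w"
  shows "length vs = length w \<and> set vs \<subseteq> {..<N} \<union> {c} \<union> snd ` set st \<and>
    last (c # vs) = last (c # map snd st)"
  using assms
proof (induction N V c st w arbitrary: vs rule: tree_walks.induct)
  case (1 N V c st)
  then show ?case by (auto split: if_splits)
next
  case (2 N V c st l w)
  from "2.prems" consider
    (push) v us where "v < N" "v \<notin> V" "vs = v # us" "us \<in> tree_walks N (insert v V) v ((l, c) # st) w"
  | (pop) b u st' us where "st = (b, u) # st'" "b \<noteq> l" "vs = u # us" "us \<in> tree_walks N V u st' w"
    by (auto split: list.splits if_splits)
  then show ?case
  proof cases
    case push
    have "length us = length w \<and> set us \<subseteq> {..<N} \<union> {v} \<union> snd ` set ((l, c) # st) \<and>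
      last (v # us) = last (v # map snd ((l, c) # st))"
      by (rule "2.IH"(1)) (use push in auto)
    with push show ?thesis by auto
  next
    case pop
    have "length us = length w \<and> set us \<subseteq> {..<N} \<union> {u} \<union> snd ` set st' \<and>
      last (u # us) = last (u # map snd st')"
      by (rule "2.IH"(2)[OF pop(1) refl pop(2,4)])
    with pop show ?thesis by auto
  qed
qed

lemma walk_edge_in: "walk_edge l c v \<in> V \<times> V \<longleftrightarrow> c \<in> V \<and> v \<in> V"
  by (auto simp: walk_edge_def)

lemma stack_steps_in: "stack_ok V c st \<Longrightarrow> fst ` set (stack_steps c st) \<subseteq> V \<times> V"
proof (induction c st rule: stack_steps.induct)
  case (2 c b u st)
  then show ?case using stack_ok_pop[OF "2.prems"]
    by (auto simp: walk_edge_def stack_ok_def)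
qed simp

text \<open>The current vertex \<open>c\<close> occurs nowhere deeper in the stack, so all deeper
  edges already lie in \<open>(V - {c}) \<times> (V - {c})\<close>.\<close>

lemma stack_top_notin:
  assumes "stack_ok V c ((b, u) # st)"
  shows "walk_edge b u c \<notin> fst ` set (stack_steps u st)"
proof -
  have "stack_ok (V - {c}) u st" using assms by (auto simp: stack_ok_def)
  then have "fst ` set (stack_steps u st) \<subseteq> (V - {c}) \<times> (V - {c})" by (rule stack_steps_in)
  then show ?thesis by (auto simp: walk_edge_def)
qed

text \<open>Going back along an edge with the opposite letter reads the same matrix entry,
  conjugated. This is why a closing step must take the opposite letter.\<close>

lemma walk_edge_commute: "b \<noteq> l \<Longrightarrow> walk_edge l c u = walk_edge b u c"
  by (auto simp: walk_edge_def)

text \<open>Stated for every stack so that the induction closes; what is wanted is the empty stack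
  with \<open>V = {c}\<close>, where each edge of the walk is read once plainly and once conjugated.
  The middle clause keeps a closed edge from being opened again: a push leaves the visited set, so
  its edge lies outside \<open>V \<times> V\<close>.\<close>

lemma tree_walks_edges:
  assumes "vs \<in> tree_walks N V c st w" "stack_ok V c st"
  shows "((e, b) \<in> set (stack_steps c st) \<longrightarrow>
      filter (\<lambda>x. fst x = e) (walk_steps c w vs) = [(e, \<not> b)]) \<and>
    (e \<notin> fst ` set (stack_steps c st) \<longrightarrow> e \<in> V \<times> V \<longrightarrow>
      filter (\<lambda>x. fst x = e) (walk_steps c w vs) = []) \<and>
    (e \<notin> V \<times> V \<longrightarrow> filter (\<lambda>x. fst x = e) (walk_steps c w vs) = [] \<or>
      (\<exists>b. filter (\<lambda>x. fst x = e) (walk_steps c w vs) = [(e, b), (e, \<not> b)]))"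
  using assms
proof (induction N V c st w arbitrary: vs b rule: tree_walks.induct)
  case (1 N V c st)
  then show ?case by (auto split: if_splits)
next
  case (2 N V c st l w)
  from "2.prems" consider
    (push) v us where "v < N" "v \<notin> V" "vs = v # us" "us \<in> tree_walks N (insert v V) v ((l, c) # st) w"
  | (pop) b' u st' us where "st = (b', u) # st'" "b' \<noteq> l" "vs = u # us" "us \<in> tree_walks N V u st' w"
    by (auto split: list.splits if_splits)
  then show ?case
  proof cases
    case push
    have ok: "stack_ok (insert v V) v ((l, c) # st)" by (rule stack_ok_push[OF "2.prems"(2) push(2)])
    let ?S = "stack_steps v ((l, c) # st)" and ?V = "insert v V"
    define F where "F = filter (\<lambda>x. fst x = e) (walk_steps v w us)"
    have v: "v \<in> {..<N} - V" using push by simp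
    note IH = "2.IH"(1)[OF v push(4) ok, folded F_def]
    have IH1: "F = [(e, \<not> b)]" if "(e, b) \<in> set ?S" for b using IH[of b] that by blast
    have IH2: "F = []" if "e \<notin> fst ` set ?S" "e \<in> ?V \<times> ?V" using IH[of b] that by blast
    have IH3: "F = [] \<or> (\<exists>b. F = [(e, b), (e, \<not> b)])" if "e \<notin> ?V \<times> ?V" using IH[of b] that by blast
    have S: "set ?S = insert (walk_edge l c v, l) (set (stack_steps c st))" by simp
    have e0: "walk_edge l c v \<notin> V \<times> V" using push by (simp add: walk_edge_in)
    have st: "fst ` set (stack_steps c st) \<subseteq> V \<times> V" by (rule stack_steps_in[OF "2.prems"(2)])
    have sub: "V \<times> V \<subseteq> ?V \<times> ?V" by blast
    show ?thesis
    proof (cases "e = walk_edge l c v")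
      case True
      have eq: "filter (\<lambda>x. fst x = e) (walk_steps c (l # w) vs) = (e, l) # F"
        by (simp add: push(3) True F_def)
      have "F = [(e, \<not> l)]" using IH1 True S by blast
      moreover have "e \<notin> V \<times> V" using True e0 by simp
      moreover from this have "(e, b) \<notin> set (stack_steps c st)" using st by (metis fst_conv image_eqI subsetD)
      ultimately show ?thesis unfolding eq by blast
    next
      case False
      have eq: "filter (\<lambda>x. fst x = e) (walk_steps c (l # w) vs) = F"
        using False by (simp add: push(3) F_def)
      show ?thesis unfolding eq
      proof (intro conjI impI)
        assume "(e, b) \<in> set (stack_steps c st)"
        then show "F = [(e, \<not> b)]" using IH1 S by blast
      next
        assume "e \<notin> fst ` set (stack_steps c st)" "e \<in> V \<times> V"
        then show "F = []" using IH2 False sub unfolding S by (metis fst_conv image_insert insertE subsetD)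
      next
        assume "e \<notin> V \<times> V"
        then have "e \<notin> fst ` set ?S" using st False unfolding S by (metis fst_conv image_insert insertE subsetD)
        then show "F = [] \<or> (\<exists>b. F = [(e, b), (e, \<not> b)])" using IH2 IH3 by blast
      qed
    qed
  next
    case pop
    have ok: "stack_ok V u st'" using "2.prems"(2) pop(1) by (auto intro: stack_ok_pop)
    define F where "F = filter (\<lambda>x. fst x = e) (walk_steps u w us)"
    note IH = "2.IH"(2)[OF pop(1) refl pop(2,4) ok, folded F_def]
    have IH1: "F = [(e, \<not> b)]" if "(e, b) \<in> set (stack_steps u st')" for b using IH[of b] that by blast
    have IH2: "F = []" if "e \<notin> fst ` set (stack_steps u st')" "e \<in> V \<times> V" using IH[of b] that by blast
    have IH3: "F = [] \<or> (\<exists>b. F = [(e, b), (e, \<not> b)])" if "e \<notin> V \<times> V" using IH[of b] that by blast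
    have e: "walk_edge l c u = walk_edge b' u c" by (rule walk_edge_commute[OF pop(2)])
    have n: "walk_edge b' u c \<notin> fst ` set (stack_steps u st')"
      using "2.prems"(2) pop(1) stack_top_notin by blast
    have i: "walk_edge b' u c \<in> V \<times> V"
      using "2.prems"(2) pop(1) unfolding walk_edge_in by (simp add: stack_ok_def)
    have S: "set (stack_steps c st) = insert (walk_edge b' u c, b') (set (stack_steps u st'))"
      by (simp add: pop(1))
    show ?thesis
    proof (cases "e = walk_edge b' u c")
      case True
      have eV: "e \<in> V \<times> V" and "e \<notin> fst ` set (stack_steps u st')" using n i True by simp_all
      then have F: "F = []" by (intro IH2)
      have eq: "filter (\<lambda>x. fst x = e) (walk_steps c (l # w) vs) = (e, l) # F"
        by (simp add: pop(3) True e F_def)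
      have "e \<in> fst ` set (stack_steps c st)" unfolding S True by force
      moreover have "b = b'" if "(e, b) \<in> set (stack_steps c st)"
        using that n unfolding S True by (metis Pair_inject fst_conv image_eqI insertE)
      moreover have "l = (\<not> b')" using pop(2) by blast
      ultimately show ?thesis unfolding eq F using eV by blast
    next
      case False
      have eq: "filter (\<lambda>x. fst x = e) (walk_steps c (l # w) vs) = F"
        using False by (simp add: pop(3) e F_def)
      show ?thesis unfolding eq
      proof (intro conjI impI)
        assume "(e, b) \<in> set (stack_steps c st)"
        then show "F = [(e, \<not> b)]" using IH1 False unfolding S by blast
      next
        assume "e \<notin> fst ` set (stack_steps c st)" "e \<in> V \<times> V"
        then show "F = []" using IH2 unfolding S by blast
      next
        assume "e \<notin> V \<times> V"
        then show "F = [] \<or> (\<exists>b. F = [(e, b), (e, \<not> b)])" by (rule IH3)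
      qed
    qed
  qed
qed

text \<open>A step to a vertex outside \<open>V\<close> uses an edge outside
  \<open>V \<times> V\<close>, hence outside \<open>E\<close>, so each new vertex is charged to its
  own new edge. With \<open>V = {c}\<close> and \<open>E\<close> empty this is the bound of the
  vertices by the edges plus one.\<close>

lemma card_vertices_le:
  assumes "length vs = length w" "finite V" "c \<in> V" "E \<subseteq> V \<times> V"
  shows "card (V \<union> set vs) + card E \<le> card V + card (E \<union> fst ` set (walk_steps c w vs))"
  using assms
proof (induction w arbitrary: vs V c E)
  case Nil
  then show ?case by simp
next
  case (Cons l w)
  obtain v us where vs: "vs = v # us" using Cons.prems by (cases vs) auto
  have E: "finite E" using Cons.prems by (meson finite_SigmaI finite_subset)
  let ?e = "walk_edge l c v"
  show ?case
  proof (cases "v \<in> V")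
    case True
    have "card (V \<union> set us) + card (insert ?e E) \<le> card V + card (insert ?e E \<union> fst ` set (walk_steps v w us))"
      using Cons.prems vs True by (intro Cons.IH) (auto simp: walk_edge_def)
    moreover have "card E \<le> card (insert ?e E)" using E by (simp add: card_insert_le)
    ultimately show ?thesis using vs True by (simp add: insert_absorb)
  next
    case False
    then have "?e \<notin> E" using Cons.prems by (auto simp: walk_edge_def)
    moreover have "card (insert v V \<union> set us) + card (insert ?e E) \<le>
        card (insert v V) + card (insert ?e E \<union> fst ` set (walk_steps v w us))"
      using Cons.prems vs by (intro Cons.IH) (auto simp: walk_edge_def)
    ultimately show ?thesis using vs False Cons.prems E by simp
  qed
qed

text \<open>A step to a new vertex always uses a new edge, so equality between the two counts forces every
  step to an old vertex to repeat an edge. As no edge is used three times, that edge is open, and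
  the only open edge at the current vertex is the top of the stack.\<close>

lemma tree_walksI:
  assumes "length vs = length w" "set vs \<subseteq> {..<N}" "finite V" "stack_ok V c st"
    and "set es \<subseteq> V \<times> V"
    and "\<And>e. count_list es e = 1 \<longleftrightarrow> e \<in> fst ` set (stack_steps c st)"
    and "\<And>e. e \<in> set (es @ map fst (walk_steps c w vs)) \<Longrightarrow>
      count_list (es @ map fst (walk_steps c w vs)) e = 2"
    and "card (V \<union> set vs) + card (set es) = card V + card (set es \<union> fst ` set (walk_steps c w vs))"
  shows "vs \<in> tree_walks N V c st w"
  using assms
proof (induction w arbitrary: vs V c st es)
  case Nil
  have "st = []"
  proof (cases st)
    case (Cons bu st')
    obtain b u where "bu = (b, u)" by (cases bu)
    then have "count_list es (walk_edge b u c) = 1" using Nil.prems(6) Cons by auto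
    moreover from this have "walk_edge b u c \<in> set es" by (metis count_list_0_iff zero_neq_one)
    ultimately show ?thesis using Nil.prems(7)[of "walk_edge b u c"] by simp
  qed
  then show ?case using Nil by simp
next
  case (Cons l w)
  obtain v us where vs: "vs = v # us" using Cons.prems by (cases vs) auto
  let ?e = "walk_edge l c v"
  have c: "c \<in> V" using Cons.prems by (auto simp: stack_ok_def)
  have cnt: "count_list (es @ [?e]) e = (if e = ?e then 1 else 0) + count_list es e" for e
    by (simp add: count_list_append)
  have tot: "count_list ((es @ [?e]) @ map fst (walk_steps v w us)) e = 2"
    if "e \<in> set ((es @ [?e]) @ map fst (walk_steps v w us))" for e
    using Cons.prems(7)[of e] that vs by simp
  show ?case
  proof (cases "v \<in> V")
    case False
    then have e: "?e \<notin> set es" "?e \<notin> V \<times> V" using Cons.prems by (auto simp: walk_edge_def)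
    have st: "fst ` set (stack_steps c st) \<subseteq> V \<times> V" by (rule stack_steps_in) fact
    have "us \<in> tree_walks N (insert v V) v ((l, c) # st) w"
    proof (rule Cons.IH[of _ _ _ _ "es @ [?e]"])
      show "length us = length w" "set us \<subseteq> {..<N}" "finite (insert v V)" using Cons.prems vs by auto
      show "stack_ok (insert v V) v ((l, c) # st)" using Cons.prems False by (auto intro: stack_ok_push)
      show "set (es @ [?e]) \<subseteq> insert v V \<times> insert v V" using Cons.prems c by (auto simp: walk_edge_def)
      show "count_list (es @ [?e]) e = 1 \<longleftrightarrow> e \<in> fst ` set (stack_steps v ((l, c) # st))" for e
        using Cons.prems(6)[of e] e st unfolding cnt by (auto simp: count_list_0_iff)
      show "card (insert v V \<union> set us) + card (set (es @ [?e])) = card (insert v V) +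
          card (set (es @ [?e]) \<union> fst ` set (walk_steps v w us))"
        using Cons.prems(3,8) vs False e(1) by simp
    qed (rule tot)
    then show ?thesis using vs False Cons.prems by auto
  next
    case True
    \<comment> \<open>A new edge without a new vertex would be a loss that, by
      \<open>card_vertices_le\<close>, the rest of the walk cannot make up for.\<close>
    have in_es: "?e \<in> set es"
    proof (rule ccontr)
      assume "?e \<notin> set es"
      moreover have "card (V \<union> set us) + card (insert ?e (set es)) \<le> 
          card V + card (insert ?e (set es) \<union> fst ` set (walk_steps v w us))"
        using Cons.prems vs True c by (intro card_vertices_le) (auto simp: walk_edge_def)
      ultimately show False using Cons.prems(8) vs True by (simp add: insert_absorb)
    qed
    then have "count_list es ?e \<noteq> 0" by (simp add: count_list_0_iff)
    moreover have "count_list (es @ [?e]) ?e \<le> 2"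
      using tot[of ?e] by (simp add: count_list_append)
    ultimately have one: "count_list es ?e = 1" by (simp add: count_list_append)
    then have mem: "?e \<in> fst ` set (stack_steps c st)" using Cons.prems(6) by simp
    then obtain b u st' where st: "st = (b, u) # st'" by (cases st) auto
    have ok: "stack_ok V u st'" using Cons.prems(4) st by (auto intro: stack_ok_pop)
    have uc: "u \<noteq> c" using Cons.prems(4) st by (auto simp: stack_ok_def)
    have n: "walk_edge b u c \<notin> fst ` set (stack_steps u st')"
      using Cons.prems(4) st stack_top_notin by auto
    have "stack_ok (V - {c}) u st'" using Cons.prems(4) st by (auto simp: stack_ok_def)
    from stack_steps_in[OF this] have "?e \<notin> fst ` set (stack_steps u st')" by (auto simp: walk_edge_def)
    then have e: "?e = walk_edge b u c" using mem st by auto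
    \<comment> \<open>As \<open>u \<noteq> c\<close>, equal letters would put \<open>c\<close> in
      different positions of the pair, so the letters are opposite.\<close>
    then have lb: "l \<noteq> b" and v: "v = u" using uc by (auto simp: walk_edge_def split: if_splits)
    have "us \<in> tree_walks N V u st' w"
    proof (rule Cons.IH[of _ _ _ _ "es @ [?e]"])
      show "length us = length w" "set us \<subseteq> {..<N}" "finite V" "stack_ok V u st'" 
        using Cons.prems vs ok by auto
      show "set (es @ [?e]) \<subseteq> V \<times> V" using Cons.prems in_es by auto
      show "count_list (es @ [?e]) e = 1 \<longleftrightarrow> e \<in> fst ` set (stack_steps u st')" for e
        using Cons.prems(6)[of e] e n st one unfolding cnt by auto
      show "card (V \<union> set us) + card (set (es @ [?e])) = card V +
          card (set (es @ [?e]) \<union> fst ` set (walk_steps u w us))"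
        using Cons.prems(3,8) vs True in_es v by (simp add: insert_absorb)
    qed (use tot v in auto)
    then show ?thesis using vs v st lb by auto
  qed
qed

text \<open>\<open>raney m p r\<close> is the coefficient of $z^p$ in $M(z)^r$ where $M = 1 + z M^{m+1}$; the recursion is
  that of $M^{r+1} = M^r + z M^{r+1+m}$.\<close>

fun raney :: "nat \<Rightarrow> nat \<Rightarrow> nat \<Rightarrow> nat" where
  "raney m 0 r = 1"
| "raney m (Suc p) 0 = 0"
| "raney m (Suc p) (Suc r) = raney m (Suc p) r + raney m p (Suc r + m)"

text \<open>The coefficient form of M^r M^s = M^(r+s); only the first factor is unfolded along the
  recursion.\<close>

lemma raney_add: "(\<Sum>j\<le>p. raney m j r * raney m (p - j) s) = raney m p (r + s)"
proof (induction m p r rule: raney.induct)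
  case (2 m p)
  have "(\<Sum>j\<le>Suc p. raney m j 0 * raney m (Suc p - j) s) = raney m (Suc p) s"
    by (subst sum.atMost_Suc_shift) simp
  then show ?case by simp
next
  case (3 m p r)
  have "(\<Sum>j\<le>Suc p. raney m j (Suc r) * raney m (Suc p - j) s) =
    (\<Sum>j\<le>Suc p. raney m j r * raney m (Suc p - j) s) + (\<Sum>j\<le>p. raney m j (Suc r + m) * raney m (p - j) s)"
    unfolding sum.atMost_Suc_shift by (simp add: sum.distrib algebra_simps)
  with 3 show ?case by (simp add: algebra_simps)
qed simp

text \<open>Multiplied out, because the denominator (m+1)p + r vanishes at p = r = 0. The induction
  closes since both terms of the recursion belong to the same upper index \<open>n\<close>, so that
  only the ratio of two neighbouring binomial coefficients enters.\<close>

lemma raney_closed_form: "((m + 1) * p + r) * raney m p r = r * (((m + 1) * p + r) choose p)"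
proof (induction m p r rule: raney.induct)
  case (3 m p r)
  define n where "n = (m + 1) * Suc p + r"
  have n: "n > 0" "n \<ge> Suc p" by (auto simp: n_def)
  define X where "X = real (n choose p)"
  define Y where "Y = real (n choose Suc p)"
  have 1: "real n * real (raney m (Suc p) r) = real r * Y"
    using arg_cong[OF "3.IH"(1), of real] by (simp only: of_nat_mult n_def Y_def)
  have n': "(m + 1) * p + (Suc r + m) = n" by (simp add: n_def)
  have "real n * real (raney m p (Suc r + m)) = real (Suc r + m) * X"
    using arg_cong[OF "3.IH"(2), of real] unfolding n' X_def by (simp only: of_nat_mult)
  then have 2: "real n * real (raney m p (Suc r + m)) = (real r + 1 + real m) * X"
    by (simp only: of_nat_add of_nat_Suc) (simp only: add.commute add.left_commute)
  have "Suc p * (n choose Suc p) = (n - p) * (n choose p)"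
    by (simp only: binomial_absorption binomial_absorb_comp)
  then have "real (Suc p) * Y = real (n - p) * X"
    unfolding X_def Y_def of_nat_mult[symmetric] by (simp only:)
  then have 3: "(real p + 1) * Y = (real n - real p) * X"
    using n by (simp add: of_nat_diff add.commute)
  have rn: "real n = (real m + 1) * (real p + 1) + real r" by (simp add: n_def algebra_simps)
  have identity: "(n + 1) * (r * Y + (r + 1 + m) * X) = n * ((r + 1) * (X + Y))"
    if n: "n = (m + 1) * (p + 1) + r" and XY: "(p + 1) * Y = (n - p) * X" for n r m p X Y :: real
  proof -
    have "(n + 1) * (r * Y + (r + 1 + m) * X) - n * ((r + 1) * (X + Y)) =
        (n * m + r + 1 + m) * X - (n - r) * Y" by (simp add: algebra_simps)
    also have "(n - r) * Y = (m + 1) * ((p + 1) * Y)" using n by (simp add: mult.assoc)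
    also have "\<dots> = (m + 1) * ((n - p) * X)" unfolding XY ..
    also have "(n * m + r + 1 + m) * X - \<dots> = ((m + 1) * (p + 1) + r - n) * X" by (simp add: algebra_simps)
    finally show ?thesis using n by simp
  qed
  have "real n * ((real n + 1) * (real (raney m (Suc p) r) + real (raney m p (Suc r + m)))) =
     (real n + 1) * (real r * Y + (real r + 1 + real m) * X)"
    using 1 2 by (simp add: algebra_simps)
  also have "\<dots> = real n * ((real r + 1) * (X + Y))"
    by (rule identity[OF rn 3])
  finally have "(real n + 1) * (real (raney m (Suc p) r) + real (raney m p (Suc r + m))) =
     (real r + 1) * (X + Y)" using n by simp
  then have "real ((n + 1) * raney m (Suc p) (Suc r)) = real (Suc r * (Suc n choose Suc p))"
    by (simp add: X_def Y_def algebra_simps)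
  then show ?case unfolding of_nat_eq_iff by (simp add: n_def)
qed auto

text \<open>At r = 1 the closed form is the binomial coefficient of n + 1 over p divided by n + 1,
  where n = (m+1)p; absorption moves the denominator to n + 1 - p = mp + 1.\<close>

lemma raney_fuss_catalan: "real (raney m p 1) = 1 / real (m * p + 1) * real ((p * m + p) choose p)"
proof -
  define n where "n = (m + 1) * p"
  have np: "n - p = m * p" "p \<le> n" by (auto simp: n_def)
  have 1: "(n + 1) * raney m p 1 = (Suc n choose p)"
    using raney_closed_form[of m p 1] by (simp add: n_def)
  have "(Suc n - p) * (Suc n choose p) = Suc n * (n choose p)"
    using binomial_absorb_comp[of "Suc n" p] by simp
  then have "(m * p + 1) * (Suc n * raney m p 1) = Suc n * (n choose p)"
    using 1 np by (simp add: Suc_diff_le)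
  then have "(m * p + 1) * raney m p 1 = (n choose p)"
    by (simp only: mult.left_commute[of "m * p + 1"] Suc_mult_cancel1)
  then have "real (m * p + 1) * real (raney m p 1) = real ((p * m + p) choose p)"
    unfolding of_nat_mult[symmetric] of_nat_eq_iff n_def by (simp add: algebra_simps)
  moreover have "a = 1 / X * b" if "X * a = b" "X > 0" for X a b :: real
    using that by (auto simp: field_simps)
  moreover have "real (m * p + 1) > 0" by (simp only: of_nat_0_less_iff)
  ultimately show ?thesis by blast
qed

text \<open>A binomial coefficient is at most 2 to its upper index. The base
  \<open>2 ^ (m + 1)\<close> later serves as growth constant for the moments and, doubled, as
  \<open>bound\<close> for the support of the limit.\<close>

lemma raney_le: "real (raney m p 1) \<le> (2 ^ (m + 1)) ^ p"
proof -
  have "real (raney m p 1) \<le> real ((p * m + p) choose p)"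
    unfolding raney_fuss_catalan by (intro mult_left_le_one_le) (simp_all add: divide_le_eq)
  also have "\<dots> \<le> real (2 ^ (p * m + p))" by (simp only: of_nat_le_iff binomial_le_pow2)
  also have "\<dots> = 2 ^ (p * m + p)" by simp
  also have "\<dots> = (2 ^ (m + 1)) ^ p" by (simp add: power_mult[symmetric] power_add[symmetric] algebra_simps)
  finally show ?thesis .
qed

text \<open>The word $(X^m (X^*)^m)^p$ moves between the levels $0, \dots, m$, and both ends of an open
  edge have determined levels. \<open>zigzag m k d L\<close> consists of the next \<open>L\<close> letters from level \<open>k\<close>, moving
  down if \<open>d\<close> holds. In terms of $M$ above, the generating function for the ways to close a given
  stack is $M^r$ with \<open>r = stack_weight m k d s\<close>, and \<open>stack_length m k d s\<close> is the length of
  the shortest way.\<close>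

fun zigzag :: "nat \<Rightarrow> nat \<Rightarrow> bool \<Rightarrow> nat \<Rightarrow> bool list" where
  "zigzag m k d 0 = []"
| "zigzag m k False (Suc L) =
     (if k < m then False # zigzag m (k + 1) False L else True # zigzag m (k - 1) True L)"
| "zigzag m k True (Suc L) =
     (if k > 0 then True # zigzag m (k - 1) True L else False # zigzag m 1 False L)"

fun stack_level :: "nat \<Rightarrow> nat \<Rightarrow> bool list \<Rightarrow> bool" where
  "stack_level m k [] \<longleftrightarrow> k = 0"
| "stack_level m k (False # s) \<longleftrightarrow> 1 \<le> k \<and> k \<le> m \<and> stack_level m (k - 1) s"
| "stack_level m k (True # s) \<longleftrightarrow> k + 1 \<le> m \<and> stack_level m (k + 1) s"

fun stack_weight :: "nat \<Rightarrow> nat \<Rightarrow> bool \<Rightarrow> bool list \<Rightarrow> nat" where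
  "stack_weight m k d [] = 1"
| "stack_weight m k d (False # s) = (if d then 1 else m + 1 - k) + stack_weight m (k - 1) True s"
| "stack_weight m k d (True # s) = (if d then k + 1 else 1) + stack_weight m (k + 1) False s"

fun stack_length :: "nat \<Rightarrow> nat \<Rightarrow> bool \<Rightarrow> bool list \<Rightarrow> nat" where
  "stack_length m k d [] = 0"
| "stack_length m k d (False # s) = (if d then 1 else 2 * (m - k) + 1) + stack_length m (k - 1) True s"
| "stack_length m k d (True # s) = (if d then 2 * k + 1 else 1) + stack_length m (k + 1) False s"



text \<open>If the coming letter cannot close the top of the stack, a push is forced; it keeps the
  weight and shortens the remaining length by the letter read. If it can, popping leaves weight w,
  while pushing postpones the closing by one full period, which costs 2 m letters and adds m + 1 to
  w: this is M^(w+1) = M^w + z M^(w+1+m). The vanishing claim covers the pushes after which too few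
  letters remain.\<close>

lemma pairings_zigzag_aux:
  assumes "m \<ge> 1" "k \<le> m" "stack_level m k s"
  shows "(L < stack_length m k d s \<longrightarrow> pairings s (zigzag m k d L) = 0) \<and>
    (\<forall>p. L = 2 * m * p + stack_length m k d s \<longrightarrow>
      pairings s (zigzag m k d L) = raney m p (stack_weight m k d s))"
  using assms(2,3)
proof (induction L arbitrary: k d s)
  case 0
  have "stack_length m k d s > 0" if "s \<noteq> []"
    using that by (cases s; cases "hd s") auto
  then show ?case using \<open>m \<ge> 1\<close> by (cases "s = []") auto
next
  case (Suc L)
  let ?claim = "\<lambda>k d s. (Suc L < stack_length m k d s \<longrightarrow> pairings s (zigzag m k d (Suc L)) = 0) \<and>
    (\<forall>p. Suc L = 2 * m * p + stack_length m k d s \<longrightarrow>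
      pairings s (zigzag m k d (Suc L)) = raney m p (stack_weight m k d s))"
  have up: "?claim k False s" if k: "k < m" "stack_level m k s" for k s
  proof (cases s)
    case Nil
    \<comment> \<open>With nothing open the word is at level 0 and a push is forced. As a letter has
      been read, p > 0, and only the term z M^(m+1) of M contributes.\<close>
    have push: "(\<forall>p. L = 2 * m * p + (2 * (m - 1) + 1) \<longrightarrow>
      pairings [False] (zigzag m 1 False L) = raney m p (Suc m))"
      using Suc.IH[of 1 "[False]" False] \<open>m \<ge> 1\<close> by simp
    have "pairings [False] (zigzag m 1 False L) = raney m p 1" if p: "Suc L = 2 * m * p" for p
    proof (cases p)
      case (Suc p')
      then have "L = 2 * m * p' + (2 * (m - 1) + 1)" using p \<open>m \<ge> 1\<close> by (simp add: algebra_simps)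
      with push Suc show ?thesis by simp
    qed (use p in simp)
    moreover have "pairings [] (zigzag m 0 False (Suc L)) = pairings [False] (zigzag m 1 False L)"
      using k Nil by simp
    ultimately show ?thesis using Nil k by (metis stack_length.simps(1) stack_level.simps(1)
        stack_weight.simps(1) not_less_zero add_0_right)
  next
    case (Cons b s')
    show ?thesis
    proof (cases b)
      case False
      have "2 * (m - k) + 1 = Suc (2 * (m - (k + 1)) + 1 + 1)" "m + 1 - k = Suc (m + 1 - (k + 1))"
        using k by auto
      then show ?thesis using Suc.IH[of "k + 1" "False # s" False] k Cons False by simp
    next
      case True
      have lv: "k + 1 \<le> m" "stack_level m (k + 1) s'" using k Cons True by auto
      let ?P = "pairings (False # s) (zigzag m (k + 1) False L)" and ?Q = "pairings s' (zigzag m (k + 1) False L)"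
      define l' where "l' = stack_length m (k + 1) False s'"
      define w' where "w' = stack_weight m (k + 1) False s'"
      have "stack_length m (k + 1) False (False # s) = 2 * m + l'"
        "stack_weight m (k + 1) False (False # s) = Suc m + w'" "stack_level m (k + 1) (False # s)"
        using lv k Cons True by (simp_all add: l'_def w'_def)
      then have push: "(L < 2 * m + l' \<longrightarrow> ?P = 0) \<and>
         (\<forall>p. L = 2 * m * p + (2 * m + l') \<longrightarrow>
          ?P = raney m p (Suc m + w'))"
        using Suc.IH[of "k + 1" "False # s" False] lv by metis
      have pop: "(L < l' \<longrightarrow> ?Q = 0) \<and>
         (\<forall>p. L = 2 * m * p + l' \<longrightarrow>
          ?Q = raney m p w')"
        using Suc.IH[of "k + 1" s' False] lv unfolding l'_def w'_def by blast
      have "?P + ?Q =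
         raney m p (Suc w')" if "Suc L = 2 * m * p + Suc l'" for p
      proof -
        have L: "L = 2 * m * p + l'" using that by simp
        then have v: "?Q = raney m p w'" using pop by blast
        show ?thesis
        proof (cases p)
          case 0
          then have "L < 2 * m + l'" using L \<open>m \<ge> 1\<close> by simp
          then have "?P = 0" using push by blast
          with v 0 show ?thesis by simp
        next
          case (Suc p')
          then have "L = 2 * m * p' + (2 * m + l')" using L by simp
          then have "?P = raney m p' (Suc m + w')"
            using push by blast
          with v Suc show ?thesis by (simp add: add.commute)
        qed
      qed
      moreover have "pairings s (zigzag m k False (Suc L)) =
          ?P + ?Q"
        "stack_length m k False s = Suc l'" "stack_weight m k False s = Suc w'"
        using k Cons True by (simp_all add: l'_def w'_def)
      moreover have "Suc L < Suc l' \<Longrightarrow> ?P +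
          ?Q = 0"
        using push pop by simp
      ultimately show ?thesis by metis
    qed
  qed
  have down: "?claim k True s" if k: "k \<le> m" "0 < k" "stack_level m k s" for k s
  proof (cases s)
    case Nil
    then show ?thesis using k by simp
  next
    case (Cons b s')
    show ?thesis
    proof (cases b)
      case True
      have eqs: "stack_length m k True s = Suc (stack_length m (k - 1) True (True # s))"
        "stack_weight m k True s = stack_weight m (k - 1) True (True # s)"
        "pairings s (zigzag m k True (Suc L)) = pairings (True # s) (zigzag m (k - 1) True L)"
        using k Cons True by (cases k; simp)+
      have "stack_level m (k - 1) (True # s)" "k - 1 \<le> m"
        using k Cons True by (cases k; simp)+
      from Suc.IH[OF this(2,1), of True] show ?thesis
        unfolding eqs Suc_less_eq add_Suc_right nat.inject .
    next
      case False
      have lv: "stack_level m (k - 1) s'" using k Cons False by auto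
      let ?P = "pairings (True # s) (zigzag m (k - 1) True L)" and ?Q = "pairings s' (zigzag m (k - 1) True L)"
      define l' where "l' = stack_length m (k - 1) True s'"
      define w' where "w' = stack_weight m (k - 1) True s'"
      have "stack_length m (k - 1) True (True # s) = 2 * m + l'"
        "stack_weight m (k - 1) True (True # s) = Suc m + w'" "stack_level m (k - 1) (True # s)"
        using lv k Cons False by (simp_all add: l'_def w'_def)
      then have push: "(L < 2 * m + l' \<longrightarrow> ?P = 0) \<and>
         (\<forall>p. L = 2 * m * p + (2 * m + l') \<longrightarrow>
          ?P = raney m p (Suc m + w'))"
        using Suc.IH[of "k - 1" "True # s" True] k by (metis diff_le_self le_trans)
      have pop: "(L < l' \<longrightarrow> ?Q = 0) \<and>
         (\<forall>p. L = 2 * m * p + l' \<longrightarrow>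
          ?Q = raney m p w')"
        using Suc.IH[OF le_trans[OF diff_le_self k(1)] lv, of True] unfolding l'_def w'_def .
      have "?P + ?Q =
         raney m p (Suc w')" if "Suc L = 2 * m * p + Suc l'" for p
      proof -
        have L: "L = 2 * m * p + l'" using that by simp
        then have v: "?Q = raney m p w'" using pop by blast
        show ?thesis
        proof (cases p)
          case 0
          then have "L < 2 * m + l'" using L \<open>m \<ge> 1\<close> by simp
          then have "?P = 0" using push by blast
          with v 0 show ?thesis by simp
        next
          case (Suc p')
          then have "L = 2 * m * p' + (2 * m + l')" using L by simp
          then have "?P = raney m p' (Suc m + w')"
            using push by blast
          with v Suc show ?thesis by (simp add: add.commute)
        qed
      qed
      moreover have "pairings s (zigzag m k True (Suc L)) =
          ?P + ?Q"
        "stack_length m k True s = Suc l'" "stack_weight m k True s = Suc w'"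
        using k Cons False by (simp_all add: l'_def w'_def)
      moreover have "Suc L < Suc l' \<Longrightarrow> ?P +
          ?Q = 0"
        using push pop by simp
      ultimately show ?thesis by metis
    qed
  qed
  \<comment> \<open>At a turning point both directions produce the same letter, so the two weights
    and lengths have to agree. Level 0 thus falls under the upward claim, and level m below under
    the downward one.\<close>
  have bottom: "?claim 0 True s = ?claim 0 False s" if "stack_level m 0 s" for s
  proof -
    have "stack_length m 0 True s = stack_length m 0 False s"
      "stack_weight m 0 True s = stack_weight m 0 False s"
      using that by (cases s; cases "hd s"; simp)+
    moreover have "zigzag m 0 True (Suc L) = zigzag m 0 False (Suc L)" using \<open>m \<ge> 1\<close> by simp
    ultimately show ?thesis by (simp only:)
  qed
  have peak: "?claim m True s = ?claim m False s" if "stack_level m m s" for s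
  proof -
    have "stack_length m m True s = stack_length m m False s"
      "stack_weight m m True s = stack_weight m m False s"
      using that by (cases s; cases "hd s"; simp)+
    moreover have "zigzag m m True (Suc L) = zigzag m m False (Suc L)" using \<open>m \<ge> 1\<close> by simp
    ultimately show ?thesis by (simp only:)
  qed
  consider "d" "0 < k" | "d" "k = 0" | "\<not> d" "k < m" | "\<not> d" "k = m" using Suc.prems by linarith
  then show ?case
  proof cases
    case 1
    then have d: "d = True" by simp
    show ?thesis unfolding d by (rule down[OF Suc.prems(1) 1(2) Suc.prems(2)])
  next
    case 2
    then have d: "d = True" "k = 0" and s: "stack_level m 0 s" "0 < m" using Suc.prems \<open>m \<ge> 1\<close> by simp_all
    show ?thesis unfolding d bottom[OF s(1)] by (rule up[OF s(2,1)])
  next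
    case 3
    then have d: "d = False" by simp
    show ?thesis unfolding d by (rule up[OF 3(2) Suc.prems(2)])
  next
    case 4
    then have d: "d = False" "k = m" and s: "stack_level m m s" "0 < m" using Suc.prems \<open>m \<ge> 1\<close> by simp_all
    show ?thesis unfolding d peak[OF s(1), symmetric] by (rule down[OF order_refl s(2,1)])
  qed
qed

section \<open>The word of the power covariance matrix\<close>

definition covariance_word :: "nat \<Rightarrow> nat \<Rightarrow> bool list" where
  "covariance_word m p = concat (replicate p (replicate m False @ replicate m True))"

lemma length_covariance_word: "length (covariance_word m p) = 2 * m * p"
  by (induction p) (auto simp: covariance_word_def)

lemma zigzag_up: "k \<le> m \<Longrightarrow> zigzag m k False (L + (m - k)) = replicate (m - k) False @ zigzag m m False L"
proof (induction "m - k" arbitrary: k)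
  case (Suc n)
  then have "m - k = Suc (m - (k + 1))" by auto
  then show ?case using Suc.hyps(1)[of "k + 1"] Suc.hyps(2) Suc.prems by auto
qed simp

lemma zigzag_down: "zigzag m k True (L + k) = replicate k True @ zigzag m 0 True L"
  by (induction k) auto

lemma zigzag_eq_covariance_word:
  assumes "m \<ge> 1"
  shows "zigzag m 0 False (2 * m * p) = covariance_word m p"
proof (induction p)
  case (Suc p)
  have "zigzag m 0 False (2 * m * Suc p) = zigzag m 0 False ((2 * m * p + m) + (m - 0))"
    by (simp add: algebra_simps)
  also have "\<dots> = replicate m False @ zigzag m m False (2 * m * p + m)"
    by (subst zigzag_up) auto
  also have "zigzag m m False (2 * m * p + m) = zigzag m m True (2 * m * p + m)"
    using assms by (cases "2 * m * p + m") auto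
  also have "\<dots> = replicate m True @ zigzag m 0 True (2 * m * p)" by (rule zigzag_down)
  also have "zigzag m 0 True (2 * m * p) = zigzag m 0 False (2 * m * p)"
    using assms by (cases "2 * m * p") auto
  finally show ?case using Suc.IH by (simp add: covariance_word_def)
qed (simp add: covariance_word_def)

lemma pairings_covariance_word:
  assumes "m \<ge> 1"
  shows "pairings [] (covariance_word m p) = raney m p 1"
  using pairings_zigzag_aux[OF assms, of 0 "[]" "2 * m * p" False]
  by (simp add: zigzag_eq_covariance_word[OF assms])

section \<open>Sums over closed walks\<close>

text \<open>A closed walk is given by the vertices reached by its successive steps, so it starts at the last
  vertex of the list.\<close>

definition closed_walks :: "nat \<Rightarrow> nat \<Rightarrow> nat list set" where
  "closed_walks N n = {vs. set vs \<subseteq> {..<N} \<and> length vs = n}"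

lemma finite_closed_walks: "finite (closed_walks N n)"
  unfolding closed_walks_def by (rule finite_lists_length_eq) simp

lemma closed_walks_Suc: "closed_walks N (Suc n) = (\<lambda>(v, vs). v # vs) ` ({..<N} \<times> closed_walks N n)"
proof (intro equalityI subsetI)
  fix x assume "x \<in> closed_walks N (Suc n)"
  then show "x \<in> (\<lambda>(v, vs). v # vs) ` ({..<N} \<times> closed_walks N n)"
    by (cases x) (auto simp: closed_walks_def)
qed (auto simp: closed_walks_def)

lemma sum_closed_walks_Suc:
  "(\<Sum>us\<in>closed_walks N (Suc n). f us) = (\<Sum>v<N. \<Sum>vs\<in>closed_walks N n. f (v # vs))"
proof -
  have "inj_on (\<lambda>(v, vs). v # vs) ({..<N} \<times> closed_walks N n)" by (auto simp: inj_on_def)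
  then show ?thesis
    by (simp add: closed_walks_Suc sum.reindex sum.cartesian_product split_def)
qed

text \<open>Prepending a vertex multiplies the sum by at most n + 1: a new vertex has at most N
  choices and costs 1/N, while one of the at most n old vertices costs nothing. The bound is
  therefore free of N.\<close>

lemma sum_closed_walks_card_le:
  assumes "N \<ge> 1"
  shows "(\<Sum>vs\<in>closed_walks N n. (1 / real N) ^ card (set vs)) \<le> fact n"
proof (induction n)
  case 0
  have "closed_walks N 0 = {[]}" by (auto simp: closed_walks_def)
  then show ?case by simp
next
  case (Suc n)
  let ?q = "1 / real N"
  have step: "(\<Sum>v<N. ?q ^ card (set (v # vs))) \<le> real (Suc n) * ?q ^ card (set vs)"
    if vs: "vs \<in> closed_walks N n" for vs
  proof -
    have sub: "set vs \<subseteq> {..<N}" and len: "length vs = n" using vs by (auto simp: closed_walks_def)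
    have "(\<Sum>v<N. ?q ^ card (set (v # vs))) =
        (\<Sum>v\<in>{..<N} - set vs. ?q ^ card (set (v # vs))) + (\<Sum>v\<in>set vs. ?q ^ card (set (v # vs)))"
      by (rule sum.subset_diff[OF sub]) simp
    also have "(\<Sum>v\<in>{..<N} - set vs. ?q ^ card (set (v # vs))) =
        (\<Sum>v\<in>{..<N} - set vs. ?q ^ Suc (card (set vs)))"
      by (intro sum.cong) auto
    also have "\<dots> = real (N - card (set vs)) * ?q ^ Suc (card (set vs))"
      using sub by (simp add: card_Diff_subset)
    also have "\<dots> \<le> real N * ?q ^ Suc (card (set vs))" by (intro mult_right_mono) auto
    also have "\<dots> = ?q ^ card (set vs)" using assms by simp
    also have "(\<Sum>v\<in>set vs. ?q ^ card (set (v # vs))) = real (card (set vs)) * ?q ^ card (set vs)"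
      by (simp add: insert_absorb)
    also have "\<dots> \<le> real n * ?q ^ card (set vs)"
      using card_length[of vs] len by (intro mult_right_mono) auto
    finally show ?thesis by (simp add: algebra_simps)
  qed
  have "(\<Sum>vs\<in>closed_walks N (Suc n). ?q ^ card (set vs)) =
      (\<Sum>vs\<in>closed_walks N n. \<Sum>v<N. ?q ^ card (set (v # vs)))"
    unfolding sum_closed_walks_Suc by (rule sum.swap)
  also have "\<dots> \<le> (\<Sum>vs\<in>closed_walks N n. real (Suc n) * ?q ^ card (set vs))"
    by (intro sum_mono step)
  also have "\<dots> = real (Suc n) * (\<Sum>vs\<in>closed_walks N n. ?q ^ card (set vs))"
    by (rule sum_distrib_left[symmetric])
  also have "\<dots> \<le> real (Suc n) * fact n" by (intro mult_left_mono Suc.IH) simp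
  finally show ?case by simp
qed

lemma count_list_map_fst: "count_list (map fst xs) e = length (filter (\<lambda>x. fst x = e) xs)"
  by (induction xs) auto

lemma walk_steps_in:
  "set vs \<subseteq> {..<N} \<Longrightarrow> c < N \<Longrightarrow> fst ` set (walk_steps c w vs) \<subseteq> {..<N} \<times> {..<N}"
  by (induction c w vs rule: walk_steps.induct) (auto simp: walk_edge_def)

lemma closed_walk_steps_in:
  assumes "vs \<in> closed_walks N (length w)" "w \<noteq> []"
  shows "fst ` set (walk_steps (last vs) w vs) \<subseteq> {..<N} \<times> {..<N}"
proof (rule walk_steps_in)
  have "vs \<noteq> []" using assms by (auto simp: closed_walks_def)
  then have "last vs \<in> set vs" by simp
  then show "last vs < N" using assms by (auto simp: closed_walks_def)
qed (use assms in \<open>auto simp: closed_walks_def\<close>)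

text \<open>A traversal ends at its root, so the root can be read off the list, and traversals from
  different roots are different.\<close>

lemma closed_tree_walks:
  assumes "w \<noteq> []"
  shows "{vs \<in> closed_walks N (length w). vs \<in> tree_walks N {last vs} (last vs) [] w} =
      (\<Union>a<N. tree_walks N {a} a [] w)" (is "?L = ?R")
    and "card {vs \<in> closed_walks N (length w). vs \<in> tree_walks N {last vs} (last vs) [] w} =
      N * (pairings [] w * (\<Prod>i<length w div 2. N - 1 - i))"
proof -
  have props: "length vs = length w \<and> set vs \<subseteq> {..<N} \<and> last vs = a"
    if "vs \<in> tree_walks N {a} a [] w" "a < N" for vs a
    using tree_walks_props[OF that(1)] that(2) assms by (auto split: if_splits)
  show eq: "?L = ?R"
  proof (intro equalityI subsetI)
    fix vs assume "vs \<in> ?L"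
    moreover from this have "vs \<noteq> []" using assms by (auto simp: closed_walks_def)
    ultimately have "last vs < N" using last_in_set by (fastforce simp: closed_walks_def)
    with \<open>vs \<in> ?L\<close> show "vs \<in> ?R" by auto
  next
    fix vs assume "vs \<in> ?R"
    then show "vs \<in> ?L" using props by (auto simp: closed_walks_def)
  qed
  have "card ?R = (\<Sum>a<N. card (tree_walks N {a} a [] w))"
    by (rule card_UN_disjoint) (use props finite_tree_walks in blast)+
  also have "\<dots> = (\<Sum>a<N. pairings [] w * (\<Prod>i<length w div 2. N - 1 - i))"
    by (intro sum.cong refl, subst card_tree_walks) (auto simp: stack_ok_def)
  finally show "card ?L = N * (pairings [] w * (\<Prod>i<length w div 2. N - 1 - i))"
    unfolding eq by simp
qed

text \<open>A closed walk on $v$ vertices uses at least $v - 1$ edges. It contributes negligibly unless it uses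
  exactly $v - 1$ edges, each of them twice.\<close>

lemma closed_walk_sum_estimate:
  fixes wt :: "nat list \<Rightarrow> complex"
  assumes "N \<ge> 1" "w \<noteq> []" "\<beta> \<ge> 0" "\<gamma> \<ge> 0"
  defines "E \<equiv> \<lambda>vs. fst ` set (walk_steps (last vs) w vs)"
  assumes wt_le: "\<And>vs. vs \<in> closed_walks N (length w) \<Longrightarrow> cmod (wt vs) \<le> (1 / real N) ^ card (E vs)"
    and wt_small: "\<And>vs e. vs \<in> closed_walks N (length w) \<Longrightarrow> e \<in> E vs \<Longrightarrow>
      length (filter (\<lambda>x. fst x = e) (walk_steps (last vs) w vs)) \<noteq> 2 \<Longrightarrow>
      cmod (wt vs) \<le> \<beta> * (1 / real N) ^ card (E vs)"
    and wt_tree: "\<And>vs. vs \<in> closed_walks N (length w) \<Longrightarrow> vs \<in> tree_walks N {last vs} (last vs) [] w \<Longrightarrow>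
      cmod (wt vs - (1 / real N) ^ (length w div 2)) \<le> \<gamma> * (1 / real N) ^ (length w div 2)"
  shows "cmod ((\<Sum>vs\<in>closed_walks N (length w). wt vs) / of_nat N -
      of_real (real (pairings [] w) * (\<Prod>i<length w div 2. real (N - 1 - i) / real N)))
    \<le> fact (length w) * (\<beta> + 1 / real N) + \<gamma> * real (pairings [] w)"
proof -
  let ?q = "1 / real N" and ?h = "length w div 2"
  let ?C = "closed_walks N (length w)"
  let ?T = "{vs \<in> ?C. vs \<in> tree_walks N {last vs} (last vs) [] w}"
  let ?P = "\<Prod>i<?h. real (N - 1 - i) / real N"
  have P: "?P \<le> 1" "0 \<le> ?P"
    by (intro prod_le_1) (auto simp: divide_le_eq_1 intro: prod_nonneg)
  have card_T: "real (card ?T) / real N * ?q ^ ?h = real (pairings [] w) * ?P"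
    unfolding closed_tree_walks(2)[OF assms(2)] using \<open>N \<ge> 1\<close>
    by (simp add: prod_dividef power_divide)
  have "cmod (\<Sum>vs\<in>?C - ?T. wt vs / of_nat N) \<le> (\<Sum>vs\<in>?C - ?T. (\<beta> + ?q) * ?q ^ card (set vs))"
  proof (rule sum_norm_le)
    fix vs assume vs: "vs \<in> ?C - ?T"
    then have len: "length vs = length w" and sub: "set vs \<subseteq> {..<N}" by (auto simp: closed_walks_def)
    have ne: "vs \<noteq> []" using len assms(2) by auto
    have last: "last vs \<in> set vs" using ne by simp
    have V: "{last vs} \<union> set vs = set vs" using last by auto
    have le: "card (set vs) \<le> Suc (card (E vs))"
      using card_vertices_le[OF len, of "{last vs}" "last vs" "{}"] unfolding V E_def by simp
    have "cmod (wt vs) / real N \<le> (\<beta> + ?q) * ?q ^ card (set vs)"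
    proof (cases "card (set vs) \<le> card (E vs)")
      case True
      \<comment> \<open>With at least as many edges as vertices the edge weights alone pay for the
        vertices, and the normalisation 1/N is left over.\<close>
      have "cmod (wt vs) / real N \<le> ?q * ?q ^ card (E vs)"
        using wt_le[of vs] vs by (simp add: divide_right_mono)
      also have "\<dots> \<le> ?q * ?q ^ card (set vs)"
        using True \<open>N \<ge> 1\<close> by (intro mult_left_mono power_decreasing) auto
      also have "\<dots> \<le> (\<beta> + ?q) * ?q ^ card (set vs)"
        using \<open>\<beta> \<ge> 0\<close> by (intro mult_right_mono) auto
      finally show ?thesis .
    next
      case False
      then have card: "card (set vs) = Suc (card (E vs))" using le by simp
      have "\<exists>e\<in>E vs. length (filter (\<lambda>x. fst x = e) (walk_steps (last vs) w vs)) \<noteq> 2"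
      proof (rule ccontr)
        assume "\<not> ?thesis"
        then have "vs \<in> tree_walks N {last vs} (last vs) [] w"
          using len sub V card
          by (intro tree_walksI[where es = "[]"]) 
            (auto simp: stack_ok_def E_def count_list_map_fst simp flip: filter_map)
        with vs show False by simp
      qed
      then have "cmod (wt vs) \<le> \<beta> * ?q ^ card (E vs)" using wt_small vs by blast
      then have "cmod (wt vs) / real N \<le> \<beta> * ?q ^ card (set vs)"
        using \<open>N \<ge> 1\<close> unfolding card by (simp add: field_simps)
      also have "\<dots> \<le> (\<beta> + ?q) * ?q ^ card (set vs)"
        by (intro mult_right_mono) auto
      finally show ?thesis .
    qed
    then show "cmod (wt vs / of_nat N) \<le> (\<beta> + ?q) * ?q ^ card (set vs)"
      by (simp add: norm_divide)
  qed
  also have "\<dots> \<le> (\<Sum>vs\<in>?C. (\<beta> + ?q) * ?q ^ card (set vs))"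
    using \<open>\<beta> \<ge> 0\<close> by (intro sum_mono2 finite_closed_walks) auto
  also have "\<dots> = (\<beta> + ?q) * (\<Sum>vs\<in>?C. ?q ^ card (set vs))" by (rule sum_distrib_left[symmetric])
  also have "\<dots> \<le> (\<beta> + ?q) * fact (length w)"
    using \<open>\<beta> \<ge> 0\<close> by (intro mult_left_mono sum_closed_walks_card_le assms) auto
  finally have rest: "cmod (\<Sum>vs\<in>?C - ?T. wt vs / of_nat N) \<le> (\<beta> + ?q) * fact (length w)" .
  have "cmod (\<Sum>vs\<in>?T. (wt vs - ?q ^ ?h) / of_nat N) \<le> (\<Sum>vs\<in>?T. \<gamma> * ?q ^ ?h / real N)"
    using wt_tree by (intro sum_norm_le) (auto simp: norm_divide intro!: divide_right_mono)
  also have "\<dots> = \<gamma> * (real (card ?T) / real N * ?q ^ ?h)" by simp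
  also have "\<dots> \<le> \<gamma> * real (pairings [] w)"
    unfolding card_T using P \<open>\<gamma> \<ge> 0\<close> by (intro mult_left_mono mult_left_le) auto
  finally have tree: "cmod (\<Sum>vs\<in>?T. (wt vs - ?q ^ ?h) / of_nat N) \<le> \<gamma> * real (pairings [] w)" .
  have "(\<Sum>vs\<in>?C. wt vs) / of_nat N = (\<Sum>vs\<in>?C. wt vs / of_nat N)" by (rule sum_divide_distrib)
  also have "\<dots> = (\<Sum>vs\<in>?C - ?T. wt vs / of_nat N) + (\<Sum>vs\<in>?T. wt vs / of_nat N)"
    by (rule sum.subset_diff) (auto simp: finite_closed_walks)
  also have "(\<Sum>vs\<in>?T. wt vs / of_nat N) = (\<Sum>vs\<in>?T. (wt vs - ?q ^ ?h) / of_nat N) +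
      of_real (real (card ?T) / real N * ?q ^ ?h)"
    by (simp add: diff_divide_distrib sum_subtractf)
  finally have "(\<Sum>vs\<in>?C. wt vs) / of_nat N - of_real (real (pairings [] w) * ?P) =
      (\<Sum>vs\<in>?C - ?T. wt vs / of_nat N) + (\<Sum>vs\<in>?T. (wt vs - ?q ^ ?h) / of_nat N)"
    unfolding card_T by (simp add: algebra_simps)
  then have "cmod ((\<Sum>vs\<in>?C. wt vs) / of_nat N - of_real (real (pairings [] w) * ?P)) \<le>
      (\<beta> + ?q) * fact (length w) + \<gamma> * real (pairings [] w)"
    using norm_triangle_mono[OF rest tree] by simp
  then show ?thesis by (simp add: mult.commute)
qed

lemma falling_ratio_tendsto: "(\<lambda>N. \<Prod>i<h. real (N - 1 - i) / real N) \<longlonglongrightarrow> 1"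
proof -
  have "(\<lambda>N. real (N - 1 - i) / real N) \<longlonglongrightarrow> 1" for i
  proof (rule Lim_transform_eventually)
    have "(\<lambda>N. 1 - (1 + real i) * (1 / real N)) \<longlonglongrightarrow> 1 - (1 + real i) * 0"
      by (intro tendsto_intros lim_1_over_n)
    then show "(\<lambda>N. 1 - (1 + real i) * (1 / real N)) \<longlonglongrightarrow> 1" by simp
    show "\<forall>\<^sub>F N in sequentially. 1 - (1 + real i) * (1 / real N) = real (N - 1 - i) / real N"
      using eventually_ge_at_top[of "Suc i"]
      by eventually_elim (auto simp: field_simps of_nat_diff)
  qed
  then have "(\<lambda>N. \<Prod>i<h. real (N - 1 - i) / real N) \<longlonglongrightarrow> (\<Prod>i<h. 1)"
    by (intro tendsto_prod)
  then show ?thesis by simp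
qed

section \<open>Expected products along a walk with independent entries\<close>

definition step_value :: "((nat \<times> nat) \<Rightarrow> complex) \<Rightarrow> (nat \<times> nat) \<times> bool \<Rightarrow> complex" where
  "step_value z x = (if snd x then cnj (z (fst x)) else z (fst x))"

text \<open>Collects the factors of a walk that belong to the same matrix entry, the form in which
  independence applies.\<close>

lemma prod_list_group:
  fixes f :: "'b \<times> 'c \<Rightarrow> 'd :: comm_monoid_mult"
  assumes "finite A" "fst ` set xs \<subseteq> A"
  shows "(\<Prod>x\<leftarrow>xs. f x) = (\<Prod>e\<in>A. \<Prod>x\<leftarrow>filter (\<lambda>x. fst x = e) xs. f x)"
  using assms(2)
proof (induction xs)
  case (Cons x xs)
  have "(\<Prod>e\<in>A. \<Prod>y\<leftarrow>filter (\<lambda>y. fst y = e) (x # xs). f y) =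
      (\<Prod>e\<in>A. (if e = fst x then f x else 1) * (\<Prod>y\<leftarrow>filter (\<lambda>y. fst y = e) xs. f y))"
    by (intro prod.cong) auto
  also have "\<dots> = f x * (\<Prod>e\<in>A. \<Prod>y\<leftarrow>filter (\<lambda>y. fst y = e) xs. f y)"
    using Cons.prems assms(1) by (simp add: prod.distrib)
  finally show ?case using Cons by simp
qed simp

lemma sum_length_filter:
  assumes "finite A" "fst ` set xs \<subseteq> A"
  shows "(\<Sum>e\<in>A. length (filter (\<lambda>x. fst x = e) xs)) = length xs"
  using assms(2)
proof (induction xs)
  case (Cons x xs)
  have "(\<Sum>e\<in>A. length (filter (\<lambda>y. fst y = e) (x # xs))) =
      (\<Sum>e\<in>A. (if e = fst x then 1 else 0) + length (filter (\<lambda>y. fst y = e) xs))"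
    by (intro sum.cong) auto
  also have "\<dots> = Suc (\<Sum>e\<in>A. length (filter (\<lambda>y. fst y = e) xs))"
    using Cons.prems assms(1) by (simp add: sum.distrib)
  finally show ?case using Cons by simp
qed simp

lemma prod_list_measurable [measurable (raw)]:
  fixes f :: "'b \<Rightarrow> 'c \<Rightarrow> complex"
  assumes "\<And>x. x \<in> set xs \<Longrightarrow> (\<lambda>\<omega>. f x \<omega>) \<in> borel_measurable M"
  shows "(\<lambda>\<omega>. \<Prod>x\<leftarrow>xs. f x \<omega>) \<in> borel_measurable M"
  using assms by (induction xs) auto

lemma norm_step_value_prod:
  assumes "\<And>x. x \<in> set xs \<Longrightarrow> fst x = e"
  shows "cmod (\<Prod>x\<leftarrow>xs. step_value z x) = cmod (z e) ^ length xs"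
  using assms by (induction xs) (auto simp: norm_mult step_value_def)

context prob_space begin

lemma expectation_step_values:
  fixes z :: "nat \<times> nat \<Rightarrow> 'a \<Rightarrow> complex"
  assumes ind: "indep_vars (\<lambda>_. borel) z I" and fin: "finite I"
    and bd: "\<And>e \<omega>. e \<in> I \<Longrightarrow> cmod (z e \<omega>) \<le> 1"
    and sub: "fst ` set xs \<subseteq> I"
  shows "expectation (\<lambda>\<omega>. \<Prod>x\<leftarrow>xs. step_value (\<lambda>e. z e \<omega>) x) =
    (\<Prod>e\<in>fst ` set xs. expectation (\<lambda>\<omega>. \<Prod>x\<leftarrow>filter (\<lambda>x. fst x = e) xs. step_value (\<lambda>e. z e \<omega>) x))"
proof -
  let ?E = "fst ` set xs"
  \<comment> \<open>Written as a function of one complex number, so that each group of factors is a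
    measurable image of a single entry.\<close>
  define Y where "Y e \<zeta> = (\<Prod>x\<leftarrow>filter (\<lambda>x. fst x = e) xs. if snd x then cnj \<zeta> else \<zeta>)" for e :: "nat \<times> nat" and \<zeta>
  have Y: "(\<Prod>x\<leftarrow>filter (\<lambda>x. fst x = e) xs. step_value (\<lambda>e. z e \<omega>) x) = Y e (z e \<omega>)" for e \<omega>
    unfolding Y_def step_value_def by (intro arg_cong[where f = prod_list] map_cong) auto
  have Ym: "Y e \<in> borel_measurable borel" for e
    unfolding Y_def
  proof (rule prod_list_measurable)
    show "(\<lambda>\<zeta>. if snd x then cnj \<zeta> else \<zeta>) \<in> borel_measurable borel" for x :: "(nat \<times> nat) \<times> bool"
      by (cases "snd x") (auto intro!: borel_measurable_continuous_onI continuous_intros)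
  qed
  have zm: "z e \<in> borel_measurable M" if "e \<in> I" for e
    using ind that unfolding indep_vars_def by auto
  have "indep_vars (\<lambda>_. borel) z ?E" by (rule indep_vars_subset[OF ind sub])
  then have ind': "indep_vars (\<lambda>_. borel) (\<lambda>e \<omega>. Y e (z e \<omega>)) ?E"
    by (rule indep_vars_compose2) (use Ym in auto)
  have int: "integrable M (\<lambda>\<omega>. Y e (z e \<omega>))" if e: "e \<in> ?E" for e
  proof (rule integrable_const_bound[where B = 1])
    show "AE \<omega> in M. cmod (Y e (z e \<omega>)) \<le> 1"
      unfolding Y[symmetric] using bd e sub
      by (intro AE_I2, subst norm_step_value_prod[where e = e]) (auto intro!: power_le_one)
    show "(\<lambda>\<omega>. Y e (z e \<omega>)) \<in> borel_measurable M"
      using measurable_compose[OF zm Ym] e sub by auto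
  qed
  have "expectation (\<lambda>\<omega>. \<Prod>x\<leftarrow>xs. step_value (\<lambda>e. z e \<omega>) x) = expectation (\<lambda>\<omega>. \<Prod>e\<in>?E. Y e (z e \<omega>))"
    by (subst prod_list_group[of ?E]) (auto simp: Y)
  also have "\<dots> = (\<Prod>e\<in>?E. expectation (\<lambda>\<omega>. Y e (z e \<omega>)))"
    by (rule indep_vars_lebesgue_integral) (use ind' int in auto)
  finally show ?thesis by (simp add: Y)
qed


text \<open>Every used edge has weight at most 1/N, and at most \<beta>/N unless it is used exactly
  twice: one use gives the mean, and k \<ge> 2 uses give at most \<beta>^(k-2) times the second
  moment. On a tree the weight is a product of second moments. These are bounded by 1/N itself, not
  merely up to \<eta>, so that the errors of the edges only add up.\<close>

lemma trace_moment_estimate: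
  fixes z :: "nat \<times> nat \<Rightarrow> 'a \<Rightarrow> complex"
  assumes N: "N \<ge> 1" and w: "w \<noteq> []"
    and ind: "indep_vars (\<lambda>_. borel) z ({..<N} \<times> {..<N})"
    and bd: "\<And>e \<omega>. e \<in> {..<N} \<times> {..<N} \<Longrightarrow> cmod (z e \<omega>) \<le> \<beta>" and \<beta>: "0 \<le> \<beta>" "\<beta> \<le> 1"
    and mean: "\<And>e. e \<in> {..<N} \<times> {..<N} \<Longrightarrow> cmod (expectation (z e)) \<le> \<beta> / real N"
    and var_le: "\<And>e. e \<in> {..<N} \<times> {..<N} \<Longrightarrow> expectation (\<lambda>\<omega>. cmod (z e \<omega>) ^ 2) \<le> 1 / real N"
    and var: "\<And>e. e \<in> {..<N} \<times> {..<N} \<Longrightarrow>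
      \<bar>expectation (\<lambda>\<omega>. cmod (z e \<omega>) ^ 2) - 1 / real N\<bar> \<le> \<eta> / real N" and \<eta>: "\<eta> \<ge> 0"
  shows "cmod ((\<Sum>vs\<in>closed_walks N (length w).
        expectation (\<lambda>\<omega>. \<Prod>x\<leftarrow>walk_steps (last vs) w vs. step_value (\<lambda>e. z e \<omega>) x)) / of_nat N -
      of_real (real (pairings [] w) * (\<Prod>i<length w div 2. real (N - 1 - i) / real N)))
    \<le> fact (length w) * (\<beta> + 1 / real N) + real (length w) * \<eta> * real (pairings [] w)"
proof -
  let ?q = "1 / real N"
  let ?I = "{..<N} \<times> {..<N}"
  define xs where "xs vs = walk_steps (last vs) w vs" for vs
  define E where "E vs = fst ` set (xs vs)" for vs
  define u where "u vs e = expectation (\<lambda>\<omega>. \<Prod>x\<leftarrow>filter (\<lambda>x. fst x = e) (xs vs). step_value (\<lambda>e. z e \<omega>) x)"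
    for vs e
  let ?g = "\<lambda>vs e. filter (\<lambda>x. fst x = e) (xs vs)"
  let ?W = "\<lambda>vs. expectation (\<lambda>\<omega>. \<Prod>x\<leftarrow>xs vs. step_value (\<lambda>e. z e \<omega>) x)"
  have zm [measurable]: "z e \<in> borel_measurable M" if "e \<in> ?I" for e
    using ind that unfolding indep_vars_def by auto
  have E_I: "E vs \<subseteq> ?I" if "vs \<in> closed_walks N (length w)" for vs
    unfolding E_def xs_def by (rule closed_walk_steps_in[OF that w])
  have fin: "finite (E vs)" for vs by (simp add: E_def)
  have wt: "?W vs = (\<Prod>e\<in>E vs. u vs e)"
    if "vs \<in> closed_walks N (length w)" for vs
    unfolding u_def E_def using E_I[OF that] bd \<beta>
    by (intro expectation_step_values[OF ind]) (use order_trans[OF bd \<beta>(2)] in \<open>auto simp: E_def\<close>)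
  have int: "integrable M (\<lambda>\<omega>. cmod (z e \<omega>) ^ k)" if "e \<in> ?I" for e k
    using that bd \<beta> zm[OF that]
    by (intro integrable_const_bound[where B = "1"])
      (use order_trans[OF bd \<beta>(2)] in \<open>auto intro!: power_le_one\<close>)
  have u_single: "cmod (u vs e) \<le> \<beta> * ?q"
    if "e \<in> ?I" "length (?g vs e) = 1" for vs e
  proof -
    obtain x where x: "?g vs e = [x]"
      using \<open>length _ = 1\<close> by (auto simp: length_Suc_conv)
    then have "x \<in> set (?g vs e)" by simp
    then have "fst x = e" by simp
    with x have "cmod (u vs e) = cmod (expectation (z e))"
      unfolding u_def x by (cases "snd x") (auto simp: step_value_def)
    then show ?thesis using mean[OF that(1)] by simp
  qed
  have u_multi: "cmod (u vs e) \<le> \<beta> ^ (length (?g vs e) - 2) * ?q"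
    if "e \<in> ?I" "length (?g vs e) \<ge> 2" for vs e
  proof -
    define k where "k = length (?g vs e)"
    have "cmod (u vs e) \<le> expectation (\<lambda>\<omega>. cmod (\<Prod>x\<leftarrow>?g vs e. step_value (\<lambda>e. z e \<omega>) x))"
      unfolding u_def by (rule integral_norm_bound)
    also have "\<dots> = expectation (\<lambda>\<omega>. cmod (z e \<omega>) ^ k)"
      unfolding k_def by (intro Bochner_Integration.integral_cong refl norm_step_value_prod) auto
    also have "\<dots> \<le> expectation (\<lambda>\<omega>. \<beta> ^ (k - 2) * cmod (z e \<omega>) ^ 2)"
    proof (intro integral_mono int that(1) integrable_mult_right)
      fix \<omega>
      have "cmod (z e \<omega>) ^ k = cmod (z e \<omega>) ^ (k - 2) * cmod (z e \<omega>) ^ 2"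
        using that(2) unfolding k_def by (simp only: power_add[symmetric] le_add_diff_inverse2)
      then show "cmod (z e \<omega>) ^ k \<le> \<beta> ^ (k - 2) * cmod (z e \<omega>) ^ 2"
        using bd[OF that(1)] by (auto intro!: mult_right_mono power_mono)
    qed
    also have "\<dots> = \<beta> ^ (k - 2) * expectation (\<lambda>\<omega>. cmod (z e \<omega>) ^ 2)" by simp
    also have "\<dots> \<le> \<beta> ^ (k - 2) * ?q"
      using \<beta> by (intro mult_left_mono var_le[OF that(1)]) auto
    finally show ?thesis by (simp add: k_def)
  qed
  have len_pos: "length (?g vs e) \<ge> 1" if "e \<in> E vs" for e vs
  proof -
    have "?g vs e \<noteq> []"
      using that unfolding E_def by (auto simp: filter_empty_conv)
    then show ?thesis by (simp add: Suc_le_eq)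
  qed
  have u_le: "cmod (u vs e) \<le> ?q" if "vs \<in> closed_walks N (length w)" "e \<in> E vs" for vs e
  proof (cases "length (?g vs e) = 1")
    case True
    have "cmod (u vs e) \<le> \<beta> * ?q" using u_single[OF _ True] that E_I by blast
    also have "\<dots> \<le> ?q" using \<beta> by (intro mult_left_le_one_le) auto
    finally show ?thesis .
  next
    case False
    then have "cmod (u vs e) \<le> \<beta> ^ (length (?g vs e) - 2) * ?q"
      using len_pos[OF that(2)] that E_I by (intro u_multi) auto
    also have "\<dots> \<le> ?q" using \<beta> by (intro mult_left_le_one_le) (auto intro: power_le_one)
    finally show ?thesis .
  qed
  have u_small: "cmod (u vs e) \<le> \<beta> * ?q" if "vs \<in> closed_walks N (length w)" "e \<in> E vs"
    "length (?g vs e) \<noteq> 2" for vs e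
  proof (cases "length (?g vs e) = 1")
    case True
    then show ?thesis using u_single[OF _ True] that E_I by blast
  next
    case False
    then have ge: "length (?g vs e) \<ge> 3" using len_pos[OF that(2)] that(3) by linarith
    then have "cmod (u vs e) \<le> \<beta> ^ (length (?g vs e) - 2) * ?q"
      using that E_I by (intro u_multi) auto
    also have "\<dots> \<le> \<beta> ^ 1 * ?q"
      using ge \<beta> by (intro mult_right_mono power_decreasing) auto
    finally show ?thesis by simp
  qed
  have "cmod ((\<Sum>vs\<in>closed_walks N (length w). ?W vs) / of_nat N -
      of_real (real (pairings [] w) * (\<Prod>i<length w div 2. real (N - 1 - i) / real N)))
    \<le> fact (length w) * (\<beta> + 1 / real N) + (real (length w) * \<eta>) * real (pairings [] w)"
  proof (rule closed_walk_sum_estimate[OF N w \<beta>(1)])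
    fix vs assume vs: "vs \<in> closed_walks N (length w)"
    have "(\<Prod>e\<in>E vs. cmod (u vs e)) \<le> (\<Prod>e\<in>E vs. ?q)"
      using u_le[OF vs] by (intro prod_mono) auto
    then show "cmod (?W vs)
        \<le> ?q ^ card (fst ` set (walk_steps (last vs) w vs))"
      unfolding wt[OF vs] by (simp add: E_def xs_def prod_norm)
  next
    fix vs e assume vs: "vs \<in> closed_walks N (length w)"
      and e: "e \<in> fst ` set (walk_steps (last vs) w vs)"
      and ne: "length (filter (\<lambda>x. fst x = e) (walk_steps (last vs) w vs)) \<noteq> 2"
    have e': "e \<in> E vs" using e by (simp add: E_def xs_def)
    have "cmod (\<Prod>e\<in>E vs. u vs e) = cmod (u vs e) * (\<Prod>e\<in>E vs - {e}. cmod (u vs e))"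
      using e' fin by (simp add: prod.remove norm_mult prod_norm)
    also have "\<dots> \<le> (\<beta> * ?q) * (\<Prod>e\<in>E vs - {e}. ?q)"
      using u_small[OF vs e'] ne u_le[OF vs] \<beta> by (intro mult_mono prod_mono) (auto simp: xs_def prod_nonneg)
    also have "\<dots> = \<beta> * (\<Prod>e\<in>E vs. ?q)"
      using e' fin by (simp add: prod.remove[of "E vs" e "\<lambda>_. ?q"] del: prod_constant)
    finally show "cmod (?W vs)
        \<le> \<beta> * ?q ^ card (fst ` set (walk_steps (last vs) w vs))"
      unfolding wt[OF vs] by (simp add: E_def xs_def)
  next
    fix vs assume vs: "vs \<in> closed_walks N (length w)"
      and tree: "vs \<in> tree_walks N {last vs} (last vs) [] w"
    let ?h = "length w div 2"
    have ok: "stack_ok {last vs} (last vs) []" by (simp add: stack_ok_def)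
    \<comment> \<open>On a tree both letters occur on every edge, so z meets its conjugate and the
      expectation is that of |z|^2.\<close>
    have pair: "\<exists>b. ?g vs e = [(e, b), (e, \<not> b)]" if "e \<in> E vs" for e
      using tree_walks_edges[OF tree ok, of e] len_pos[OF that] unfolding xs_def by force
    have len_xs: "length (xs vs) = length w"
    proof -
      have "length us = length w \<Longrightarrow> length (walk_steps c w us) = length w" for c us w
        by (induction c w us rule: walk_steps.induct) auto
      then show ?thesis using vs by (auto simp: xs_def closed_walks_def)
    qed
    have "length (xs vs) = (\<Sum>e\<in>E vs. length (?g vs e))"
      using sum_length_filter[OF fin[of vs], of "xs vs"] by (simp add: E_def)
    also have "\<dots> = (\<Sum>e\<in>E vs. 2)"
      by (intro sum.cong refl) (drule pair, auto)
    finally have "length (xs vs) = (\<Sum>e\<in>E vs. 2)" .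
    then have card: "card (E vs) = ?h" using len_xs by simp
    have u_eq: "u vs e = of_real (expectation (\<lambda>\<omega>. cmod (z e \<omega>) ^ 2))" if e: "e \<in> E vs" for e
    proof -
      obtain b where "?g vs e = [(e, b), (e, \<not> b)]" using pair[OF e] by blast
      then have "u vs e = expectation (\<lambda>\<omega>. complex_of_real (cmod (z e \<omega>) ^ 2))"
        unfolding u_def by (cases b) (auto simp: step_value_def mult.commute simp flip: complex_norm_square)
      then show ?thesis by (simp only: integral_complex_of_real)
    qed
    \<comment> \<open>Multiplied by N each factor has norm at most 1, so the product differs from 1
      by at most the sum of the errors of its factors.\<close>
    have "cmod ((\<Prod>e\<in>E vs. of_nat N * u vs e) - (\<Prod>e\<in>E vs. 1)) \<le> (\<Sum>e\<in>E vs. cmod (of_nat N * u vs e - 1))"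
    proof (rule norm_prod_diff)
      show "cmod (of_nat N * u vs e) \<le> 1" if "e \<in> E vs" for e
        using u_le[OF vs that] N by (simp add: norm_mult field_simps)
    qed simp
    also have "\<dots> \<le> (\<Sum>e\<in>E vs. \<eta>)"
    proof (rule sum_mono)
      fix e assume e: "e \<in> E vs"
      have "of_nat N * u vs e - 1 = of_real (real N * (expectation (\<lambda>\<omega>. cmod (z e \<omega>) ^ 2) - ?q))"
        unfolding u_eq[OF e] using N by (simp add: algebra_simps)
      also have "cmod \<dots> = real N * \<bar>expectation (\<lambda>\<omega>. cmod (z e \<omega>) ^ 2) - ?q\<bar>"
        unfolding norm_of_real by (simp add: abs_mult)
      also have "\<dots> \<le> real N * (\<eta> / real N)"
        using e E_I[OF vs] by (intro mult_left_mono var) auto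
      finally show "cmod (of_nat N * u vs e - 1) \<le> \<eta>" using N by simp
    qed
    also have "\<dots> \<le> real (length w) * \<eta>"
      using \<eta> by (simp add: card mult_right_mono)
    finally have *: "cmod (of_nat N ^ ?h * (\<Prod>e\<in>E vs. u vs e) - 1) \<le> real (length w) * \<eta>"
      by (simp add: prod.distrib card)
    have "(\<Prod>e\<in>E vs. u vs e) - ?q ^ ?h = (of_nat N ^ ?h * (\<Prod>e\<in>E vs. u vs e) - 1) * of_real (?q ^ ?h)"
      using N by (simp add: algebra_simps power_divide)
    also have "cmod \<dots> \<le> real (length w) * \<eta> * ?q ^ ?h"
      unfolding norm_mult norm_of_real using * by (auto intro!: mult_right_mono)
    finally show "cmod (?W vs - (1 / real N) ^ ?h)
        \<le> real (length w) * \<eta> * (1 / real N) ^ ?h"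
      unfolding wt[OF vs] .
  qed (use \<eta> in simp)
  then show ?thesis unfolding xs_def .
qed

end

section \<open>Traces of words in a matrix and its adjoint\<close>

lemma mat_adjoint_carrier [simp]: "X \<in> carrier_mat n k \<Longrightarrow> mat_adjoint X \<in> carrier_mat k n"
  unfolding mat_adjoint_def by (auto intro: carrier_matI simp: mat_of_rows_def)

lemma mat_adjoint_dim [simp]:
  "dim_row (mat_adjoint X) = dim_col X" "dim_col (mat_adjoint X) = dim_row X"
  using mat_adjoint_carrier[OF carrier_matI[OF refl refl], of X] by blast+

lemma mat_adjoint_index:
  "X \<in> carrier_mat n k \<Longrightarrow> i < k \<Longrightarrow> j < n \<Longrightarrow> mat_adjoint X $$ (i, j) = cnj (X $$ (j, i))"
  for X :: "complex mat"
  unfolding mat_adjoint_def by (auto simp: mat_of_rows_index conjugate_complex_def)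

lemma mat_adjoint_mult:
  fixes A B :: "complex mat"
  assumes "A \<in> carrier_mat n k" "B \<in> carrier_mat k l"
  shows "mat_adjoint (A * B) = mat_adjoint B * mat_adjoint A"
proof (rule eq_matI)
  have AB: "A * B \<in> carrier_mat n l" using assms by simp
  have A': "mat_adjoint A \<in> carrier_mat k n" and B': "mat_adjoint B \<in> carrier_mat l k"
    using assms by auto
  show "dim_row (mat_adjoint (A * B)) = dim_row (mat_adjoint B * mat_adjoint A)"
    "dim_col (mat_adjoint (A * B)) = dim_col (mat_adjoint B * mat_adjoint A)"
    using mat_adjoint_carrier[OF AB] A' B' by auto
  fix i j assume "i < dim_row (mat_adjoint B * mat_adjoint A)" "j < dim_col (mat_adjoint B * mat_adjoint A)"
  then have ij: "i < l" "j < n" using A' B' by auto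
  show "mat_adjoint (A * B) $$ (i, j) = (mat_adjoint B * mat_adjoint A) $$ (i, j)"
    using ij assms
    by (subst mat_adjoint_index[OF AB])
      (auto simp: scalar_prod_def mat_adjoint_index[OF assms(1)] mat_adjoint_index[OF assms(2)] mult.commute
        intro!: sum.cong)
qed

lemma mat_adjoint_one: "mat_adjoint (1\<^sub>m n :: complex mat) = 1\<^sub>m n"
  by (rule eq_matI) (auto simp: mat_adjoint_index[of _ n n])

lemma pow_mat_comm:
  fixes X :: "'a :: semiring_1 mat"
  assumes "X \<in> carrier_mat n n"
  shows "X ^\<^sub>m k * X = X * X ^\<^sub>m k"
proof (induction k)
  case (Suc k)
  have "X ^\<^sub>m k \<in> carrier_mat n n" using assms by (rule pow_carrier_mat)
  then show ?case using Suc assms by (simp add: assoc_mult_mat[of _ n n _ n _ n])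
qed (use assms in simp)

lemma mat_adjoint_pow:
  fixes X :: "complex mat"
  assumes "X \<in> carrier_mat n n"
  shows "mat_adjoint X ^\<^sub>m k = mat_adjoint (X ^\<^sub>m k)"
proof (induction k)
  case 0
  then show ?case using assms by (auto simp: mat_adjoint_one)
next
  case (Suc k)
  have "X ^\<^sub>m k \<in> carrier_mat n n" using assms by (rule pow_carrier_mat)
  then have "mat_adjoint (X ^\<^sub>m k * X) = mat_adjoint X * mat_adjoint (X ^\<^sub>m k)"
    using assms by (rule mat_adjoint_mult)
  then show ?case using Suc pow_mat_comm[OF mat_adjoint_carrier[OF assms], of k] by simp
qed

section \<open>Traces of powers and eigenvalues\<close>

definition mat_trace :: "'a :: comm_monoid_add mat \<Rightarrow> 'a" where
  "mat_trace A = (\<Sum>i<dim_row A. A $$ (i, i))"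

lemma mat_trace_mult_comm:
  fixes A B :: "'a :: comm_semiring_0 mat"
  assumes "A \<in> carrier_mat n k" "B \<in> carrier_mat k n"
  shows "mat_trace (A * B) = mat_trace (B * A)"
proof -
  have "mat_trace (A * B) = (\<Sum>i<n. \<Sum>j<k. A $$ (i, j) * B $$ (j, i))"
    using assms by (simp add: mat_trace_def scalar_prod_def lessThan_atLeast0)
  also have "\<dots> = (\<Sum>j<k. \<Sum>i<n. B $$ (j, i) * A $$ (i, j))"
    by (subst sum.swap) (simp add: mult.commute)
  also have "\<dots> = mat_trace (B * A)"
    using assms by (simp add: mat_trace_def scalar_prod_def lessThan_atLeast0)
  finally show ?thesis .
qed

lemma upper_triangular_pow:
  fixes B :: "'a :: comm_semiring_1 mat"
  assumes B: "B \<in> carrier_mat n n" and ut: "upper_triangular B"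
  shows "upper_triangular (B ^\<^sub>m p) \<and> (\<forall>i<n. (B ^\<^sub>m p) $$ (i, i) = (B $$ (i, i)) ^ p)"
proof (induction p)
  case 0
  then show ?case using B by simp
next
  case (Suc p)
  have Bp: "B ^\<^sub>m p \<in> carrier_mat n n" using B by (rule pow_carrier_mat)
  have entry: "(B ^\<^sub>m p * B) $$ (i, j) = (\<Sum>k<n. (B ^\<^sub>m p) $$ (i, k) * B $$ (k, j))"
    if "i < n" "j < n" for i j
    using that B Bp by (simp add: scalar_prod_def lessThan_atLeast0)
  have zero: "(B ^\<^sub>m p) $$ (i, k) * B $$ (k, j) = 0" if "i < n" "k < n" "k < i \<or> j < k" for i j k
  proof (cases "k < i")
    case True
    then have "(B ^\<^sub>m p) $$ (i, k) = 0" using Suc Bp that by (intro upper_triangularD) auto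
    then show ?thesis by simp
  next
    case False
    then have "B $$ (k, j) = 0" using ut B that by (intro upper_triangularD) auto
    then show ?thesis by simp
  qed
  have "(B ^\<^sub>m p * B) $$ (i, j) = 0" if "j < i" "i < n" for i j
    using that by (subst entry) (auto intro!: sum.neutral zero)
  moreover have "(B ^\<^sub>m p * B) $$ (i, i) = B $$ (i, i) ^ Suc p" if "i < n" for i
  proof -
    have "(B ^\<^sub>m p * B) $$ (i, i) = (\<Sum>k<n. if k = i then B $$ (i, i) ^ Suc p else 0)"
      unfolding entry[OF that that]
      using Suc that zero by (intro sum.cong refl) (auto simp: mult.commute neq_iff)
    then show ?thesis using that by simp
  qed
  ultimately show ?case using Bp B by (auto intro!: upper_triangularI)
qed

text \<open>Schur triangularisation puts the roots of the characteristic polynomial, with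
  multiplicity, on the diagonal; powers stay triangular with powered diagonal, and the trace is
  invariant under similarity.\<close>

lemma eigenvalue_mset_props:
  assumes A: "A \<in> carrier_mat n n"
  shows "size (eigenvalue_mset A) = n"
    and "mat_trace (A ^\<^sub>m p) = (\<Sum>z\<in>#eigenvalue_mset A. z ^ p)"
proof -
  obtain es where es: "char_poly A = (\<Prod>a\<leftarrow>es. [:- a, 1:])" "length es = n"
    using char_poly_factorized[OF A] by blast
  have "proots (\<Prod>a\<leftarrow>es. [:- a, 1:]) = mset es" for es :: "complex list"
  proof (induction es)
    case (Cons e es)
    have "(\<Prod>a\<leftarrow>es. [:- a, 1:]) \<noteq> 0" by (auto simp: prod_list_zero_iff)
    then show ?case using Cons by (simp add: proots_mult del: mult_pCons_left)
  qed simp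
  then have ms: "eigenvalue_mset A = mset es" by (simp add: eigenvalue_mset_def es)
  show "size (eigenvalue_mset A) = n" by (simp add: ms es)
  obtain B P Q where "schur_decomposition A es = (B, P, Q)" by (cases "schur_decomposition A es") auto
  from schur_decomposition[OF A es(1) this] have wit: "similar_mat_wit A B P Q"
    and ut: "upper_triangular B" and diag: "diag_mat B = es" by auto
  from similar_mat_witD2[OF A wit] have PQ: "Q * P = 1\<^sub>m n" and B: "B \<in> carrier_mat n n"
    and P: "P \<in> carrier_mat n n" and Q: "Q \<in> carrier_mat n n" by auto
  have Bp: "B ^\<^sub>m p \<in> carrier_mat n n" using B by (rule pow_carrier_mat)
  have "mat_trace (A ^\<^sub>m p) = mat_trace (P * (B ^\<^sub>m p * Q))"
    using similar_mat_wit_pow_id[OF wit, of p] P Bp Q by simp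
  also have "\<dots> = mat_trace ((B ^\<^sub>m p * Q) * P)"
    using P Bp Q by (intro mat_trace_mult_comm) auto
  also have "\<dots> = mat_trace (B ^\<^sub>m p)"
    using P Bp Q PQ by (simp add: assoc_mult_mat[of _ n n _ n _ n] right_mult_one_mat[OF Bp])
  also have "\<dots> = (\<Sum>i<n. B $$ (i, i) ^ p)"
    using upper_triangular_pow[OF B ut, of p] B Bp by (simp add: mat_trace_def)
  also have "\<dots> = (\<Sum>z\<leftarrow>diag_mat B. z ^ p)"
    using B by (simp add: diag_mat_def comp_def interv_sum_list_conv_sum_set_nat lessThan_atLeast0)
  also have "\<dots> = (\<Sum>z\<in>#eigenvalue_mset A. z ^ p)"
    unfolding diag ms by (simp add: sum_mset_sum_list flip: mset_map)
  finally show "mat_trace (A ^\<^sub>m p) = (\<Sum>z\<in>#eigenvalue_mset A. z ^ p)" .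
qed

text \<open>For an eigenvector v one has e |v|^2 = |u|^2 with u the adjoint of Z applied to v, so e
  is a quotient of reals. This justifies reading the spectrum through \<open>Re\<close>.\<close>

lemma eigenvalue_mset_real:
  assumes Z: "Z \<in> carrier_mat n n" and e: "e \<in># eigenvalue_mset (Z * mat_adjoint Z)"
  shows "Im e = 0"
proof -
  let ?A = "Z * mat_adjoint Z"
  have Z': "mat_adjoint Z \<in> carrier_mat n n" and A: "?A \<in> carrier_mat n n" using Z by auto
  have "char_poly ?A \<noteq> 0" using degree_monic_char_poly[OF A] by auto
  then have "poly (char_poly ?A) e = 0" using e by (simp add: eigenvalue_mset_def)
  then have "eigenvalue ?A e" using eigenvalue_root_char_poly[OF A] by simp
  then obtain v where v: "v \<in> carrier_vec n" "v \<noteq> 0\<^sub>v n" and Av: "?A *\<^sub>v v = e \<cdot>\<^sub>v v"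
    using A unfolding eigenvalue_def eigenvector_def by auto
  define u where "u = mat_adjoint Z *\<^sub>v v"
  have u: "u \<in> carrier_vec n" using Z' v by (simp add: u_def)
  have u_index: "u $ j = (\<Sum>i<n. cnj (Z $$ (i, j)) * v $ i)" if "j < n" for j
    using that Z Z' v mat_adjoint_index[OF Z] unfolding u_def
    by (auto simp: scalar_prod_def lessThan_atLeast0 intro!: sum.cong)
  have Zu: "e \<cdot>\<^sub>v v = Z *\<^sub>v u" using Av Z Z' v by (simp add: u_def)
  have Av_index: "e * v $ i = (\<Sum>j<n. Z $$ (i, j) * u $ j)" if "i < n" for i
  proof -
    have "e * v $ i = (e \<cdot>\<^sub>v v) $ i" using v that by simp
    also have "\<dots> = (\<Sum>j<n. Z $$ (i, j) * u $ j)"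
      unfolding Zu using Z u that by (simp add: scalar_prod_def lessThan_atLeast0)
    finally show ?thesis .
  qed
  have "e * of_real (\<Sum>i<n. (cmod (v $ i))\<^sup>2) = (\<Sum>i<n. cnj (v $ i) * (e * v $ i))"
    by (simp add: sum_distrib_left complex_norm_square mult_ac del: of_real_power)
  also have "\<dots> = (\<Sum>i<n. \<Sum>j<n. cnj (v $ i) * (Z $$ (i, j) * u $ j))"
    by (intro sum.cong refl) (simp add: Av_index sum_distrib_left)
  also have "\<dots> = (\<Sum>j<n. \<Sum>i<n. cnj (v $ i) * (Z $$ (i, j) * u $ j))" by (rule sum.swap)
  also have "\<dots> = (\<Sum>j<n. u $ j * cnj (u $ j))"
    by (intro sum.cong refl) (simp add: u_index sum_distrib_left sum_distrib_right mult_ac)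
  also have "\<dots> = of_real (\<Sum>j<n. (cmod (u $ j))\<^sup>2)"
    by (simp add: complex_norm_square del: of_real_power)
  finally have eq: "e * of_real (\<Sum>i<n. (cmod (v $ i))\<^sup>2) = of_real (\<Sum>j<n. (cmod (u $ j))\<^sup>2)" .
  obtain i where "i < n" "v $ i \<noteq> 0" using v by (metis eq_vecI carrier_vecD index_zero_vec)
  then have "(\<Sum>i<n. (cmod (v $ i))\<^sup>2) > 0"
    by (intro sum_pos2[of _ i]) auto
  moreover have "Im e * (\<Sum>i<n. (cmod (v $ i))\<^sup>2) = 0"
    using arg_cong[OF eq, of Im] by simp
  ultimately show ?thesis by simp
qed

section \<open>Expansion of words into walks\<close>

definition word_mat :: "nat \<Rightarrow> complex mat \<Rightarrow> bool list \<Rightarrow> complex mat" where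
  "word_mat n X w = foldr (\<lambda>l B. (if l then mat_adjoint X else X) * B) w (1\<^sub>m n)"

lemma word_mat_carrier [simp]: "X \<in> carrier_mat n n \<Longrightarrow> word_mat n X w \<in> carrier_mat n n"
proof (induction w)
  case (Cons l w)
  have "(if l then mat_adjoint X else X) \<in> carrier_mat n n" using Cons by simp
  with Cons show ?case unfolding word_mat_def by simp
qed (simp add: word_mat_def)

lemma word_mat_append:
  assumes X: "X \<in> carrier_mat n n"
  shows "word_mat n X (u @ v) = word_mat n X u * word_mat n X v"
proof (induction u)
  case Nil
  then show ?case using word_mat_carrier[OF X, of v] by (simp add: word_mat_def)
next
  case (Cons l u)
  have "(if l then mat_adjoint X else X) \<in> carrier_mat n n" using X by simp
  then show ?case using Cons word_mat_carrier[OF X, of u] word_mat_carrier[OF X, of v]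
    unfolding word_mat_def by (simp add: assoc_mult_mat[of _ n n _ n _ n])
qed

lemma word_mat_replicate:
  assumes X: "X \<in> carrier_mat n n"
  shows "word_mat n X (concat (replicate k w)) = word_mat n X w ^\<^sub>m k"
proof (induction k)
  case 0
  then show ?case using word_mat_carrier[OF X, of w] by (simp add: word_mat_def)
next
  case (Suc k)
  have "concat (replicate (Suc k) w) = concat (replicate k w) @ w"
    by (induction k) auto
  then show ?case using Suc by (simp add: word_mat_append[OF X])
qed

lemma power_covariance_pow_eq_word_mat:
  assumes X: "X \<in> carrier_mat n n"
  shows "power_covariance m X ^\<^sub>m p = word_mat n X (covariance_word m p)"
proof -
  have single: "word_mat n X [l] = (if l then mat_adjoint X else X)" for l
    using X mat_adjoint_carrier[OF X] by (simp add: word_mat_def)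
  have "concat (replicate m [l]) = replicate m l" for l :: bool by (induction m) auto
  then have "word_mat n X (replicate m l) = (if l then mat_adjoint X else X) ^\<^sub>m m" for l
    using word_mat_replicate[OF X, of m "[l]"] single[of l] by simp
  from this[of False] this[of True] show ?thesis
    unfolding covariance_word_def word_mat_replicate[OF X] word_mat_append[OF X] power_covariance_def
    by simp
qed

text \<open>Only the vertices after the start are listed, so the end is
  \<open>last (a # vs)\<close>; this form includes the empty word, whose end is its start.\<close>

lemma word_mat_index:
  assumes X: "X \<in> carrier_mat n n" and "a < n" "b < n"
  shows "word_mat n X w $$ (a, b) = (\<Sum>vs\<in>closed_walks n (length w).
    if last (a # vs) = b then (\<Prod>x\<leftarrow>walk_steps a w vs. step_value (\<lambda>e. X $$ e) x) else 0)"
  using assms(2)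
proof (induction w arbitrary: a)
  case Nil
  have "closed_walks n 0 = {[]}" by (auto simp: closed_walks_def)
  then show ?case using Nil assms(3) by (simp add: word_mat_def)
next
  case (Cons l w)
  let ?Y = "if l then mat_adjoint X else X"
  have Y: "?Y \<in> carrier_mat n n" using X by simp
  have Y_index: "?Y $$ (a, v) = step_value (\<lambda>e. X $$ e) (walk_edge l a v, l)" if "v < n" for v
    using Cons.prems that mat_adjoint_index[OF X] by (simp add: step_value_def walk_edge_def)
  have "word_mat n X (l # w) $$ (a, b) = (?Y * word_mat n X w) $$ (a, b)" by (simp add: word_mat_def)
  also have "\<dots> = (\<Sum>v<n. ?Y $$ (a, v) * word_mat n X w $$ (v, b))"
    using Y word_mat_carrier[OF X, of w] Cons.prems assms(3)
    by (simp add: scalar_prod_def lessThan_atLeast0 del: if_split)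
  also have "\<dots> = (\<Sum>v<n. \<Sum>vs\<in>closed_walks n (length w). if last (a # v # vs) = b then
      (\<Prod>x\<leftarrow>walk_steps a (l # w) (v # vs). step_value (\<lambda>e. X $$ e) x) else 0)"
  proof (intro sum.cong refl)
    fix v assume "v \<in> {..<n}"
    then have v: "v < n" by simp
    show "?Y $$ (a, v) * word_mat n X w $$ (v, b) = (\<Sum>vs\<in>closed_walks n (length w).
      if last (a # v # vs) = b then (\<Prod>x\<leftarrow>walk_steps a (l # w) (v # vs). step_value (\<lambda>e. X $$ e) x) else 0)"
      unfolding Cons.IH[OF v] Y_index[OF v] sum_distrib_left by (intro sum.cong refl) simp
  qed
  also have "\<dots> = (\<Sum>vs\<in>closed_walks n (length (l # w)). if last (a # vs) = b then
      (\<Prod>x\<leftarrow>walk_steps a (l # w) vs. step_value (\<lambda>e. X $$ e) x) else 0)"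
    by (simp add: sum_closed_walks_Suc)
  finally show ?case .
qed

text \<open>Closing the walk fixes its start as \<open>last vs\<close>, which collapses the sum over
  the diagonal; a nonempty word guarantees that this vertex exists.\<close>

lemma mat_trace_word_mat:
  assumes X: "X \<in> carrier_mat n n" and "w \<noteq> []"
  shows "mat_trace (word_mat n X w) = (\<Sum>vs\<in>closed_walks n (length w).
    \<Prod>x\<leftarrow>walk_steps (last vs) w vs. step_value (\<lambda>e. X $$ e) x)"
proof -
  let ?f = "\<lambda>a vs. \<Prod>x\<leftarrow>walk_steps a w vs. step_value (\<lambda>e. X $$ e) x"
  have "mat_trace (word_mat n X w) = (\<Sum>a<n. \<Sum>vs\<in>closed_walks n (length w).
      if last (a # vs) = a then ?f a vs else 0)"
    unfolding mat_trace_def using word_mat_carrier[OF X, of w]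
    by (auto intro!: sum.cong simp: word_mat_index[OF X])
  also have "\<dots> = (\<Sum>vs\<in>closed_walks n (length w). \<Sum>a<n. if last (a # vs) = a then ?f a vs else 0)"
    by (rule sum.swap)
  also have "\<dots> = (\<Sum>vs\<in>closed_walks n (length w). ?f (last vs) vs)"
  proof (intro sum.cong refl)
    fix vs assume vs: "vs \<in> closed_walks n (length w)"
    then have ne: "vs \<noteq> []" using assms(2) by (auto simp: closed_walks_def)
    then have "last vs \<in> set vs" by simp
    then have "last vs < n" using vs by (auto simp: closed_walks_def)
    have "(\<Sum>a<n. if last (a # vs) = a then ?f a vs else 0) = (\<Sum>a<n. if last vs = a then ?f (last vs) vs else 0)"
      using ne by (intro sum.cong refl) auto
    also have "\<dots> = ?f (last vs) vs" using \<open>last vs < n\<close> by simp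
    finally show "(\<Sum>a<n. if last (a # vs) = a then ?f a vs else 0) = ?f (last vs) vs" .
  qed
  finally show ?thesis .
qed

section \<open>The mean of a random empirical distribution\<close>

text \<open>Measurability of the counting function of the eigenvalues is reduced to that of their power sums,
  which are traces.\<close>

lemma polynomials_tendsto_indicator:
  fixes t :: real
  obtains a :: "nat \<Rightarrow> nat \<Rightarrow> real" and n :: "nat \<Rightarrow> nat"
  where "\<And>x. (\<lambda>j. \<Sum>i\<le>n j. a j i * x ^ i) \<longlonglongrightarrow> indicator {..t} x"
proof -
  \<comment> \<open>For j \<ge> 1 a ramp that is 1 up to t and 0 from t + 1/j on, so the limit has
    the value 1 at t itself. Approximating it on [-j, j] suffices, since every x lies there
    eventually.\<close>
  define f where "f j x = max 0 (min 1 (1 - real j * (x - t)))" for j x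
  have "\<exists>a n. \<forall>x\<in>{- real j..real j}. \<bar>f j x - (\<Sum>i\<le>n. a i * x ^ i)\<bar> < 1 / real (Suc j)" for j
  proof -
    have "continuous_on {- real j..real j} (f j)"
      unfolding f_def by (intro continuous_intros)
    then obtain g where g: "real_polynomial_function g"
      "\<And>x. x \<in> {- real j..real j} \<Longrightarrow> \<bar>f j x - g x\<bar> < 1 / real (Suc j)"
      using Stone_Weierstrass_real_polynomial_function[of "{- real j..real j}" "f j" "1 / real (Suc j)"]
      by auto
    then show ?thesis unfolding real_polynomial_function_iff_sum by fastforce
  qed
  then obtain a n where an: "\<And>j x. x \<in> {- real j..real j} \<Longrightarrow>
      \<bar>f j x - (\<Sum>i\<le>n j. a j i * x ^ i)\<bar> < 1 / real (Suc j)"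
    by metis
  have "(\<lambda>j. \<Sum>i\<le>n j. a j i * x ^ i) \<longlonglongrightarrow> indicator {..t} x" for x
  proof -
    have diff: "(\<lambda>j. f j x - (\<Sum>i\<le>n j. a j i * x ^ i)) \<longlonglongrightarrow> 0"
    proof (rule Lim_null_comparison)
      obtain J where J: "\<bar>x\<bar> \<le> real J" using real_arch_simple by blast
      show "\<forall>\<^sub>F j in sequentially. norm (f j x - (\<Sum>i\<le>n j. a j i * x ^ i)) \<le> 1 / real (Suc j)"
        using eventually_ge_at_top[of J]
      proof eventually_elim
        case (elim j)
        then have "x \<in> {- real j..real j}" using J by auto
        from an[OF this] show ?case by simp
      qed
      show "(\<lambda>j. 1 / real (Suc j)) \<longlonglongrightarrow> 0" by (rule LIMSEQ_Suc[OF lim_1_over_n])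
    qed
    have "(\<lambda>j. f j x) \<longlonglongrightarrow> indicator {..t} x"
    proof (rule tendsto_eventually, cases "x \<le> t")
      case True
      then show "\<forall>\<^sub>F j in sequentially. f j x = indicator {..t} x"
        by (auto simp: f_def mult_le_0_iff)
    next
      case False
      obtain J where J: "1 / (x - t) \<le> real J" using real_arch_simple by blast
      show "\<forall>\<^sub>F j in sequentially. f j x = indicator {..t} x"
        using eventually_ge_at_top[of J]
      proof eventually_elim
        case (elim j)
        then have "1 / (x - t) \<le> real j" using J by linarith
        then have "1 \<le> real j * (x - t)" using False by (simp add: field_simps)
        then show ?case using False by (simp add: f_def)
      qed
    qed
    from tendsto_diff[OF this diff] show ?thesis by simp
  qed
  then show ?thesis by (rule that)
qed

text \<open>Expresses the event that the k-th smallest value is at most t through the counting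
  function, which passes measurability on to the order statistics.\<close>

lemma sorted_nth_le_iff:
  fixes xs :: "'a :: linorder list"
  assumes "sorted xs" "k < length xs"
  shows "xs ! k \<le> t \<longleftrightarrow> k < length (filter (\<lambda>x. x \<le> t) xs)"
  using assms
proof (induction xs arbitrary: k)
  case (Cons x xs)
  show ?case
  proof (cases "x \<le> t")
    case True
    then show ?thesis using Cons by (cases k) auto
  next
    case False
    then have "\<forall>y\<in>set (x # xs). \<not> y \<le> t" using Cons.prems(1) by fastforce
    then show ?thesis using Cons.prems(2) by (metis filter_False list.size(3) not_less_zero nth_mem)
  qed
qed simp

lemma size_filter_mset_measurable:
  fixes \<Lambda> :: "'a \<Rightarrow> real multiset"
  assumes "\<And>p. (\<lambda>\<omega>. \<Sum>z\<in>#\<Lambda> \<omega>. z ^ p) \<in> borel_measurable M"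
  shows "(\<lambda>\<omega>. real (size {# z \<in># \<Lambda> \<omega>. z \<le> t #})) \<in> borel_measurable M"
proof -
  obtain a :: "nat \<Rightarrow> nat \<Rightarrow> real" and n :: "nat \<Rightarrow> nat" where an: "\<And>x. (\<lambda>j. \<Sum>i\<le>n j. a j i * x ^ i) \<longlonglongrightarrow> indicator {..t} x"
    using polynomials_tendsto_indicator by blast
  have "(\<lambda>j. \<Sum>z\<in>#\<Lambda>'. \<Sum>i\<le>n j. a j i * z ^ i) \<longlonglongrightarrow> real (size {# z \<in># \<Lambda>'. z \<le> t #})" for \<Lambda>'
  proof (induction \<Lambda>')
    case (add z \<Lambda>')
    show ?case using tendsto_add[OF an[of z] add] by (auto simp: indicator_def split: if_splits)
  qed simp
  moreover have "(\<Sum>z\<in>#\<Lambda>'. \<Sum>i\<le>n j. a j i * z ^ i) = (\<Sum>i\<le>n j. a j i * (\<Sum>z\<in>#\<Lambda>'. z ^ i))" for j and \<Lambda>' :: "real multiset"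
    by (induction \<Lambda>') (auto simp: sum.distrib algebra_simps)
  ultimately have "(\<lambda>j. \<Sum>i\<le>n j. a j i * (\<Sum>z\<in>#\<Lambda> \<omega>. z ^ i)) \<longlonglongrightarrow> real (size {# z \<in># \<Lambda> \<omega>. z \<le> t #})" for \<omega>
    by simp
  then show ?thesis
    by (rule borel_measurable_LIMSEQ_real) (intro borel_measurable_sum borel_measurable_times assms borel_measurable_const)
qed

text \<open>Enumerating the values in increasing order makes each of them a random variable.\<close>

lemma (in prob_space) mean_empirical_distribution:
  fixes \<Lambda> :: "'a \<Rightarrow> real multiset"
  assumes N: "N > 0" and size: "\<And>\<omega>. size (\<Lambda> \<omega>) = N"
    and meas: "\<And>p. (\<lambda>\<omega>. \<Sum>z\<in>#\<Lambda> \<omega>. z ^ p) \<in> borel_measurable M"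
    and bd: "\<And>\<omega> z. z \<in># \<Lambda> \<omega> \<Longrightarrow> \<bar>z\<bar> \<le> K"
  obtains \<mu> where "real_distribution \<mu>"
    "\<And>t. cdf \<mu> t = expectation (\<lambda>\<omega>. real (size {# z \<in># \<Lambda> \<omega>. z \<le> t #}) / real N)"
    "\<And>p. integrable \<mu> (\<lambda>x. x ^ p)"
    "\<And>p. (\<integral>x. x ^ p \<partial>\<mu>) = expectation (\<lambda>\<omega>. (\<Sum>z\<in>#\<Lambda> \<omega>. z ^ p) / real N)"
proof -
  \<comment> \<open>The value 0 beyond N only makes \<open>ev\<close> total; the uniform law on the
    indices below N gives it no mass.\<close>
  define ev where "ev k \<omega> = (if k < N then sorted_list_of_multiset (\<Lambda> \<omega>) ! k else 0)" for k \<omega>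
  have len: "length (sorted_list_of_multiset (\<Lambda> \<omega>)) = N" for \<omega>
    by (metis mset_sorted_list_of_multiset size size_mset)
  have ev_le: "ev k \<omega> \<le> t \<longleftrightarrow> real k < real (size {# z \<in># \<Lambda> \<omega>. z \<le> t #})" if "k < N" for k \<omega> t
  proof -
    have "length (filter (\<lambda>z. z \<le> t) (sorted_list_of_multiset (\<Lambda> \<omega>))) = size {# z \<in># \<Lambda> \<omega>. z \<le> t #}"
      by (metis mset_filter mset_sorted_list_of_multiset size_mset)
    then show ?thesis using that sorted_nth_le_iff[of "sorted_list_of_multiset (\<Lambda> \<omega>)" k t]
      by (simp add: ev_def len)
  qed
  have ev_meas: "ev k \<in> borel_measurable M" for k
  proof (cases "k < N")
    case True
    note [measurable] = size_filter_mset_measurable[OF meas]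
    show ?thesis unfolding borel_measurable_iff_le ev_le[OF True] by (rule allI) measurable
  next
    case False
    then have "ev k = (\<lambda>_. 0)" by (simp add: ev_def fun_eq_iff)
    then show ?thesis by simp
  qed
  have sum_ev: "(\<Sum>k<N. f (ev k \<omega>)) = (\<Sum>z\<in>#\<Lambda> \<omega>. f z)" for f :: "real \<Rightarrow> real" and \<omega>
  proof -
    have "(\<Sum>k<N. f (ev k \<omega>)) = (\<Sum>k<N. map f (sorted_list_of_multiset (\<Lambda> \<omega>)) ! k)"
      by (intro sum.cong) (auto simp: ev_def len)
    also have "\<dots> = sum_list (map f (sorted_list_of_multiset (\<Lambda> \<omega>)))"
      by (simp add: sum_list_sum_nth len lessThan_atLeast0)
    also have "\<dots> = (\<Sum>z\<in>#\<Lambda> \<omega>. f z)"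
      by (metis mset_map mset_sorted_list_of_multiset sum_mset_sum_list)
    finally show ?thesis .
  qed
  have ev_bd: "\<bar>ev k \<omega>\<bar> \<le> \<bar>K\<bar>" for k \<omega>
  proof (cases "k < N")
    case True
    then have "ev k \<omega> \<in># \<Lambda> \<omega>"
      using nth_mem[of k "sorted_list_of_multiset (\<Lambda> \<omega>)"] by (simp add: ev_def len)
    then show ?thesis using bd[of "ev k \<omega>" \<omega>] by simp
  qed (simp add: ev_def)
  \<comment> \<open>The mean of the empirical laws is the law of a member of the multiset picked
    uniformly and independently of \<omega>.\<close>
  define Q where "Q = measure_pmf (pmf_of_set {..<N})"
  interpret Q: prob_space Q unfolding Q_def by (rule measure_pmf.prob_space_axioms)
  interpret P: pair_prob_space M Q ..
  define X where "X = (\<lambda>(\<omega>, k). ev k \<omega>)"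
  have X [measurable]: "X \<in> borel_measurable (M \<Otimes>\<^sub>M Q)"
  proof -
    \<comment> \<open>The index is discrete, so joint measurability reduces to that of each
      \<open>ev k\<close>.\<close>
    have "X \<in> borel_measurable (M \<Otimes>\<^sub>M count_space UNIV)"
      by (subst measurable_pair_swap_iff, rule measurable_pair_measure_countable1) (auto simp: X_def ev_meas)
    also have "sets (M \<Otimes>\<^sub>M count_space UNIV) = sets (M \<Otimes>\<^sub>M Q)"
      by (intro sets_pair_measure_cong) (simp_all add: Q_def)
    then have "borel_measurable (M \<Otimes>\<^sub>M count_space UNIV) = borel_measurable (M \<Otimes>\<^sub>M Q)"
      by (intro measurable_cong_sets) auto
    finally show ?thesis .
  qed
  define \<mu> where "\<mu> = distr (M \<Otimes>\<^sub>M Q) borel X"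
  interpret \<mu>: prob_space \<mu> unfolding \<mu>_def by (rule P.prob_space_distr) simp
  have rd: "real_distribution \<mu>" by unfold_locales (simp_all add: \<mu>_def)
  have int: "integrable \<mu> f" and eq: "(\<integral>x. f x \<partial>\<mu>) = expectation (\<lambda>\<omega>. (\<Sum>z\<in>#\<Lambda> \<omega>. f z) / real N)"
    if f [measurable]: "f \<in> borel_measurable borel" and f_bd: "\<And>x. \<bar>x\<bar> \<le> \<bar>K\<bar> \<Longrightarrow> \<bar>f x\<bar> \<le> L" for f :: "real \<Rightarrow> real" and L
  proof -
    have i: "integrable (M \<Otimes>\<^sub>M Q) (\<lambda>y. f (X y))"
    proof (rule P.integrable_const_bound[where B = L])
      show "AE y in M \<Otimes>\<^sub>M Q. norm (f (X y)) \<le> L"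
        by (auto simp: X_def ev_bd intro!: AE_I2 f_bd)
    qed simp
    then show "integrable \<mu> f" unfolding \<mu>_def by (simp add: integrable_distr_eq)
    have "(\<integral>x. f x \<partial>\<mu>) = (\<integral>y. f (X y) \<partial>(M \<Otimes>\<^sub>M Q))"
      unfolding \<mu>_def by (intro integral_distr) auto
    also have "\<dots> = (\<integral>\<omega>. (\<integral>k. f (ev k \<omega>) \<partial>Q) \<partial>M)"
      using P.integral_fst'[OF i] by (simp add: X_def)
    also have "\<dots> = expectation (\<lambda>\<omega>. (\<Sum>z\<in>#\<Lambda> \<omega>. f z) / real N)"
      using N unfolding Q_def by (subst integral_pmf_of_set) (auto simp: sum_ev)
    finally show "(\<integral>x. f x \<partial>\<mu>) = expectation (\<lambda>\<omega>. (\<Sum>z\<in>#\<Lambda> \<omega>. f z) / real N)" .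
  qed
  have cdf: "cdf \<mu> t = expectation (\<lambda>\<omega>. real (size {# z \<in># \<Lambda> \<omega>. z \<le> t #}) / real N)" for t
  proof -
    have sz: "(\<Sum>z\<in>#L. indicator {..t} z) = real (size {# z \<in># L. z \<le> t #})" for L
      by (induction L) (auto simp: indicator_def)
    have b: "\<bar>indicator {..t} x :: real\<bar> \<le> 1" for x by (simp add: indicator_def)
    have "cdf \<mu> t = (\<integral>x. indicator {..t} x \<partial>\<mu>)"
      unfolding cdf_def using \<mu>.emeasure_eq_measure by (simp add: \<mu>_def)
    also have "\<dots> = expectation (\<lambda>\<omega>. real (size {# z \<in># \<Lambda> \<omega>. z \<le> t #}) / real N)"
      by (subst eq[OF _ b]) (auto simp: sz)
    finally show ?thesis .
  qed
  have pw: "\<bar>x ^ p\<bar> \<le> \<bar>K\<bar> ^ p" if "\<bar>x\<bar> \<le> \<bar>K\<bar>" for x p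
    using that by (simp add: power_abs power_mono)
  show ?thesis
  proof (rule that[of \<mu>])
    show "integrable \<mu> (\<lambda>x. x ^ p)" for p by (rule int[OF _ pw]) simp
    show "(\<integral>x. x ^ p \<partial>\<mu>) = expectation (\<lambda>\<omega>. (\<Sum>z\<in>#\<Lambda> \<omega>. z ^ p) / real N)" for p
      by (rule eq[OF _ pw]) simp
  qed (fact rd cdf)+
qed

section \<open>Convergence of moments\<close>

text \<open>A bounded continuous stand-in for the identity, which makes clipped powers admissible
  test functions for weak convergence.\<close>

definition clip :: "real \<Rightarrow> real \<Rightarrow> real" where
  "clip R x = max (- R) (min R x)"

lemma isCont_clip_power: "isCont (\<lambda>x. clip R x ^ p) x"
  unfolding clip_def by (intro continuous_intros)

lemma clip_measurable [measurable]: "clip R \<in> borel_measurable borel"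
  unfolding clip_def by measurable

lemma abs_clip_power_le: "0 \<le> R \<Longrightarrow> \<bar>clip R x ^ p\<bar> \<le> R ^ p"
  unfolding power_abs by (intro power_mono) (auto simp: clip_def)

lemma abs_clip_power_le': "0 \<le> R \<Longrightarrow> \<bar>clip R x ^ p\<bar> \<le> \<bar>x\<bar> ^ p"
  unfolding power_abs by (intro power_mono) (auto simp: clip_def)

text \<open>Nothing changes for |x| \<le> R, and beyond R the error is at most |x|^p \<le>
  |x|^(2p)/R. A moment of twice the order thus controls the clipping uniformly over a sequence of
  laws.\<close>

lemma power_diff_clip_le:
  assumes "1 \<le> R" "p \<ge> 1"
  shows "\<bar>x ^ p - clip R x ^ p\<bar> \<le> x ^ (2 * p) / R"
proof (cases "\<bar>x\<bar> \<le> R")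
  case True
  then have "clip R x = x" by (auto simp: clip_def)
  then show ?thesis using assms by (simp add: zero_le_even_power)
next
  case False
  then have x: "\<bar>x\<bar> > R" by simp
  have "\<bar>x ^ p - clip R x ^ p\<bar> \<le> \<bar>x\<bar> ^ p"
  proof (cases "x > 0")
    case True
    then have "clip R x = R" "0 \<le> R ^ p" "R ^ p \<le> x ^ p"
      using x assms by (auto simp: clip_def intro: power_mono)
    then show ?thesis using True by simp
  next
    case False
    then have c: "clip R x = - R" "x = - \<bar>x\<bar>" "0 \<le> R ^ p" "R ^ p \<le> \<bar>x\<bar> ^ p"
      using x assms by (auto simp: clip_def intro: power_mono)
    have "\<bar>x ^ p - clip R x ^ p\<bar> = \<bar>(-1) ^ p * (\<bar>x\<bar> ^ p - R ^ p)\<bar>"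
      using c(1,2) by (metis mult_minus1 power_mult_distrib right_diff_distrib)
    also have "\<dots> = \<bar>x\<bar> ^ p - R ^ p" using c by (simp add: abs_mult power_abs)
    finally show ?thesis using c by simp
  qed
  also have "\<dots> \<le> \<bar>x\<bar> ^ p * (\<bar>x\<bar> ^ p / R)"
  proof -
    have "R \<le> \<bar>x\<bar> ^ 1" using x by simp
    also have "\<dots> \<le> \<bar>x\<bar> ^ p" using x assms by (intro power_increasing) auto
    finally have "1 \<le> \<bar>x\<bar> ^ p / R" using assms by (simp add: field_simps)
    from mult_left_mono[OF this, of "\<bar>x\<bar> ^ p"] show ?thesis by simp
  qed
  also have "\<dots> = \<bar>x\<bar> ^ (2 * p) / R" by (simp add: mult_2 power_add)
  also have "\<bar>x\<bar> ^ (2 * p) = x ^ (2 * p)" by (rule power_even_abs) simp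
  finally show ?thesis .
qed

locale converging_moments =
  fixes \<mu> :: "nat \<Rightarrow> real measure" and c :: "nat \<Rightarrow> real" and C :: real
  assumes rd: "\<And>n. real_distribution (\<mu> n)"
    and int: "\<And>n p. integrable (\<mu> n) (\<lambda>x. x ^ p)"
    and conv: "\<And>p. (\<lambda>n. \<integral>x. x ^ p \<partial>\<mu> n) \<longlonglongrightarrow> c p"
    and growth: "\<And>p. \<bar>c p\<bar> \<le> C ^ p"
begin

text \<open>Second moments converge, hence are bounded by some D, and Chebyshev's inequality gives
  uniform tails.\<close>

lemma tight: "tight \<mu>"
  unfolding tight_def
proof (intro conjI allI impI)
  fix \<epsilon> :: real assume "\<epsilon> > 0"
  obtain D where D: "\<And>n. norm (\<integral>x. x ^ 2 \<partial>\<mu> n) \<le> D" "D > 0"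
    using convergent_imp_Bseq[OF convergentI[OF conv[of 2]]] by (auto simp: Bseq_def)
  define R where "R = max 1 (2 * D / \<epsilon>)"
  have R: "R \<ge> 1" "D / R < \<epsilon>"
    using D(2) \<open>\<epsilon> > 0\<close> by (auto simp: R_def field_simps max_def)
  have "measure (\<mu> n) {- R<..R} > 1 - \<epsilon>" for n
  proof -
    interpret real_distribution "\<mu> n" by (rule rd)
    have "prob {x \<in> space (\<mu> n). R\<^sup>2 \<le> x ^ 2} \<le> (\<integral>x. x ^ 2 \<partial>\<mu> n) / R\<^sup>2"
      using R int[of n 2] by (intro integral_Markov_inequality_measure[where A = "{}"]) auto
    also have "\<dots> \<le> D / R\<^sup>2" using D(1)[of n] R by (intro divide_right_mono) auto
    also have "\<dots> \<le> D / R" using R D(2) by (intro divide_left_mono) (auto simp: power2_eq_square)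
    also have "\<dots> < \<epsilon>" by fact
    finally have "prob {x \<in> space (\<mu> n). R\<^sup>2 \<le> x ^ 2} < \<epsilon>" .
    moreover have "prob (UNIV - {- R<..R}) \<le> prob {x \<in> space (\<mu> n). R\<^sup>2 \<le> x ^ 2}"
    proof (rule finite_measure_mono)
      show "UNIV - {- R<..R} \<subseteq> {x \<in> space (\<mu> n). R\<^sup>2 \<le> x ^ 2}"
        using R by (auto simp: abs_le_square_iff[symmetric] not_le not_less)
    qed simp
    moreover have "prob (UNIV - {- R<..R}) = 1 - prob {- R<..R}"
      using prob_compl[of "{- R<..R}"] by simp
    ultimately show ?thesis by simp
  qed
  then show "\<exists>a b. a < b \<and> (\<forall>n. measure (\<mu> n) {a<..b} > 1 - \<epsilon>)"
    using R by (intro exI[of _ "- R"] exI[of _ R]) auto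
qed (rule rd)

text \<open>The growth condition determines the characteristic function of any weak limit, hence the limit.\<close>

lemma char_weak_limit:
  assumes "strict_mono s" "real_distribution \<nu>" "weak_conv_m (\<mu> \<circ> s) \<nu>"
  shows "(\<lambda>q. \<Sum>k\<le>2 * q. (\<i> * t) ^ k / fact k * c k) \<longlonglongrightarrow> char \<nu> t"
proof -
  have ch: "(\<lambda>n. char (\<mu> (s n)) t) \<longlonglongrightarrow> char \<nu> t"
    using levy_continuity1[of "\<mu> \<circ> s" \<nu> t] assms rd by (simp add: comp_def)
  have conv_s: "(\<lambda>n. \<integral>x. x ^ p \<partial>\<mu> (s n)) \<longlonglongrightarrow> c p" for p
    using LIMSEQ_subseq_LIMSEQ[OF conv[of p] assms(1)] by (simp add: comp_def)
  \<comment> \<open>Even orders, because the Taylor remainder of a characteristic function is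
    bounded by an absolute moment, which at even order is a moment.\<close>
  let ?T = "\<lambda>q. \<Sum>k\<le>2 * q. (\<i> * t) ^ k / fact k * c k" and ?E = "\<lambda>q n. \<Sum>k\<le>2 * q. (\<i> * t) ^ k / fact k * (\<integral>x. x ^ k \<partial>\<mu> (s n))"
    and ?b = "\<lambda>q. 2 * \<bar>t\<bar> ^ (2 * q) / fact (2 * q)"
  have bound: "cmod (?T q - char \<nu> t) \<le> 2 * (inverse (fact (2 * q)) * (\<bar>t\<bar> * \<bar>C\<bar>) ^ (2 * q))" for q
  proof -
    have "cmod (char \<nu> t - ?T q) \<le> ?b q * c (2 * q)"
    proof (rule LIMSEQ_le)
      show "(\<lambda>n. cmod (char (\<mu> (s n)) t - ?E q n)) \<longlonglongrightarrow>
        cmod (char \<nu> t - ?T q)"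
        by (intro tendsto_intros ch conv_s)
      show "(\<lambda>n. ?b q * (\<integral>x. x ^ (2 * q) \<partial>\<mu> (s n))) \<longlonglongrightarrow>
        ?b q * c (2 * q)"
        by (intro tendsto_intros conv_s)
      show "\<exists>n0. \<forall>n\<ge>n0. cmod (char (\<mu> (s n)) t - ?E q n)
        \<le> ?b q * (\<integral>x. x ^ (2 * q) \<partial>\<mu> (s n))"
      proof (intro exI allI impI)
        fix n
        interpret real_distribution "\<mu> (s n)" by (rule rd)
        have "\<bar>x :: real\<bar> ^ (2 * q) = x ^ (2 * q)" for x by (rule power_even_abs) simp
        then show "cmod (char (\<mu> (s n)) t - ?E q n)
        \<le> ?b q * (\<integral>x. x ^ (2 * q) \<partial>\<mu> (s n))"
          using char_approx1[of "2 * q" t] int by simp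
      qed
    qed
    also have "\<dots> \<le> ?b q * \<bar>C\<bar> ^ (2 * q)"
      using growth[of "2 * q"] by (intro mult_left_mono) (auto simp: power_even_abs)
    also have "\<dots> = 2 * (inverse (fact (2 * q)) * (\<bar>t\<bar> * \<bar>C\<bar>) ^ (2 * q))"
      by (simp add: field_simps power_mult_distrib)
    finally show ?thesis by (subst norm_minus_commute)
  qed
  have "(\<lambda>k. inverse (fact k) * (\<bar>t\<bar> * \<bar>C\<bar>) ^ k) \<longlonglongrightarrow> 0"
    by (rule summable_LIMSEQ_zero[OF summable_exp])
  then have "(\<lambda>q. inverse (fact (2 * q)) * (\<bar>t\<bar> * \<bar>C\<bar>) ^ (2 * q)) \<longlonglongrightarrow> 0"
    by (rule LIMSEQ_subseq_LIMSEQ[of _ _ "\<lambda>q. 2 * q", unfolded comp_def]) (auto simp: strict_mono_def)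
  then have "(\<lambda>q. 2 * (inverse (fact (2 * q)) * (\<bar>t\<bar> * \<bar>C\<bar>) ^ (2 * q))) \<longlonglongrightarrow> 0"
    using tendsto_mult_right_zero by blast
  then have "(\<lambda>q. ?T q - char \<nu> t) \<longlonglongrightarrow> 0"
    by (rule Lim_null_comparison[rotated]) (use bound in auto)
  then show ?thesis by (rule LIM_zero_cancel)
qed

text \<open>Powers are unbounded, so weak convergence does not reach them directly. For even powers
  the clipped integrals increase with the level and stay below \<open>c (2 * q)\<close>; monotone
  convergence gives integrability and an upper bound. At order 2p this bound controls the clipping
  error of x^p both along the sequence and in the limit.\<close>

lemma weak_limit_moments:
  assumes \<nu>: "real_distribution \<nu>" and wc: "weak_conv_m \<mu> \<nu>"
  shows "integrable \<nu> (\<lambda>x. x ^ p)" "(\<integral>x. x ^ p \<partial>\<nu>) = c p"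
proof -
  interpret \<nu>: real_distribution \<nu> by (rule \<nu>)
  have clip_int: "integrable N (\<lambda>x. clip R x ^ p)" if "real_distribution N" "R \<ge> 0" for N R p
  proof -
    interpret real_distribution N by fact
    show ?thesis using abs_clip_power_le[OF that(2)]
      by (intro integrable_const_bound[where B = "R ^ p"]) auto
  qed
  have clip_conv: "(\<lambda>n. \<integral>x. clip R x ^ p \<partial>\<mu> n) \<longlonglongrightarrow> (\<integral>x. clip R x ^ p \<partial>\<nu>)" if "R \<ge> 0" for R p
    by (rule weak_conv_imp_integral_bdd_continuous_conv[OF rd \<nu> wc isCont_clip_power, where B = "R ^ p"])
      (use abs_clip_power_le[OF that] in auto)
  have even: "integrable \<nu> (\<lambda>x. x ^ (2 * q)) \<and> (\<integral>x. x ^ (2 * q) \<partial>\<nu>) \<le> c (2 * q)" for q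
  proof -
    define f where "f j x = clip (real j) x ^ (2 * q)" for j x
    have f_mono: "f i x \<le> f j x" if "i \<le> j" for i j x
    proof -
      have "\<bar>clip (real i) x\<bar> ^ (2 * q) \<le> \<bar>clip (real j) x\<bar> ^ (2 * q)"
        using that by (intro power_mono) (auto simp: clip_def)
      then show ?thesis by (simp add: f_def power_even_abs)
    qed
    have f_lim: "(\<lambda>j. f j x) \<longlonglongrightarrow> x ^ (2 * q)" for x
    proof (rule tendsto_eventually)
      obtain J where J: "\<bar>x\<bar> \<le> real J" using real_arch_simple by blast
      show "\<forall>\<^sub>F j in sequentially. f j x = x ^ (2 * q)"
        using eventually_ge_at_top[of J]
      proof eventually_elim
        case (elim j)
        then have "clip (real j) x = x" using J by (auto simp: clip_def)
        then show ?case by (simp add: f_def)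
      qed
    qed
    have f_int: "integrable \<nu> (f j)" for j
      unfolding f_def by (intro clip_int \<nu>) simp
    have le: "(\<integral>x. f j x \<partial>\<nu>) \<le> c (2 * q)" for j
    proof (rule LIMSEQ_le)
      show "(\<lambda>n. \<integral>x. f j x \<partial>\<mu> n) \<longlonglongrightarrow> (\<integral>x. f j x \<partial>\<nu>)" unfolding f_def by (rule clip_conv) simp
      show "(\<lambda>n. \<integral>x. x ^ (2 * q) \<partial>\<mu> n) \<longlonglongrightarrow> c (2 * q)" by (rule conv)
      have "(\<integral>x. f j x \<partial>\<mu> n) \<le> (\<integral>x. x ^ (2 * q) \<partial>\<mu> n)" for n
      proof (rule integral_mono)
        show "integrable (\<mu> n) (f j)" unfolding f_def by (intro clip_int rd) simp
        show "f j x \<le> x ^ (2 * q)" for x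
          using abs_clip_power_le'[of "real j" x "2 * q"] by (simp add: f_def power_even_abs)
      qed (rule int)
      then show "\<exists>n0. \<forall>n\<ge>n0. (\<integral>x. f j x \<partial>\<mu> n) \<le> (\<integral>x. x ^ (2 * q) \<partial>\<mu> n)" by blast
    qed
    have "incseq (\<lambda>j. \<integral>x. f j x \<partial>\<nu>)"
      by (intro incseq_SucI integral_mono f_int f_mono) simp
    then obtain L where L: "(\<lambda>j. \<integral>x. f j x \<partial>\<nu>) \<longlonglongrightarrow> L"
      using incseq_convergent[of _ "c (2 * q)"] le by blast
    have f_nn: "0 \<le> f j x" for j x by (simp add: f_def)
    have prems: "AE x in \<nu>. mono (\<lambda>n. f n x)" "\<And>i. AE x in \<nu>. 0 \<le> f i x"
      "AE x in \<nu>. (\<lambda>i. f i x) \<longlonglongrightarrow> x ^ (2 * q)" "(\<lambda>x. x ^ (2 * q)) \<in> borel_measurable \<nu>"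
      using f_mono f_nn f_lim by (auto simp: mono_def)
    have "integrable \<nu> (\<lambda>x. x ^ (2 * q))" "(\<integral>x. x ^ (2 * q) \<partial>\<nu>) = L"
      using integral_monotone_convergence_nonneg[OF f_int prems(1-3) L prems(4)] by auto
    moreover have "L \<le> c (2 * q)" using L le by (intro LIMSEQ_le_const2[OF L]) auto
    ultimately show ?thesis by simp
  qed
  show ip: "integrable \<nu> (\<lambda>x. x ^ p)" for p
  proof (rule Bochner_Integration.integrable_bound)
    show "integrable \<nu> (\<lambda>x. 1 + x ^ (2 * p))" using even[of p] by simp
    have "\<bar>x\<bar> ^ p \<le> 1 + x ^ (2 * p)" for x :: real
    proof -
      define y where "y = \<bar>x\<bar> ^ p"
      have "x ^ (2 * p) = \<bar>x\<bar> ^ (2 * p)" by (rule power_even_abs[symmetric]) simp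
      also have "\<dots> = y * y" by (simp add: y_def mult_2 power_add)
      finally have "x ^ (2 * p) = y * y" .
      moreover have "0 \<le> (y - 1) * (y - 1)" "0 \<le> y" by (simp_all add: y_def)
      ultimately show ?thesis unfolding y_def[symmetric] by (simp add: algebra_simps)
    qed
    then show "AE x in \<nu>. norm (x ^ p) \<le> norm (1 + x ^ (2 * p))"
      by (intro AE_I2) (simp add: power_abs zero_le_even_power order_trans[OF _ abs_ge_self])
  qed simp
  show "(\<integral>x. x ^ p \<partial>\<nu>) = c p"
  proof (cases "p = 0")
    case True
    have "(\<lambda>n. \<integral>x. x ^ 0 \<partial>\<mu> n) = (\<lambda>_. 1)"
      using prob_space.prob_space[OF real_distribution.axioms(1)[OF rd]] by simp
    then have "c 0 = 1" using conv[of 0] by (metis LIMSEQ_unique tendsto_const)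
    then show ?thesis using True \<nu>.prob_space by simp
  next
    case False
    have bound: "\<bar>(\<integral>x. x ^ p \<partial>\<nu>) - c p\<bar> \<le> 2 * c (2 * p) * (1 / real R)" if R: "R \<ge> 1" for R
    proof -
      have diff: "\<bar>(\<integral>x. x ^ p \<partial>N) - (\<integral>x. clip R x ^ p \<partial>N)\<bar> \<le> (\<integral>x. x ^ (2 * p) \<partial>N) / R"
        if N: "real_distribution N" "\<And>p. integrable N (\<lambda>x. x ^ p)" for N
      proof -
        have "\<bar>(\<integral>x. x ^ p \<partial>N) - (\<integral>x. clip R x ^ p \<partial>N)\<bar> = \<bar>\<integral>x. x ^ p - clip R x ^ p \<partial>N\<bar>"
          using N(2) clip_int[OF N(1), of R p] by simp
        also have "\<dots> \<le> (\<integral>x. \<bar>x ^ p - clip R x ^ p\<bar> \<partial>N)" by (rule integral_abs_bound)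
        also have "\<dots> \<le> (\<integral>x. x ^ (2 * p) / R \<partial>N)"
          using N(2) clip_int[OF N(1), of R p] R False
          by (intro integral_mono power_diff_clip_le integrable_abs Bochner_Integration.integrable_diff integrable_divide) auto
        finally show ?thesis by simp
      qed
      have "\<bar>c p - (\<integral>x. clip R x ^ p \<partial>\<nu>)\<bar> \<le> c (2 * p) / R"
      proof (rule LIMSEQ_le)
        show "(\<lambda>n. \<bar>(\<integral>x. x ^ p \<partial>\<mu> n) - (\<integral>x. clip R x ^ p \<partial>\<mu> n)\<bar>) \<longlonglongrightarrow> \<bar>c p - (\<integral>x. clip R x ^ p \<partial>\<nu>)\<bar>"
          by (intro tendsto_intros conv clip_conv) simp
        show "(\<lambda>n. (\<integral>x. x ^ (2 * p) \<partial>\<mu> n) / R) \<longlonglongrightarrow> c (2 * p) / R"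
          using R by (intro tendsto_intros conv) auto
      qed (use diff rd int in blast)
      moreover have "\<bar>(\<integral>x. x ^ p \<partial>\<nu>) - (\<integral>x. clip R x ^ p \<partial>\<nu>)\<bar> \<le> c (2 * p) / R"
        using diff[OF \<nu> ip] divide_right_mono[of "\<integral>x. x ^ (2 * p) \<partial>\<nu>" "c (2 * p)" "real R"] even[of p]
        by linarith
      ultimately show ?thesis by simp
    qed
    have "(\<lambda>R. 2 * c (2 * p) * (1 / real R)) \<longlonglongrightarrow> 2 * c (2 * p) * 0"
      by (intro tendsto_intros lim_1_over_n)
    then have "\<bar>(\<integral>x. x ^ p \<partial>\<nu>) - c p\<bar> \<le> 0"
      using bound by (intro LIMSEQ_le_const[of "\<lambda>R. 2 * c (2 * p) * (1 / real R)"]) auto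
    then show ?thesis by simp
  qed
qed

text \<open>Tightness supplies a subsequential limit; every other one has the same characteristic
  function, computed from \<open>c\<close> alone, so the whole sequence converges.\<close>

lemma weak_limit:
  obtains \<nu> where "real_distribution \<nu>" "weak_conv_m \<mu> \<nu>"
    "\<And>p. integrable \<nu> (\<lambda>x. x ^ p)" "\<And>p. (\<integral>x. x ^ p \<partial>\<nu>) = c p"
proof -
  obtain r \<nu> where r: "strict_mono (r :: nat \<Rightarrow> nat)" and \<nu>: "real_distribution \<nu>" and "weak_conv_m (\<mu> \<circ> id \<circ> r) \<nu>"
    using tight_imp_convergent_subsubsequence[OF tight strict_mono_id] by blast
  then have ch: "(\<lambda>q. \<Sum>k\<le>2 * q. (\<i> * t) ^ k / fact k * c k) \<longlonglongrightarrow> char \<nu> t" for t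
    by (intro char_weak_limit) simp_all
  have wc: "weak_conv_m \<mu> \<nu>"
  proof (rule tight_subseq_weak_converge[OF rd \<nu> tight])
    fix s \<nu>' assume s: "strict_mono (s :: nat \<Rightarrow> nat)" and \<nu>': "real_distribution \<nu>'" and w: "weak_conv_m (\<mu> \<circ> s) \<nu>'"
    have "char \<nu>' = char \<nu>"
      using LIMSEQ_unique[OF char_weak_limit[OF s \<nu>' w] ch] by auto
    then have "\<nu>' = \<nu>" using Levy_uniqueness \<nu> \<nu>' by blast
    with w show "weak_conv_m (\<mu> \<circ> s) \<nu>" by simp
  qed
  show ?thesis by (rule that[OF \<nu> wc weak_limit_moments[OF \<nu> wc]])
qed

end

section \<open>Absence of atoms\<close>

definition raney_fps :: "nat \<Rightarrow> complex fps" where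
  "raney_fps m = Abs_fps (\<lambda>p. of_nat (raney m p 1))"

lemma raney_fps_nth: "fps_nth (raney_fps m) p = of_nat (raney m p 1)"
  by (simp add: raney_fps_def)

lemma raney_fps_power: "fps_nth (raney_fps m ^ r) p = of_nat (raney m p r)"
proof (induction r arbitrary: p)
  case 0
  then show ?case by (cases p) auto
next
  case (Suc r)
  have "fps_nth (raney_fps m ^ Suc r) p = (\<Sum>j=0..p. of_nat (raney m j 1) * of_nat (raney m (p - j) r))"
    by (simp add: fps_mult_nth Suc raney_fps_nth)
  also have "\<dots> = of_nat (\<Sum>j\<le>p. raney m j 1 * raney m (p - j) r)"
    by (simp add: atLeast0AtMost)
  finally show ?case by (simp add: raney_add)
qed

lemma raney_fps_eq: "raney_fps m = 1 + fps_X * raney_fps m ^ (m + 1)"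
proof (rule fps_ext)
  fix p
  show "fps_nth (raney_fps m) p = fps_nth (1 + fps_X * raney_fps m ^ (m + 1)) p"
  proof (cases p)
    case (Suc q)
    have "raney m (Suc q) 1 = raney m q (m + 1)" by simp
    then show ?thesis unfolding Suc fps_add_nth fps_X_mult_nth raney_fps_power raney_fps_nth
      by simp
  qed (simp add: raney_fps_nth)
qed

lemma (in prob_space) norm_expectation_le:
  fixes f :: "'a \<Rightarrow> complex"
  assumes [measurable]: "f \<in> borel_measurable M" and bd: "AE x in M. cmod (f x) \<le> B"
  shows "cmod (expectation f) \<le> B"
proof -
  have "cmod (expectation f) \<le> expectation (\<lambda>x. cmod (f x))" by (rule integral_norm_bound)
  also have "\<dots> \<le> expectation (\<lambda>_. B)"
    using bd by (intro integral_mono_AE integrable_const_bound[where B = B and f = "\<lambda>x. cmod (f x)"]) auto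
  finally show ?thesis using prob_space by simp
qed

text \<open>The transform $S(z) = \int (1 - zx)^{-1} d\nu(x)$ satisfies $S = 1 + z S^{m+1}$ near the origin and,
  by analytic continuation, off the real axis. This bounds $S$ near any $1/t \ne 0$, whereas an atom at
  $t$ would make it unbounded there; an atom at $0$ is excluded by letting $z$ tend to infinity.\<close>

locale fuss_catalan_law = real_distribution \<nu> for \<nu> +
  fixes m :: nat
  assumes m: "m \<ge> 1"
    and moment_int: "\<And>p. integrable \<nu> (\<lambda>x. x ^ p)"
    and moment: "\<And>p. expectation (\<lambda>x. x ^ p) = real (raney m p 1)"
begin

text \<open>Twice the growth rate of the moments; the factor 2 makes the Markov bounds decay
  geometrically in the order of the moment.\<close>

definition bound :: real where "bound = 2 * 2 ^ (m + 1)"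

lemma bound_pos: "bound > 0" by (simp add: bound_def)

text \<open>Markov's inequality with x^(2q) bounds the mass beyond \<open>bound\<close> by 4^(-q),
  for every q.\<close>

lemma AE_bound: "AE x in \<nu>. \<bar>x\<bar> \<le> bound"
proof -
  have le: "prob {x \<in> space \<nu>. bound ^ (2 * q) \<le> x ^ (2 * q)} \<le> (1 / 2) ^ (2 * q)" for q
  proof -
    have "prob {x \<in> space \<nu>. bound ^ (2 * q) \<le> x ^ (2 * q)} \<le> expectation (\<lambda>x. x ^ (2 * q)) / bound ^ (2 * q)"
      using moment_int[of "2 * q"] bound_pos
      by (intro integral_Markov_inequality_measure[where A = "{}"]) auto
    also have "\<dots> \<le> (2 ^ (m + 1)) ^ (2 * q) / bound ^ (2 * q)"
      unfolding moment using bound_pos by (intro divide_right_mono raney_le) simp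
    also have "\<dots> = (1 / 2) ^ (2 * q)"
      by (simp add: bound_def power_divide[symmetric])
    finally show ?thesis .
  qed
  have sub: "prob {x \<in> space \<nu>. bound < \<bar>x\<bar>} \<le> (1 / 4) ^ q" for q
  proof -
    have "{x \<in> space \<nu>. bound < \<bar>x\<bar>} \<subseteq> {x \<in> space \<nu>. bound ^ (2 * q) \<le> x ^ (2 * q)}"
    proof safe
      fix x assume "bound < \<bar>x\<bar>"
      then have "bound ^ (2 * q) \<le> \<bar>x\<bar> ^ (2 * q)" using bound_pos by (intro power_mono) auto
      then show "bound ^ (2 * q) \<le> x ^ (2 * q)" by (simp add: power_even_abs)
    qed
    then have "prob {x \<in> space \<nu>. bound < \<bar>x\<bar>} \<le> prob {x \<in> space \<nu>. bound ^ (2 * q) \<le> x ^ (2 * q)}"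
      by (rule finite_measure_mono) simp
    also have "\<dots> \<le> (1 / 2) ^ (2 * q)" by (rule le)
    also have "\<dots> = (1 / 4) ^ q" by (simp add: power_mult power2_eq_square)
    finally show ?thesis .
  qed
  have "(\<lambda>q. (1 / 4 :: real) ^ q) \<longlonglongrightarrow> 0" by (rule LIMSEQ_power_zero) simp
  then have "prob {x \<in> space \<nu>. bound < \<bar>x\<bar>} \<le> 0"
    using sub by (intro LIMSEQ_le_const) auto
  then have "prob {x \<in> space \<nu>. bound < \<bar>x\<bar>} = 0" by (simp add: measure_le_0_iff)
  then have "AE x in \<nu>. x \<notin> {x \<in> space \<nu>. bound < \<bar>x\<bar>}"
    by (subst AE_iff_measurable[OF _ refl]) (auto simp: emeasure_eq_measure)
  then show ?thesis by eventually_elim auto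
qed

definition S :: "complex \<Rightarrow> complex" where
  "S z = (\<integral>x. 1 / (1 - z * of_real x) \<partial>\<nu>)"

text \<open>The plane slit along the two real rays |z| \<ge> 1/\<open>bound\<close>. The integrand
  of \<open>S\<close> has no pole there for |x| \<le> \<open>bound\<close>, and being starlike about
  0 the set joins both half planes to the disc of the power series.\<close>

definition dom :: "complex set" where
  "dom = {z. Im z \<noteq> 0 \<or> \<bar>Re z\<bar> < 1 / bound}"

lemma dom_bounded_below:
  assumes "z \<in> dom"
  obtains \<delta> where "\<delta> > 0" "\<And>x. \<bar>x\<bar> \<le> bound \<Longrightarrow> cmod (1 - z * of_real x) \<ge> \<delta>"
proof -
  have ne: "1 - z * of_real x \<noteq> 0" if "\<bar>x\<bar> \<le> bound" for x
  proof
    assume "1 - z * of_real x = 0"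
    then have "Re z * x = 1" "Im z * x = 0" by (auto simp: complex_eq_iff)
    then have "Im z = 0" "\<bar>Re z\<bar> * \<bar>x\<bar> = 1" by (auto simp flip: abs_mult)
    moreover from this have "\<bar>Re z\<bar> < 1 / bound" using assms by (simp add: dom_def)
    then have "\<bar>Re z\<bar> * bound < 1" using bound_pos by (simp add: field_simps)
    moreover have "\<bar>Re z\<bar> * \<bar>x\<bar> \<le> \<bar>Re z\<bar> * bound" using that by (intro mult_left_mono) auto
    ultimately show False by linarith
  qed
  have "compact {- bound..bound}" "{- bound..bound} \<noteq> {}" using bound_pos by auto
  moreover have "continuous_on {- bound..bound} (\<lambda>x. cmod (1 - z * of_real x))" by (intro continuous_intros)
  ultimately obtain x0 where x0: "x0 \<in> {- bound..bound}"
    "\<And>x. x \<in> {- bound..bound} \<Longrightarrow> cmod (1 - z * of_real x0) \<le> cmod (1 - z * of_real x)"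
    using continuous_attains_inf by metis
  show ?thesis
  proof (rule that[of "cmod (1 - z * of_real x0)"])
    have "\<bar>x0\<bar> \<le> bound" using x0(1) by auto
    from ne[OF this] show "0 < cmod (1 - z * of_real x0)" by (simp only: zero_less_norm_iff not_False_eq_True)
    show "cmod (1 - z * of_real x0) \<le> cmod (1 - z * of_real x)" if "\<bar>x\<bar> \<le> bound" for x
      using that by (intro x0(2)) auto
  qed
qed

lemma open_dom: "open dom"
proof -
  have "open {z. Im z \<noteq> 0}" "open {z. \<bar>Re z\<bar> < 1 / bound}"
    by (intro open_Collect_neq open_Collect_less continuous_intros)+
  moreover have "dom = {z. Im z \<noteq> 0} \<union> {z. \<bar>Re z\<bar> < 1 / bound}" by (auto simp: dom_def)
  ultimately show ?thesis by auto
qed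

lemma connected_dom: "connected dom"
proof (rule starlike_imp_connected)
  show "starlike dom" unfolding starlike_def
  proof (intro bexI ballI subsetI)
    show "0 \<in> dom" using bound_pos by (simp add: dom_def)
    fix z y assume z: "z \<in> dom" and "y \<in> closed_segment 0 z"
    then obtain u where u: "y = of_real u * z" "0 \<le> u" "u \<le> 1"
      by (auto simp: in_segment scaleR_conv_of_real)
    have "\<bar>Re y\<bar> \<le> \<bar>Re z\<bar>" using u by (simp add: abs_mult mult_left_le_one_le)
    then show "y \<in> dom" using z u bound_pos by (cases "u = 0") (auto simp: dom_def)
  qed
qed

lemma ball_dom: "ball 0 (1 / bound) \<subseteq> dom"
proof
  fix z :: complex assume "z \<in> ball 0 (1 / bound)"
  then have "\<bar>Re z\<bar> < 1 / bound" using abs_Re_le_cmod[of z] by simp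
  then show "z \<in> dom" by (simp add: dom_def)
qed

text \<open>By the resolvent identity the difference quotient of the integrand minus its derivative
  is (z - z0) x^2/(a b^2), with a and b the denominators at z and z0. This is O(z - z0) uniformly in
  |x| \<le> \<open>bound\<close>, so it survives integration.\<close>

lemma S_holomorphic: "S holomorphic_on dom"
proof -
  have "S field_differentiable at z0" if z0: "z0 \<in> dom" for z0
  proof -
    obtain \<delta> where \<delta>: "\<delta> > 0" "\<And>x. \<bar>x\<bar> \<le> bound \<Longrightarrow> cmod (1 - z0 * of_real x) \<ge> \<delta>"
      using dom_bounded_below[OF z0] by blast
    \<comment> \<open>Moving z by less than this changes z x by at most \<delta>/2, so the
      denominators stay above \<delta>/2.\<close>
    define d where "d = \<delta> / (2 * bound)"
    have d: "d > 0" using \<delta> bound_pos by (simp add: d_def)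
    have near: "cmod (1 - z * of_real x) \<ge> \<delta> / 2" if "cmod (z - z0) < d" "\<bar>x\<bar> \<le> bound" for z x
    proof -
      have "cmod ((z - z0) * of_real x) \<le> d * bound"
        unfolding norm_mult using that d by (intro mult_mono) auto
      also have "\<dots> = \<delta> / 2" using bound_pos by (simp add: d_def)
      finally have "cmod ((z - z0) * of_real x) \<le> \<delta> / 2" .
      moreover have "1 - z0 * of_real x = (1 - z * of_real x) + (z - z0) * of_real x" by (simp add: algebra_simps)
      then have "cmod (1 - z0 * of_real x) \<le> cmod (1 - z * of_real x) + cmod ((z - z0) * of_real x)"
        by (metis norm_triangle_ineq)
      ultimately show ?thesis using \<delta>(2)[OF that(2)] by linarith
    qed
    have int1: "integrable \<nu> (\<lambda>x. 1 / (1 - z * of_real x))" if "cmod (z - z0) < d" for z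
    proof (rule integrable_const_bound[where B = "2 / \<delta>"])
      show "AE x in \<nu>. cmod (1 / (1 - z * of_real x)) \<le> 2 / \<delta>"
        using AE_bound
      proof eventually_elim
        case (elim x)
        have "1 / cmod (1 - z * of_real x) \<le> 1 / (\<delta> / 2)"
          using near[OF that elim] \<delta>(1) by (intro frac_le) auto
        then show ?case by (simp add: norm_divide)
      qed
    qed simp
    have int2: "integrable \<nu> (\<lambda>x. of_real x / (1 - z0 * of_real x) ^ 2)"
    proof (rule integrable_const_bound[where B = "bound / \<delta> ^ 2"])
      show "AE x in \<nu>. cmod (of_real x / (1 - z0 * of_real x) ^ 2) \<le> bound / \<delta> ^ 2"
        using AE_bound
      proof eventually_elim
        case (elim x)
        then show ?case using \<delta>(2)[OF elim] \<delta>(1)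
          by (auto simp: norm_divide norm_power intro!: frac_le power_mono)
      qed
    qed simp
    define D where "D = (\<integral>x. of_real x / (1 - z0 * of_real x) ^ 2 \<partial>\<nu>)"
    \<comment> \<open>From |x| \<le> \<open>bound\<close>, |a| \<ge> \<delta>/2 and |b| \<ge>
      \<delta> in the error term x^2/(a b^2).\<close>
    define E where "E = bound ^ 2 / (\<delta> / 2 * \<delta> ^ 2)"
    have est: "cmod ((S z - S z0) / (z - z0) - D) \<le> cmod (z - z0) * E" if "cmod (z - z0) < d" "z \<noteq> z0" for z
    proof -
      have z0': "cmod (z0 - z0) < d" using d by simp
      have "(S z - S z0) / (z - z0) - D =
        (\<integral>x. (1 / (1 - z * of_real x) - 1 / (1 - z0 * of_real x)) / (z - z0) - of_real x / (1 - z0 * of_real x) ^ 2 \<partial>\<nu>)"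
        unfolding S_def D_def using int1[OF that(1)] int1[OF z0'] int2 by simp
      also have "cmod \<dots> \<le> cmod (z - z0) * E"
      proof (rule norm_expectation_le)
        show "AE x in \<nu>. cmod ((1 / (1 - z * of_real x) - 1 / (1 - z0 * of_real x)) / (z - z0) - of_real x / (1 - z0 * of_real x) ^ 2) \<le> cmod (z - z0) * E"
          using AE_bound
        proof eventually_elim
          case (elim x)
          define a where "a = 1 - z * of_real x"
          define b where "b = 1 - z0 * of_real x"
          have a: "cmod a \<ge> \<delta> / 2" and b: "cmod b \<ge> \<delta>"
            using near[OF that(1) elim] \<delta>(2)[OF elim] by (auto simp: a_def b_def)
          then have ne: "a \<noteq> 0" "b \<noteq> 0" using \<delta>(1) by auto
          have ba: "b - a = (z - z0) * of_real x" by (simp add: a_def b_def algebra_simps)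
          have "(1 / a - 1 / b) / (z - z0) = of_real x / (a * b)"
          proof -
            have "1 / a - 1 / b = (b - a) / (a * b)" using ne by (simp add: field_simps)
            then show ?thesis unfolding ba using that(2) by simp
          qed
          moreover have "y / (a * b) - y / b ^ 2 = y * (b - a) / (a * b ^ 2)" for y
            using ne by (simp add: field_simps power2_eq_square)
          ultimately have "(1 / a - 1 / b) / (z - z0) - of_real x / b ^ 2 = of_real x * (b - a) / (a * b ^ 2)"
            by simp
          also have "\<dots> = (z - z0) * (of_real x ^ 2 / (a * b ^ 2))" unfolding ba by (simp add: power2_eq_square)
          also have "cmod \<dots> \<le> cmod (z - z0) * E"
            unfolding norm_mult norm_divide norm_power E_def norm_of_real
            using a b \<delta>(1) elim bound_pos by (intro mult_left_mono frac_le mult_mono power_mono) auto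
          finally show ?case unfolding a_def b_def .
        qed
      qed simp
      finally show ?thesis .
    qed
    have "((\<lambda>z. (S z - S z0) / (z - z0) - D) \<longlongrightarrow> 0) (at z0)"
    proof (rule Lim_null_comparison)
      show "\<forall>\<^sub>F z in at z0. cmod ((S z - S z0) / (z - z0) - D) \<le> cmod (z - z0) * E"
        using eventually_at_ball[OF d, of z0 UNIV] eventually_neq_at_within[of z0 z0 UNIV]
      proof eventually_elim
        case (elim z)
        then have "cmod (z - z0) < d" by (simp add: dist_norm norm_minus_commute)
        then show ?case using elim by (intro est)
      qed
      have "((\<lambda>z. cmod (z - z0) * E) \<longlongrightarrow> cmod (z0 - z0) * E) (at z0)" by (intro tendsto_intros)
      then show "((\<lambda>z. cmod (z - z0) * E) \<longlongrightarrow> 0) (at z0)" by simp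
    qed
    then have "((\<lambda>z. (S z - S z0) / (z - z0)) \<longlongrightarrow> D) (at z0)" by (rule LIM_zero_cancel)
    then show ?thesis
      unfolding field_differentiable_def has_field_derivative_iff by blast
  qed
  then show ?thesis
    by (simp add: holomorphic_on_def field_differentiable_at_within)
qed

text \<open>Geometric expansion under the integral; since |z| times \<open>bound\<close> is below 1,
  a geometric series dominates it.\<close>

lemma S_sums:
  assumes "cmod z < 1 / bound"
  shows "(\<lambda>p. of_nat (raney m p 1) * z ^ p) sums S z"
proof -
  have zb: "cmod z * bound < 1" using assms bound_pos by (simp add: field_simps)
  have le: "AE x in \<nu>. cmod (z * of_real x) \<le> cmod z * bound"
    using AE_bound by eventually_elim (auto simp: norm_mult intro!: mult_left_mono)
  have int: "integrable \<nu> (\<lambda>x. (z * of_real x) ^ p)" for p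
  proof -
    have "integrable \<nu> (\<lambda>x. z ^ p * complex_of_real (x ^ p))"
      by (intro integrable_mult_right integrable_of_real moment_int)
    then show ?thesis by (simp add: power_mult_distrib)
  qed
  have "(\<lambda>p. \<integral>x. (z * of_real x) ^ p \<partial>\<nu>) sums (\<integral>x. (\<Sum>p. (z * of_real x) ^ p) \<partial>\<nu>)"
  proof (rule sums_integral[OF int])
    show "AE x in \<nu>. summable (\<lambda>p. cmod ((z * of_real x) ^ p))"
      using le by eventually_elim (use zb in \<open>auto simp: norm_power intro!: summable_geometric\<close>)
    show "summable (\<lambda>p. \<integral>x. cmod ((z * of_real x) ^ p) \<partial>\<nu>)"
    proof (rule summable_comparison_test')
      show "summable (\<lambda>p. (cmod z * bound) ^ p)"
        using zb bound_pos by (intro summable_geometric) (simp add: abs_mult)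
      fix p :: nat
      have "(\<integral>x. cmod ((z * of_real x) ^ p) \<partial>\<nu>) \<le> (\<integral>x. (cmod z * bound) ^ p \<partial>\<nu>)"
      proof (rule integral_mono_AE)
        show "AE x in \<nu>. cmod ((z * of_real x) ^ p) \<le> (cmod z * bound) ^ p"
          using le by eventually_elim (auto simp: norm_power intro!: power_mono)
      qed (use int in \<open>auto intro: integrable_norm\<close>)
      then show "norm (\<integral>x. cmod ((z * of_real x) ^ p) \<partial>\<nu>) \<le> (cmod z * bound) ^ p"
        using prob_space by simp
    qed
  qed
  also have "(\<lambda>p. \<integral>x. (z * of_real x) ^ p \<partial>\<nu>) = (\<lambda>p. of_nat (raney m p 1) * z ^ p)"
  proof
    fix p
    have "(\<integral>x. (z * of_real x) ^ p \<partial>\<nu>) = (\<integral>x. z ^ p * complex_of_real (x ^ p) \<partial>\<nu>)"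
      by (simp add: power_mult_distrib)
    also have "\<dots> = z ^ p * of_real (expectation (\<lambda>x. x ^ p))"
      by (simp only: integral_mult_right_zero integral_complex_of_real)
    finally show "(\<integral>x. (z * of_real x) ^ p \<partial>\<nu>) = of_nat (raney m p 1) * z ^ p"
      unfolding moment by (simp add: mult.commute)
  qed
  also have "(\<integral>x. (\<Sum>p. (z * of_real x) ^ p) \<partial>\<nu>) = S z"
    unfolding S_def
  proof (rule integral_cong_AE)
    show "AE x in \<nu>. (\<Sum>p. (z * of_real x) ^ p) = 1 / (1 - z * of_real x)"
      using le by eventually_elim (use zb in \<open>auto intro!: suminf_geometric\<close>)
  qed measurable
  finally show ?thesis .
qed

lemma S_eq:
  assumes "z \<in> dom"
  shows "S z = 1 + z * S z ^ (m + 1)"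
proof (rule analytic_continuation_open[of "ball 0 (1 / bound)" dom S "\<lambda>z. 1 + z * S z ^ (m + 1)"])
  show "(\<lambda>z. 1 + z * S z ^ (m + 1)) holomorphic_on dom"
    by (intro holomorphic_intros S_holomorphic)
  fix z :: complex assume "z \<in> ball 0 (1 / bound)"
  then have z: "cmod z < 1 / bound" by simp
  let ?F = "raney_fps m"
  \<comment> \<open>Every radius below 1/\<open>bound\<close> is a point of convergence by
    \<open>S_sums\<close>, so the formal identity for M may be evaluated in the whole disc.\<close>
  have "conv_radius (fps_nth ?F) \<ge> ereal (1 / bound)"
  proof (rule conv_radius_geI_ex)
    fix r :: real assume "0 < r" "ereal r < ereal (1 / bound)"
    then have "cmod (of_real r) < 1 / bound" by simp
    from sums_summable[OF S_sums[OF this]] show "\<exists>z. cmod z = r \<and> summable (\<lambda>n. fps_nth ?F n * z ^ n)"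
      using \<open>0 < r\<close> by (intro exI[of _ "of_real r"]) (auto simp: raney_fps_def)
  qed
  then have r: "ereal (cmod z) < fps_conv_radius ?F"
    using z unfolding fps_conv_radius_def by (meson ereal_less_eq less_ereal.simps(1) order.strict_trans2)
  have r': "ereal (cmod z) < fps_conv_radius (?F ^ k)" for k
    using r fps_conv_radius_power[of ?F k] by (rule order.strict_trans2)
  have e: "eval_fps ?F z = S z"
    using sums_unique[OF S_sums[OF z]] by (simp add: eval_fps_def raney_fps_def)
  have r2: "ereal (cmod z) < fps_conv_radius (fps_X * ?F ^ (m + 1))"
    using r'[of "m + 1"] fps_conv_radius_mult[of fps_X "?F ^ (m + 1)"] by (simp del: power_Suc)
  have one: "ereal (cmod z) < fps_conv_radius 1" by simp
  have prod: "eval_fps (fps_X * ?F ^ k) z = z * eval_fps ?F z ^ k" for k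
    using r r'[of k] by (simp add: eval_fps_mult eval_fps_power)
  have "eval_fps ?F z = eval_fps (1 + fps_X * ?F ^ (m + 1)) z" using raney_fps_eq[of m] by simp
  also have "\<dots> = 1 + z * eval_fps ?F z ^ (m + 1)"
    unfolding eval_fps_add[OF one r2] prod by simp
  finally show "S z = 1 + z * S z ^ (m + 1)" unfolding e .
qed (use open_dom connected_dom ball_dom S_holomorphic assms bound_pos in auto)

lemma expectation_indicator_complex:
  "(\<integral>x. indicator {t} x \<partial>\<nu>) = complex_of_real (prob {t})"
proof -
  have "(\<integral>x. indicator {t} x \<partial>\<nu>) = (\<integral>x. complex_of_real (indicator {t} x) \<partial>\<nu>)"
    by (intro Bochner_Integration.integral_cong) (auto simp: indicator_def)
  also have "\<dots> = of_real (\<integral>x. indicator {t} x \<partial>\<nu>)" by (rule integral_complex_of_real)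
  finally show ?thesis by simp
qed

text \<open>Along z = i(n+1) the integrand of \<open>S\<close> is at most 1 in modulus and tends to
  the indicator of 0, so S tends to the mass at 0. The equation gives |S|^(m+1) = |S - 1|/|z| \<le>
  2/(n+1), which forces this limit to be 0.\<close>

lemma no_atom_zero: "prob {0} = 0"
proof -
  define z where "z n = \<i> * of_real (real (Suc n))" for n
  have z: "z n \<in> dom" "cmod (z n) = real (Suc n)" for n
    by (auto simp: z_def dom_def norm_mult simp del: of_nat_Suc)
  have ge1: "1 \<le> cmod (1 - z n * of_real x)" for n x
    using abs_Re_le_cmod[of "1 - z n * of_real x"] by (simp add: z_def)
  have inv_le: "cmod (1 / (1 - z n * of_real x)) \<le> 1" for n x
    unfolding norm_divide using frac_le[of 1 1 1, OF _ _ _ ge1[of n x]] by simp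
  have S_le: "cmod (S (z n)) \<le> 1" for n
    unfolding S_def by (rule norm_expectation_le) (use inv_le in simp_all)
  have "(\<lambda>n. S (z n)) \<longlonglongrightarrow> (\<integral>x. indicator {0} x \<partial>\<nu>)"
    unfolding S_def
  proof (rule integral_dominated_convergence[where w = "\<lambda>_. 1"])
    show "AE x in \<nu>. (\<lambda>n. 1 / (1 - z n * of_real x)) \<longlonglongrightarrow> indicator {0} x"
    proof (rule AE_I2)
      fix x
      show "(\<lambda>n. 1 / (1 - z n * of_real x)) \<longlonglongrightarrow> indicator {0} x"
      proof (cases "x = 0")
        case False
        have "(\<lambda>n. 1 / (1 - z n * of_real x)) \<longlonglongrightarrow> 0"
        proof (rule Lim_null_comparison)
          show "\<forall>\<^sub>F n in sequentially. cmod (1 / (1 - z n * of_real x)) \<le> (1 / \<bar>x\<bar>) * (1 / real (Suc n))"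
          proof (rule always_eventually, rule allI)
            fix n
            have "real (Suc n) * \<bar>x\<bar> \<le> cmod (1 - z n * of_real x)"
              using abs_Im_le_cmod[of "1 - z n * of_real x"] by (simp add: z_def abs_mult del: of_nat_Suc)
            then have "1 / cmod (1 - z n * of_real x) \<le> 1 / (real (Suc n) * \<bar>x\<bar>)"
              using False by (intro divide_left_mono) (auto intro!: mult_pos_pos order.strict_trans2[OF _ ge1] simp del: of_nat_Suc)
            then show "cmod (1 / (1 - z n * of_real x)) \<le> (1 / \<bar>x\<bar>) * (1 / real (Suc n))"
              by (simp add: norm_divide mult.commute del: of_nat_Suc)
          qed
          show "(\<lambda>n. (1 / \<bar>x\<bar>) * (1 / real (Suc n))) \<longlonglongrightarrow> 0"
            by (intro tendsto_mult_right_zero LIMSEQ_Suc[OF lim_1_over_n])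
        qed
        then show ?thesis using False by simp
      qed simp
    qed
  qed (use inv_le in simp_all)
  also have "(\<integral>x. indicator {0} x \<partial>\<nu>) = complex_of_real (prob {0})"
    by (rule expectation_indicator_complex)
  finally have lim: "(\<lambda>n. cmod (S (z n)) ^ (m + 1)) \<longlonglongrightarrow> cmod (of_real (prob {0})) ^ (m + 1)"
    by (intro tendsto_intros)
  have "(\<lambda>n. cmod (S (z n)) ^ (m + 1)) \<longlonglongrightarrow> 0"
  proof (rule Lim_null_comparison)
    show "(\<lambda>n. 2 * (1 / real (Suc n))) \<longlonglongrightarrow> 0"
      by (intro tendsto_mult_right_zero LIMSEQ_Suc[OF lim_1_over_n])
    show "\<forall>\<^sub>F n in sequentially. norm (cmod (S (z n)) ^ (m + 1)) \<le> 2 * (1 / real (Suc n))"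
    proof (rule always_eventually, rule allI)
      fix n
      have "z n * S (z n) ^ (m + 1) = S (z n) - 1" using S_eq[OF z(1), of n] by (simp add: algebra_simps)
      then have "real (Suc n) * cmod (S (z n)) ^ (m + 1) = cmod (S (z n) - 1)"
        unfolding z(2)[symmetric] norm_power[symmetric] norm_mult[symmetric] by simp
      also have "\<dots> \<le> 2" using norm_triangle_ineq4[of "S (z n)" 1] S_le[of n] by simp
      finally show "norm (cmod (S (z n)) ^ (m + 1)) \<le> 2 * (1 / real (Suc n))"
        by (simp add: field_simps del: of_nat_Suc power_Suc)
    qed
  qed
  from LIMSEQ_unique[OF lim this] show ?thesis by auto
qed

text \<open>At z = (1 + i e)/t the denominator for x = t is -i e, so -i e S tends to the mass at t
  as e tends to 0. But S stays bounded: if |S| > 1, then S = 1 + z S^(m+1) gives |z| |S|^m \<le>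
  2.\<close>

lemma no_atom_nonzero:
  assumes t: "t \<noteq> 0"
  shows "prob {t} = 0"
proof -
  define e where "e n = 1 / real (Suc n)" for n
  have e: "0 < e n" "e n \<le> 1" for n by (auto simp: e_def)
  have e_lim: "e \<longlonglongrightarrow> 0" unfolding e_def by (rule LIMSEQ_Suc[OF lim_1_over_n])
  define z where "z n = (1 + \<i> * of_real (e n)) / of_real t" for n
  have z_dom: "z n \<in> dom" for n using t e[of n] by (auto simp: z_def dom_def)
  have z_norm: "1 / \<bar>t\<bar> \<le> cmod (z n)" for n
    using abs_Re_le_cmod[of "z n"] t by (simp add: z_def)
  have re: "Re (1 - z n * of_real x) = 1 - x / t" and im: "Im (1 - z n * of_real x) = - e n * (x / t)" for n x
    by (auto simp: z_def)
  have S_le: "cmod (S (z n)) \<le> 1 + 2 * \<bar>t\<bar>" for n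
  proof (cases "cmod (S (z n)) \<le> 1")
    case False
    define s where "s = cmod (S (z n))"
    have s: "s > 1" using False by (simp add: s_def)
    have "z n * S (z n) ^ (m + 1) = S (z n) - 1" using S_eq[OF z_dom, of n] by (simp add: algebra_simps)
    then have "cmod (z n) * s ^ (m + 1) = cmod (S (z n) - 1)"
      unfolding s_def norm_power[symmetric] norm_mult[symmetric] by simp
    also have "\<dots> \<le> s + 1" using norm_triangle_ineq4[of "S (z n)" 1] by (simp add: s_def)
    also have "\<dots> \<le> 2 * s" using s by simp
    finally have "(cmod (z n) * s ^ m) * s \<le> 2 * s" by (simp add: mult_ac)
    then have "cmod (z n) * s ^ m \<le> 2" using s by simp
    \<comment> \<open>Here m \<ge> 1 enters: s > 1 gives s \<le> s^m.\<close>
    moreover have "1 / \<bar>t\<bar> * s ^ 1 \<le> cmod (z n) * s ^ m"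
      using s m z_norm by (intro mult_mono power_increasing) auto
    ultimately have "1 / \<bar>t\<bar> * s \<le> 2" by simp
    then have "s \<le> 2 * \<bar>t\<bar>" using t by (simp add: field_simps)
    then show ?thesis by (simp add: s_def)
  qed simp
  have ratio: "cmod (- \<i> * of_real (e n) / (1 - z n * of_real x)) \<le> 2" for n x
  proof -
    \<comment> \<open>If |x/t| \<ge> 1/2, the imaginary part e |x/t| is large enough; otherwise the
      real part 1 - x/t exceeds 1/2, and e \<le> 1.\<close>
    have "e n / 2 \<le> cmod (1 - z n * of_real x)"
    proof (cases "1 / 2 \<le> \<bar>x / t\<bar>")
      case True
      then have "e n * (1 / 2) \<le> e n * \<bar>x / t\<bar>" using e(1)[of n] by (intro mult_left_mono) auto
      also have "\<dots> = \<bar>Im (1 - z n * of_real x)\<bar>" unfolding im using e(1)[of n] by (simp add: abs_mult)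
      also have "\<dots> \<le> cmod (1 - z n * of_real x)" by (rule abs_Im_le_cmod)
      finally show ?thesis by simp
    next
      case False
      then have "1 / 2 \<le> \<bar>Re (1 - z n * of_real x)\<bar>" unfolding re by linarith
      also have "\<dots> \<le> cmod (1 - z n * of_real x)" by (rule abs_Re_le_cmod)
      finally show ?thesis using e(2)[of n] by linarith
    qed
    moreover have "0 < e n / 2" using e(1)[of n] by simp
    ultimately have "cmod (1 - z n * of_real x) > 0" "e n \<le> 2 * cmod (1 - z n * of_real x)" by linarith+
    then show ?thesis using e(1)[of n] by (simp add: norm_divide norm_mult divide_le_eq)
  qed
  have "(\<lambda>n. \<integral>x. - \<i> * of_real (e n) / (1 - z n * of_real x) \<partial>\<nu>) \<longlonglongrightarrow> (\<integral>x. indicator {t} x \<partial>\<nu>)"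
  proof (rule integral_dominated_convergence[where w = "\<lambda>_. 2"])
    show "AE x in \<nu>. (\<lambda>n. - \<i> * of_real (e n) / (1 - z n * of_real x)) \<longlonglongrightarrow> indicator {t} x"
    proof (rule AE_I2)
      fix x
      show "(\<lambda>n. - \<i> * of_real (e n) / (1 - z n * of_real x)) \<longlonglongrightarrow> indicator {t} x"
      proof (cases "x = t")
        case True
        have "- \<i> * of_real (e n) / (1 - z n * of_real x) = 1" for n
          using t True e(1)[of n] by (simp add: z_def)
        then show ?thesis using True by simp
      next
        case False
        have "(\<lambda>n. - \<i> * of_real (e n) / (1 - z n * of_real x)) \<longlonglongrightarrow>
            - \<i> * of_real 0 / (1 - (1 + \<i> * of_real 0) / of_real t * of_real x)"
          unfolding z_def using t False
          by (intro tendsto_intros e_lim) (auto simp: field_simps)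
        then show ?thesis using False by simp
      qed
    qed
  qed (use ratio in auto)
  also have "(\<lambda>n. \<integral>x. - \<i> * of_real (e n) / (1 - z n * of_real x) \<partial>\<nu>) = (\<lambda>n. - \<i> * of_real (e n) * S (z n))"
  proof
    fix n
    have "(\<integral>x. - \<i> * of_real (e n) / (1 - z n * of_real x) \<partial>\<nu>) = (\<integral>x. - \<i> * of_real (e n) * (1 / (1 - z n * of_real x)) \<partial>\<nu>)"
      by simp
    also have "\<dots> = - \<i> * of_real (e n) * S (z n)"
      unfolding S_def by (rule integral_mult_right_zero)
    finally show "(\<integral>x. - \<i> * of_real (e n) / (1 - z n * of_real x) \<partial>\<nu>) = - \<i> * of_real (e n) * S (z n)" .
  qed
  also have "(\<integral>x. indicator {t} x \<partial>\<nu>) = complex_of_real (prob {t})"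
    by (rule expectation_indicator_complex)
  finally have lim: "(\<lambda>n. - \<i> * of_real (e n) * S (z n)) \<longlonglongrightarrow> complex_of_real (prob {t})" .
  have "(\<lambda>n. - \<i> * of_real (e n) * S (z n)) \<longlonglongrightarrow> 0"
  proof (rule Lim_null_comparison)
    show "(\<lambda>n. (1 + 2 * \<bar>t\<bar>) * e n) \<longlonglongrightarrow> 0" by (rule tendsto_mult_right_zero[OF e_lim])
    show "\<forall>\<^sub>F n in sequentially. cmod (- \<i> * of_real (e n) * S (z n)) \<le> (1 + 2 * \<bar>t\<bar>) * e n"
    proof (rule always_eventually, rule allI)
      fix n
      have "e n * cmod (S (z n)) \<le> e n * (1 + 2 * \<bar>t\<bar>)" using e(1)[of n] S_le by (intro mult_left_mono) auto
      then show "cmod (- \<i> * of_real (e n) * S (z n)) \<le> (1 + 2 * \<bar>t\<bar>) * e n"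
        using e(1)[of n] by (simp add: norm_mult mult.commute)
    qed
  qed
  from LIMSEQ_unique[OF lim this] show ?thesis by simp
qed

lemma no_atom: "prob {t} = 0"
  using no_atom_zero no_atom_nonzero by (cases "t = 0") auto

end

section \<open>Truncation of the entries\<close>

text \<open>Each \<open>f k\<close> is below 1/k from some threshold on. Taking the largest k whose
  threshold has been passed lets k grow with N, but slowly enough to keep that bound.\<close>

lemma diagonal_null_sequence:
  fixes f :: "nat \<Rightarrow> nat \<Rightarrow> real"
  assumes f: "\<And>k. k \<ge> 1 \<Longrightarrow> f k \<longlonglongrightarrow> 0"
  obtains \<kappa> where "filterlim \<kappa> at_top sequentially" "(\<lambda>N. f (\<kappa> N) N) \<longlonglongrightarrow> 0"
proof -
  have "\<exists>n0. \<forall>N\<ge>n0. \<bar>f k N\<bar> < 1 / real k" if "k \<ge> 1" for k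
    using LIMSEQ_D[OF f[OF that], of "1 / real k"] that by simp
  then obtain n0 where n0: "\<And>k N. k \<ge> 1 \<Longrightarrow> N \<ge> n0 k \<Longrightarrow> \<bar>f k N\<bar> < 1 / real k" by metis
  \<comment> \<open>Capping k by N makes the set finite; the inserted 0 keeps \<open>Max\<close>
    defined before any threshold has been passed.\<close>
  define \<kappa> where "\<kappa> N = Max (insert 0 {k. 1 \<le> k \<and> k \<le> N \<and> n0 k \<le> N})" for N
  have fin: "finite (insert 0 {k. 1 \<le> k \<and> k \<le> N \<and> n0 k \<le> N})" for N
    by (rule finite_subset[of _ "{..N}"]) auto
  have ge: "k \<le> \<kappa> N" if "1 \<le> k" "max k (n0 k) \<le> N" for k N
    unfolding \<kappa>_def using that by (intro Max_ge[OF fin]) auto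
  have mem: "\<kappa> N = 0 \<or> (1 \<le> \<kappa> N \<and> n0 (\<kappa> N) \<le> N)" for N
    using Max_in[OF fin[of N]] unfolding \<kappa>_def by auto
  have top: "filterlim \<kappa> at_top sequentially"
    unfolding filterlim_at_top
  proof
    fix Z
    show "\<forall>\<^sub>F N in sequentially. Z \<le> \<kappa> N"
      using eventually_ge_at_top[of "max (Suc Z) (n0 (Suc Z))"]
    proof eventually_elim
      case (elim N)
      then have "Suc Z \<le> \<kappa> N" by (intro ge) auto
      then show ?case by simp
    qed
  qed
  have "(\<lambda>N. f (\<kappa> N) N) \<longlonglongrightarrow> 0"
  proof (rule Lim_null_comparison)
    show "\<forall>\<^sub>F N in sequentially. norm (f (\<kappa> N) N) \<le> 1 / real (\<kappa> N)"
      using top[unfolded filterlim_at_top, rule_format, of 1]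
    proof eventually_elim
      case (elim N)
      then have "n0 (\<kappa> N) \<le> N" using mem[of N] by auto
      then show ?case using n0[OF elim] by (simp add: less_imp_le)
    qed
    show "(\<lambda>N. 1 / real (\<kappa> N)) \<longlonglongrightarrow> 0"
      using filterlim_compose[OF lim_1_over_n top] .
  qed
  with top show ?thesis by (rule that)
qed

text \<open>Large values are discarded, not clamped: the part removed is the value itself on the
  event |\<zeta>| > r, where the Lindeberg condition controls it.\<close>

definition cutoff :: "real \<Rightarrow> complex \<Rightarrow> complex" where
  "cutoff r \<zeta> = (if cmod \<zeta> \<le> r then \<zeta> else 0)"

lemma cutoff_measurable [measurable]: "cutoff r \<in> borel_measurable borel"
  unfolding cutoff_def by measurable

lemma cmod_cutoff_le: "r \<ge> 0 \<Longrightarrow> cmod (cutoff r \<zeta>) \<le> r"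
  by (simp add: cutoff_def)

context prob_space begin

context
  fixes \<xi> :: "'a \<Rightarrow> complex" and B r :: real
  assumes \<xi>_meas [measurable]: "\<xi> \<in> borel_measurable M"
    and mean: "expectation \<xi> = 0"
    and var: "expectation (\<lambda>\<omega>. cmod (\<xi> \<omega>) ^ 2) = 1"
    and int4: "integrable M (\<lambda>\<omega>. cmod (\<xi> \<omega>) ^ 4)"
    and le_B: "expectation (\<lambda>\<omega>. cmod (\<xi> \<omega>) ^ 4) \<le> B"
    and r: "r > 0"
begin

lemma integrable_moments:
  "integrable M \<xi>" "integrable M (\<lambda>\<omega>. cmod (\<xi> \<omega>) ^ 2)"
proof -
  have i: "integrable M (\<lambda>\<omega>. 1 + cmod (\<xi> \<omega>) ^ 4)" using int4 by simp
  have le1: "a \<le> 1 + a ^ 4" and le2: "a ^ 2 \<le> 1 + a ^ 4" if "a \<ge> 0" for a :: real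
  proof -
    show "a \<le> 1 + a ^ 4"
    proof (cases "a \<le> 1")
      case False
      then have "a ^ 1 \<le> a ^ 4" by (intro power_increasing) auto
      then show ?thesis by simp
    qed (use that in \<open>simp add: add_increasing2\<close>)
    show "a ^ 2 \<le> 1 + a ^ 4"
    proof (cases "a \<le> 1")
      case True
      then have "a ^ 2 \<le> 1" using that by (simp add: power_le_one)
      then show ?thesis using that by (simp add: add_increasing2)
    next
      case False
      then have "a ^ 2 \<le> a ^ 4" by (intro power_increasing) auto
      then show ?thesis by simp
    qed
  qed
  show "integrable M \<xi>"
    by (rule Bochner_Integration.integrable_bound[OF i]) (use le1 in \<open>auto intro!: AE_I2\<close>)
  show "integrable M (\<lambda>\<omega>. cmod (\<xi> \<omega>) ^ 2)"
    by (rule Bochner_Integration.integrable_bound[OF i]) (use le2 in \<open>auto intro!: AE_I2\<close>)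
qed

text \<open>On the event |\<xi>| > r each missing power costs a factor r. The case j = 1 serves the
  mean and j = 2 the variance.\<close>

lemma cutoff_power_diff_le:
  assumes "j \<le> 4"
  shows "cmod (\<xi> \<omega>) ^ j * indicator {\<omega>. cmod (\<xi> \<omega>) > r} \<omega> \<le> cmod (\<xi> \<omega>) ^ 4 / r ^ (4 - j)"
proof (cases "cmod (\<xi> \<omega>) > r")
  case True
  have "cmod (\<xi> \<omega>) ^ j * r ^ (4 - j) \<le> cmod (\<xi> \<omega>) ^ j * cmod (\<xi> \<omega>) ^ (4 - j)"
    using True r by (intro mult_left_mono power_mono) auto
  also have "\<dots> = cmod (\<xi> \<omega>) ^ 4" using assms by (simp add: power_add[symmetric])
  finally show ?thesis using True r by (simp add: field_simps)
qed (use r in simp)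

text \<open>As \<xi> is centred, the mean of the kept part is minus that of the discarded
  part.\<close>

lemma expectation_cutoff_le: "cmod (expectation (\<lambda>\<omega>. cutoff r (\<xi> \<omega>))) \<le> B / r ^ 3"
proof -
  have it: "integrable M (\<lambda>\<omega>. cutoff r (\<xi> \<omega>))"
    using r by (intro integrable_const_bound[where B = r]) (auto intro!: AE_I2 cmod_cutoff_le)
  have "expectation (\<lambda>\<omega>. cutoff r (\<xi> \<omega>)) = - expectation (\<lambda>\<omega>. \<xi> \<omega> - cutoff r (\<xi> \<omega>))"
    using it integrable_moments mean by simp
  then have "cmod (expectation (\<lambda>\<omega>. cutoff r (\<xi> \<omega>))) = cmod (expectation (\<lambda>\<omega>. \<xi> \<omega> - cutoff r (\<xi> \<omega>)))"
    by simp
  also have "\<dots> \<le> expectation (\<lambda>\<omega>. cmod (\<xi> \<omega> - cutoff r (\<xi> \<omega>)))" by (rule integral_norm_bound)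
  also have "\<dots> \<le> expectation (\<lambda>\<omega>. cmod (\<xi> \<omega>) ^ 4 / r ^ 3)"
  proof (rule integral_mono)
    show "cmod (\<xi> \<omega> - cutoff r (\<xi> \<omega>)) \<le> cmod (\<xi> \<omega>) ^ 4 / r ^ 3" for \<omega>
      using cutoff_power_diff_le[of 1 \<omega>] r by (auto simp: cutoff_def indicator_def split: if_splits)
  qed (use it integrable_moments int4 in auto)
  also have "\<dots> \<le> B / r ^ 3" using le_B r by (simp add: divide_right_mono)
  finally show ?thesis .
qed

lemma variance_cutoff:
  "expectation (\<lambda>\<omega>. cmod (cutoff r (\<xi> \<omega>)) ^ 2) \<le> 1"
  "\<bar>expectation (\<lambda>\<omega>. cmod (cutoff r (\<xi> \<omega>)) ^ 2) - 1\<bar> \<le> B / r ^ 2"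
proof -
  note int2 = integrable_moments(2)
  have it: "integrable M (\<lambda>\<omega>. cmod (cutoff r (\<xi> \<omega>)) ^ 2)"
    by (rule Bochner_Integration.integrable_bound[OF int2]) (auto simp: cutoff_def intro!: AE_I2)
  have "expectation (\<lambda>\<omega>. cmod (cutoff r (\<xi> \<omega>)) ^ 2) \<le> expectation (\<lambda>\<omega>. cmod (\<xi> \<omega>) ^ 2)"
    by (intro integral_mono it int2) (auto simp: cutoff_def)
  then show le: "expectation (\<lambda>\<omega>. cmod (cutoff r (\<xi> \<omega>)) ^ 2) \<le> 1" by (simp add: var)
  have "1 - expectation (\<lambda>\<omega>. cmod (cutoff r (\<xi> \<omega>)) ^ 2) =
      expectation (\<lambda>\<omega>. cmod (\<xi> \<omega>) ^ 2 - cmod (cutoff r (\<xi> \<omega>)) ^ 2)"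
    using it int2 by (simp add: var)
  also have "\<dots> \<le> expectation (\<lambda>\<omega>. cmod (\<xi> \<omega>) ^ 4 / r ^ 2)"
  proof (rule integral_mono)
    show "cmod (\<xi> \<omega>) ^ 2 - cmod (cutoff r (\<xi> \<omega>)) ^ 2 \<le> cmod (\<xi> \<omega>) ^ 4 / r ^ 2" for \<omega>
      using cutoff_power_diff_le[of 2 \<omega>] r by (auto simp: cutoff_def indicator_def split: if_splits)
  qed (use it int2 int4 in auto)
  also have "\<dots> \<le> B / r ^ 2" using le_B r by (simp add: divide_right_mono)
  finally show "\<bar>expectation (\<lambda>\<omega>. cmod (cutoff r (\<xi> \<omega>)) ^ 2) - 1\<bar> \<le> B / r ^ 2" using le by simp
qed

text \<open>The indicator is kept on the right: at r = \<alpha> sqrt N the plain bound B/r^4, summed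
  over N^2 entries, gives B/\<alpha>^4, which does not tend to zero, whereas the truncated moments
  sum to the Lindeberg quantity.\<close>

lemma prob_gt_le:
  "prob {\<omega> \<in> space M. cmod (\<xi> \<omega>) > r} \<le>
    expectation (\<lambda>\<omega>. cmod (\<xi> \<omega>) ^ 4 * indicator {\<omega>. cmod (\<xi> \<omega>) > r} \<omega>) / r ^ 4"
proof -
  let ?A = "{\<omega> \<in> space M. cmod (\<xi> \<omega>) > r}"
  have eq: "(\<lambda>\<omega>. cmod (\<xi> \<omega>) ^ 4 * indicator {\<omega>. cmod (\<xi> \<omega>) > r} \<omega>) =
      (\<lambda>\<omega>. if r < cmod (\<xi> \<omega>) then cmod (\<xi> \<omega>) ^ 4 else 0)"
    by (auto simp: indicator_def)
  have i: "integrable M (\<lambda>\<omega>. cmod (\<xi> \<omega>) ^ 4 * indicator {\<omega>. cmod (\<xi> \<omega>) > r} \<omega>)"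
    unfolding eq by (rule Bochner_Integration.integrable_bound[OF int4]) auto
  have "prob ?A = expectation (indicator ?A)" by simp
  also have "\<dots> \<le> expectation (\<lambda>\<omega>. cmod (\<xi> \<omega>) ^ 4 * indicator {\<omega>. cmod (\<xi> \<omega>) > r} \<omega> / r ^ 4)"
  proof (rule integral_mono)
    fix \<omega> assume "\<omega> \<in> space M"
    show "indicator ?A \<omega> \<le> cmod (\<xi> \<omega>) ^ 4 * indicator {\<omega>. cmod (\<xi> \<omega>) > r} \<omega> / r ^ 4"
    proof (cases "cmod (\<xi> \<omega>) > r")
      case True
      then have "r ^ 4 \<le> cmod (\<xi> \<omega>) ^ 4" using r by (intro power_mono) auto
      then show ?thesis using True r by (auto simp: indicator_def)
    qed (use r in \<open>auto simp: indicator_def\<close>)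
  next
    show "integrable M (indicator ?A :: 'a \<Rightarrow> real)"
      by (rule integrable_real_indicator) (simp_all add: emeasure_eq_measure)
  qed (use i in auto)
  finally show ?thesis by simp
qed

end

end

section \<open>Spectra of random power covariance matrices\<close>

lemma scaled_matrix_carrier [simp]: "scaled_matrix x N \<omega> \<in> carrier_mat N N"
  by (simp add: scaled_matrix_def)

lemma scaled_matrix_index:
  "i < N \<Longrightarrow> j < N \<Longrightarrow> scaled_matrix x N \<omega> $$ (i, j) = x N i j \<omega> / complex_of_real (sqrt (real N))"
  by (simp add: scaled_matrix_def)

lemma power_covariance_eq:
  "X \<in> carrier_mat N N \<Longrightarrow> power_covariance m X = (X ^\<^sub>m m) * mat_adjoint (X ^\<^sub>m m)"
  by (simp add: power_covariance_def mat_adjoint_pow)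

lemma power_covariance_carrier [simp]:
  assumes "X \<in> carrier_mat N N"
  shows "power_covariance m X \<in> carrier_mat N N"
proof -
  have "X ^\<^sub>m m \<in> carrier_mat N N" "mat_adjoint X ^\<^sub>m m \<in> carrier_mat N N"
    using assms by (auto intro: pow_carrier_mat)
  then show ?thesis unfolding power_covariance_def by simp
qed

definition real_spectrum :: "complex mat \<Rightarrow> real multiset" where
  "real_spectrum A = image_mset Re (eigenvalue_mset A)"

lemma size_real_spectrum: "A \<in> carrier_mat N N \<Longrightarrow> size (real_spectrum A) = N"
  by (simp add: real_spectrum_def eigenvalue_mset_props)

lemma spectral_distribution_eq:
  assumes "A \<in> carrier_mat N N"
  shows "spectral_distribution A t = real (size {# z \<in># real_spectrum A. z \<le> t #}) / real N"
  using assms by (simp add: spectral_distribution_def real_spectrum_def filter_mset_image_mset)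

lemma spectral_distribution_bounds: "A \<in> carrier_mat N N \<Longrightarrow> 0 \<le> spectral_distribution A t \<and> spectral_distribution A t \<le> 1"
  using size_filter_mset_lesseq[of "\<lambda>z. z \<le> t" "real_spectrum A"]
  by (cases "N = 0") (simp_all add: spectral_distribution_eq size_real_spectrum divide_le_eq_1)

lemma sum_real_spectrum:
  assumes X: "X \<in> carrier_mat N N"
  shows "complex_of_real (\<Sum>z\<in>#real_spectrum (power_covariance m X). z ^ p) = mat_trace (power_covariance m X ^\<^sub>m p)"
proof -
  let ?A = "power_covariance m X"
  have "X ^\<^sub>m m \<in> carrier_mat N N" using X by (rule pow_carrier_mat)
  then have "e \<in># eigenvalue_mset ?A \<Longrightarrow> Im e = 0" for e
    unfolding power_covariance_eq[OF X] by (rule eigenvalue_mset_real)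
  then have re: "e \<in># eigenvalue_mset ?A \<Longrightarrow> complex_of_real (Re e) = e" for e
    by (simp add: complex_eq_iff)
  have "complex_of_real (\<Sum>z\<in>#L. z ^ p) = (\<Sum>z\<in>#L. complex_of_real z ^ p)" for L
    by (induction L) auto
  then have "complex_of_real (\<Sum>z\<in>#real_spectrum ?A. z ^ p) = (\<Sum>e\<in>#eigenvalue_mset ?A. complex_of_real (Re e) ^ p)"
    by (simp add: real_spectrum_def image_mset.compositionality comp_def)
  also have "\<dots> = (\<Sum>e\<in>#eigenvalue_mset ?A. e ^ p)"
    by (intro arg_cong[where f = sum_mset] image_mset_cong) (simp add: re)
  also have "\<dots> = mat_trace (?A ^\<^sub>m p)"
    using eigenvalue_mset_props(2)[OF power_covariance_carrier[OF X]] by simp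
  finally show ?thesis .
qed

lemma covariance_word_nonempty: "m \<ge> 1 \<Longrightarrow> p \<ge> 1 \<Longrightarrow> covariance_word m p \<noteq> []"
  using length_covariance_word[of m p] by auto

lemma mat_trace_power_covariance:
  assumes "X \<in> carrier_mat N N" "m \<ge> 1" "p \<ge> 1"
  shows "mat_trace (power_covariance m X ^\<^sub>m p) = (\<Sum>vs\<in>closed_walks N (2 * m * p).
    \<Prod>s\<leftarrow>walk_steps (last vs) (covariance_word m p) vs. step_value (\<lambda>e. X $$ e) s)"
  unfolding power_covariance_pow_eq_word_mat[OF assms(1)]
  using mat_trace_word_mat[OF assms(1) covariance_word_nonempty[OF assms(2,3)]]
  by (simp add: length_covariance_word)

lemma walk_product_measurable:
  assumes meas: "\<And>i j. i < N \<Longrightarrow> j < N \<Longrightarrow> x N i j \<in> borel_measurable M"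
    and vs: "vs \<in> closed_walks N (length w)" and w: "w \<noteq> []"
  shows "(\<lambda>\<omega>. \<Prod>s\<leftarrow>walk_steps (last vs) w vs. step_value (\<lambda>e. scaled_matrix x N \<omega> $$ e) s) \<in> borel_measurable M"
proof (rule prod_list_measurable)
  fix s assume "s \<in> set (walk_steps (last vs) w vs)"
  then have "fst s \<in> {..<N} \<times> {..<N}" using closed_walk_steps_in[OF vs w] by auto
  then obtain i j where ij: "fst s = (i, j)" "i < N" "j < N" by auto
  note [measurable] = meas[OF ij(2,3)]
  have "cnj \<in> borel_measurable borel" by (intro borel_measurable_continuous_onI continuous_intros)
  from measurable_compose[OF meas[OF ij(2,3)] this]
  have [measurable]: "(\<lambda>\<omega>. cnj (x N i j \<omega>)) \<in> borel_measurable M" .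
  show "(\<lambda>\<omega>. step_value (\<lambda>e. scaled_matrix x N \<omega> $$ e) s) \<in> borel_measurable M"
    using ij by (cases "snd s") (auto simp: step_value_def scaled_matrix_index)
qed

lemma real_spectrum_moment_measurable:
  assumes meas: "\<And>i j. i < N \<Longrightarrow> j < N \<Longrightarrow> x N i j \<in> borel_measurable M" and m: "m \<ge> 1"
  shows "(\<lambda>\<omega>. \<Sum>z\<in>#real_spectrum (power_covariance m (scaled_matrix x N \<omega>)). z ^ p) \<in> borel_measurable M"
proof (cases "p = 0")
  case True
  \<comment> \<open>For p = 0 the word is empty and a closed walk has no last vertex; the power sum
    is the constant N.\<close>
  then show ?thesis by (simp add: size_real_spectrum[OF power_covariance_carrier[OF scaled_matrix_carrier]])
next
  case False
  then have p: "p \<ge> 1" by simp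
  have "(\<Sum>z\<in>#real_spectrum (power_covariance m (scaled_matrix x N \<omega>)). z ^ p) =
    Re (\<Sum>vs\<in>closed_walks N (2 * m * p). \<Prod>s\<leftarrow>walk_steps (last vs) (covariance_word m p) vs.
      step_value (\<lambda>e. scaled_matrix x N \<omega> $$ e) s)" for \<omega>
    unfolding mat_trace_power_covariance[OF scaled_matrix_carrier m p, symmetric]
      sum_real_spectrum[OF scaled_matrix_carrier, symmetric] by (simp only: Re_complex_of_real)
  then show ?thesis
    using walk_product_measurable[where w = "covariance_word m p" and x = x and N = N and M = M, OF meas] covariance_word_nonempty[OF m p]
    by (auto simp: length_covariance_word intro!: borel_measurable_sum measurable_compose[OF _ borel_measurable_Re, unfolded comp_def])
qed

lemma spectral_distribution_measurable:
  assumes "\<And>i j. i < N \<Longrightarrow> j < N \<Longrightarrow> x N i j \<in> borel_measurable M" and "m \<ge> 1"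
  shows "(\<lambda>\<omega>. spectral_distribution (power_covariance m (scaled_matrix x N \<omega>)) t) \<in> borel_measurable M"
  unfolding spectral_distribution_eq[OF power_covariance_carrier[OF scaled_matrix_carrier]]
  by (intro borel_measurable_divide size_filter_mset_measurable real_spectrum_moment_measurable assms borel_measurable_const)

definition cutoff_array ::
  "real \<Rightarrow> (nat \<Rightarrow> nat \<Rightarrow> nat \<Rightarrow> 'a \<Rightarrow> complex) \<Rightarrow> nat \<Rightarrow> nat \<Rightarrow> nat \<Rightarrow> 'a \<Rightarrow> complex" where
  "cutoff_array \<alpha> x N i j \<omega> = cutoff (\<alpha> * sqrt (real N)) (x N i j \<omega>)"

text \<open>One matrix size with one cut-off level. Since \<alpha> \<le> 1, cut-off scaled entries
  have modulus at most 1, which makes all walk products bounded and hence integrable.\<close>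

locale entry_array = prob_space M for M :: "'a measure" +
  fixes x :: "nat \<Rightarrow> nat \<Rightarrow> nat \<Rightarrow> 'a \<Rightarrow> complex" and N :: nat and B \<alpha> :: real
  assumes N: "N \<ge> 1"
    and indep: "indep_vars (\<lambda>_. borel) (\<lambda>(i, j). x N i j) ({..<N} \<times> {..<N})"
    and mean: "\<And>i j. i < N \<Longrightarrow> j < N \<Longrightarrow> expectation (x N i j) = 0"
    and var: "\<And>i j. i < N \<Longrightarrow> j < N \<Longrightarrow> expectation (\<lambda>\<omega>. cmod (x N i j \<omega>) ^ 2) = 1"
    and int4: "\<And>i j. i < N \<Longrightarrow> j < N \<Longrightarrow> integrable M (\<lambda>\<omega>. cmod (x N i j \<omega>) ^ 4)"
    and le_B: "\<And>i j. i < N \<Longrightarrow> j < N \<Longrightarrow> expectation (\<lambda>\<omega>. cmod (x N i j \<omega>) ^ 4) \<le> B"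
    and \<alpha>: "0 < \<alpha>" "\<alpha> \<le> 1"
begin

definition y :: "nat \<Rightarrow> nat \<Rightarrow> nat \<Rightarrow> 'a \<Rightarrow> complex" where
  "y = cutoff_array \<alpha> x"

lemma cutoff_pos: "\<alpha> * sqrt (real N) > 0"
  using \<alpha> N by simp

lemma x_meas: "i < N \<Longrightarrow> j < N \<Longrightarrow> x N i j \<in> borel_measurable M"
  using indep unfolding indep_vars_def by force

lemma y_meas: "i < N \<Longrightarrow> j < N \<Longrightarrow> y N i j \<in> borel_measurable M"
  using measurable_compose[OF x_meas cutoff_measurable] by (simp add: y_def cutoff_array_def[abs_def])

lemma cmod_entry_le: "i < N \<Longrightarrow> j < N \<Longrightarrow> cmod (scaled_matrix y N \<omega> $$ (i, j)) \<le> \<alpha>"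
  using cmod_cutoff_le[of "\<alpha> * sqrt (real N)" "x N i j \<omega>"] cutoff_pos N
  by (simp add: scaled_matrix_index y_def cutoff_array_def norm_divide divide_le_eq)

lemma cmod_walk_product_le:
  assumes "vs \<in> closed_walks N (length w)" "w \<noteq> []"
  shows "cmod (\<Prod>s\<leftarrow>walk_steps (last vs) w vs. step_value (\<lambda>e. scaled_matrix y N \<omega> $$ e) s) \<le> 1"
proof -
  have "cmod (\<Prod>s\<leftarrow>xs. step_value (\<lambda>e. scaled_matrix y N \<omega> $$ e) s) \<le> 1"
    if "fst ` set xs \<subseteq> {..<N} \<times> {..<N}" for xs
    using that
  proof (induction xs)
    case (Cons s xs)
    then obtain i j where ij: "fst s = (i, j)" "i < N" "j < N" by auto
    have "cmod (step_value (\<lambda>e. scaled_matrix y N \<omega> $$ e) s) \<le> 1"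
      using order_trans[OF cmod_entry_le[OF ij(2,3)] \<alpha>(2)] ij(1) by (simp add: step_value_def)
    then show ?case using Cons by (auto simp: norm_mult intro: mult_le_one)
  qed simp
  then show ?thesis using closed_walk_steps_in[OF assms] by blast
qed

text \<open>A crude bound depending on N, made only for averaging the empirical laws. The square of
  an eigenvalue is at most the trace of the squared matrix, a sum of walk products of modulus at
  most 1; adding 1 turns a bound on the square into one on the modulus.\<close>

lemma spectrum_bound:
  assumes m: "m \<ge> 1" and z: "z \<in># real_spectrum (power_covariance m (scaled_matrix y N \<omega>))"
  shows "\<bar>z\<bar> \<le> real (card (closed_walks N (2 * m * 2))) + 1"
proof -
  let ?\<Lambda> = "real_spectrum (power_covariance m (scaled_matrix y N \<omega>))"
  let ?c = "real (card (closed_walks N (2 * m * 2)))"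
  have "z ^ 2 \<le> (\<Sum>z\<in>#L. z ^ 2)" if "z \<in># L" for L :: "real multiset"
    using that
  proof (induction L)
    case (add u L)
    have "0 \<le> (\<Sum>z\<in>#L. z ^ 2)" by (induction L) auto
    with add show ?case by (auto intro: add_increasing)
  qed simp
  with z have "z ^ 2 \<le> (\<Sum>z\<in>#?\<Lambda>. z ^ 2)" by blast
  also have "\<dots> \<le> cmod (of_real (\<Sum>z\<in>#?\<Lambda>. z ^ 2))" unfolding norm_of_real by simp
  also have "\<dots> \<le> (\<Sum>vs\<in>closed_walks N (2 * m * 2). 1)"
    unfolding sum_real_spectrum[OF scaled_matrix_carrier] mat_trace_power_covariance[OF scaled_matrix_carrier m one_le_numeral]
    using cmod_walk_product_le[of _ "covariance_word m 2"] covariance_word_nonempty[OF m, of 2]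
    by (intro sum_norm_le) (auto simp: length_covariance_word)
  finally have "z ^ 2 \<le> ?c" by simp
  show ?thesis
  proof (rule ccontr)
    assume "\<not> ?thesis"
    then have gt: "\<bar>z\<bar> > ?c + 1" by simp
    then have "\<bar>z\<bar> * 1 \<le> \<bar>z\<bar> * \<bar>z\<bar>" by (intro mult_left_mono) auto
    then show False using gt \<open>z ^ 2 \<le> ?c\<close> by (simp add: power2_eq_square)
  qed
qed

text \<open>\<open>\<beta>\<close> must dominate the entry bound \<open>\<alpha>\<close> and the
  mean: cutting at r = \<alpha> sqrt N leaves a mean of at most B/r^3, which scaling turns into
  B/(\<alpha>^3 N) times 1/N. Likewise the second moment misses 1/N by at most the fraction
  B/(\<alpha>^2 N), the \<open>\<eta>\<close> of the trace estimate.\<close>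

lemma spectral_moment_estimate:
  assumes m: "m \<ge> 1" and p: "p \<ge> 1"
    and \<beta>: "\<alpha> \<le> \<beta>" "\<beta> \<le> 1" "B / (\<alpha> ^ 3 * real N) \<le> \<beta>"
  shows "\<bar>expectation (\<lambda>\<omega>. (\<Sum>z\<in>#real_spectrum (power_covariance m (scaled_matrix y N \<omega>)). z ^ p) / real N) -
      real (raney m p 1) * (\<Prod>i<m * p. real (N - 1 - i) / real N)\<bar>
    \<le> fact (2 * m * p) * (\<beta> + 1 / real N) + real (2 * m * p) * (B / (\<alpha> ^ 2 * real N)) * real (raney m p 1)"
proof -
  let ?I = "{..<N} \<times> {..<N}"
  let ?w = "covariance_word m p"
  let ?r = "\<alpha> * sqrt (real N)"
  have w: "?w \<noteq> []" by (rule covariance_word_nonempty[OF m p])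
  define z where "z e \<omega> = scaled_matrix y N \<omega> $$ e" for e \<omega>
  let ?pr = "\<lambda>vs \<omega>. \<Prod>s\<leftarrow>walk_steps (last vs) ?w vs. step_value (\<lambda>e. z e \<omega>) s"
  have z_eq: "z (i, j) = (\<lambda>\<omega>. cutoff ?r (x N i j \<omega>) / of_real (sqrt (real N)))" if "i < N" "j < N" for i j
    using that by (simp add: z_def scaled_matrix_index y_def cutoff_array_def fun_eq_iff)
  note fourth = x_meas mean var int4 le_B cutoff_pos
  have B: "B \<ge> 0"
  proof -
    have "0 \<le> expectation (\<lambda>\<omega>. cmod (x N 0 0 \<omega>) ^ 4)" by (rule Bochner_Integration.integral_nonneg) simp
    also have "\<dots> \<le> B" using N by (intro le_B) auto
    finally show ?thesis .
  qed
  have sqN: "sqrt (real N) ^ 2 = real N" by simp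
  have est: "cmod ((\<Sum>vs\<in>closed_walks N (length ?w).
        expectation (\<lambda>\<omega>. ?pr vs \<omega>)) / of_nat N -
      of_real (real (pairings [] ?w) * (\<Prod>i<length ?w div 2. real (N - 1 - i) / real N)))
    \<le> fact (length ?w) * (\<beta> + 1 / real N) + real (length ?w) * (B / (\<alpha> ^ 2 * real N)) * real (pairings [] ?w)"
  proof (rule trace_moment_estimate[OF N w])
    have "indep_vars (\<lambda>_. borel) (\<lambda>e \<omega>. cutoff ?r ((case e of (i, j) \<Rightarrow> x N i j) \<omega>) / of_real (sqrt (real N))) ?I"
      by (rule indep_vars_compose2[OF indep]) measurable
    also have "?this \<longleftrightarrow> indep_vars (\<lambda>_. borel) z ?I"
      by (rule indep_vars_cong) (auto simp: z_eq)
    finally show "indep_vars (\<lambda>_. borel) z ?I" .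
    show "cmod (z e \<omega>) \<le> \<beta>" if "e \<in> ?I" for e \<omega>
      using that order_trans[OF cmod_entry_le \<beta>(1)] by (auto simp: z_def)
    show "0 \<le> \<beta>" "\<beta> \<le> 1" using \<alpha> \<beta> by auto
    show "0 \<le> B / (\<alpha> ^ 2 * real N)" using B \<alpha> by simp
    fix e assume "e \<in> ?I"
    then obtain i j where e: "e = (i, j)" and ij: "i < N" "j < N" by auto
    note four = fourth(1-5)[OF ij] cutoff_pos
    have "cmod (expectation (z e)) = cmod (expectation (\<lambda>\<omega>. cutoff ?r (x N i j \<omega>))) / sqrt (real N)"
      unfolding e z_eq[OF ij] by (simp add: norm_divide)
    also have "\<dots> \<le> B / ?r ^ 3 / sqrt (real N)"
      by (intro divide_right_mono expectation_cutoff_le[OF four]) simp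
    also have "\<dots> = B / (\<alpha> ^ 3 * real N) / real N"
    proof -
      have "?r ^ 3 * sqrt (real N) = \<alpha> ^ 3 * (sqrt (real N) ^ 2 * sqrt (real N) ^ 2)"
        by (simp add: power_mult_distrib power2_eq_square power3_eq_cube mult_ac del: real_sqrt_mult_self real_sqrt_pow2)
      then show ?thesis unfolding sqN by (simp add: mult.assoc)
    qed
    also have "\<dots> \<le> \<beta> / real N" by (intro divide_right_mono \<beta>) simp
    finally show "cmod (expectation (z e)) \<le> \<beta> / real N" .
    have v: "expectation (\<lambda>\<omega>. cmod (z e \<omega>) ^ 2) = expectation (\<lambda>\<omega>. cmod (cutoff ?r (x N i j \<omega>)) ^ 2) / real N"
      unfolding e z_eq[OF ij] by (simp add: norm_divide power_divide)
    show "expectation (\<lambda>\<omega>. cmod (z e \<omega>) ^ 2) \<le> 1 / real N"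
      unfolding v by (intro divide_right_mono variance_cutoff(1)[OF four]) simp
    have "\<bar>expectation (\<lambda>\<omega>. cmod (z e \<omega>) ^ 2) - 1 / real N\<bar> =
        \<bar>expectation (\<lambda>\<omega>. cmod (cutoff ?r (x N i j \<omega>)) ^ 2) - 1\<bar> / real N"
      unfolding v diff_divide_distrib[symmetric] by simp
    also have "\<dots> \<le> B / ?r ^ 2 / real N"
      by (intro divide_right_mono variance_cutoff(2)[OF four]) simp
    also have "?r ^ 2 = \<alpha> ^ 2 * real N" by (simp add: power_mult_distrib)
    finally show "\<bar>expectation (\<lambda>\<omega>. cmod (z e \<omega>) ^ 2) - 1 / real N\<bar> \<le> B / (\<alpha> ^ 2 * real N) / real N" .
  qed
  have eq: "(\<Sum>vs\<in>closed_walks N (length ?w).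
        expectation (\<lambda>\<omega>. ?pr vs \<omega>)) / of_nat N =
      of_real (expectation (\<lambda>\<omega>. (\<Sum>z\<in>#real_spectrum (power_covariance m (scaled_matrix y N \<omega>)). z ^ p) / real N))"
  proof -
    have int: "integrable M (\<lambda>\<omega>. ?pr vs \<omega>)"
      if "vs \<in> closed_walks N (length ?w)" for vs
    proof (rule integrable_const_bound[where B = 1])
      show "AE \<omega> in M. cmod (?pr vs \<omega>) \<le> 1"
        unfolding z_def by (intro AE_I2 cmod_walk_product_le that w)
      show "(\<lambda>\<omega>. ?pr vs \<omega>) \<in> borel_measurable M"
        unfolding z_def by (rule walk_product_measurable[where x = y and N = N and M = M, OF y_meas that w])
    qed
    have "(\<Sum>vs\<in>closed_walks N (length ?w).
        expectation (\<lambda>\<omega>. ?pr vs \<omega>)) / of_nat N =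
      expectation (\<lambda>\<omega>. (\<Sum>vs\<in>closed_walks N (length ?w). ?pr vs \<omega>) / of_nat N)"
      using int by (simp add: Bochner_Integration.integral_sum)
    also have "\<dots> = expectation (\<lambda>\<omega>. complex_of_real
        ((\<Sum>z\<in>#real_spectrum (power_covariance m (scaled_matrix y N \<omega>)). z ^ p) / real N))"
      unfolding of_real_divide sum_real_spectrum[OF scaled_matrix_carrier]
        mat_trace_power_covariance[OF scaled_matrix_carrier m p] z_def length_covariance_word of_real_of_nat_eq ..
    finally show ?thesis by (simp only: integral_complex_of_real)
  qed
  have half: "2 * m * p div 2 = m * p" by simp
  show ?thesis
    using est unfolding eq unfolding of_real_diff[symmetric] norm_of_real pairings_covariance_word[OF m]
      length_covariance_word half .
qed

text \<open>The two spectral distributions agree unless some entry exceeds the level, and never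
  differ by more than 1. The union bound with Markov's inequality produces the Lindeberg sum, r^4 =
  N^2 \<alpha>^4 supplying its factor N^(-2).\<close>

lemma spectral_cutoff_difference:
  assumes m: "m \<ge> 1"
  shows "\<bar>expectation (\<lambda>\<omega>. spectral_distribution (power_covariance m (scaled_matrix x N \<omega>)) t) -
      expectation (\<lambda>\<omega>. spectral_distribution (power_covariance m (scaled_matrix y N \<omega>)) t)\<bar>
    \<le> (\<Sum>i<N. \<Sum>j<N. expectation (\<lambda>\<omega>. cmod (x N i j \<omega>) ^ 4 *
        indicator {\<omega>. cmod (x N i j \<omega>) > \<alpha> * sqrt (real N)} \<omega>)) / real N ^ 2 / \<alpha> ^ 4"
proof -
  let ?r = "\<alpha> * sqrt (real N)"
  define F where "F x' \<omega> = spectral_distribution (power_covariance m (scaled_matrix x' N \<omega>)) t"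
    for x' :: "nat \<Rightarrow> nat \<Rightarrow> nat \<Rightarrow> 'a \<Rightarrow> complex" and \<omega>
  define A where "A e = {\<omega> \<in> space M. cmod (x N (fst e) (snd e) \<omega>) > ?r}" for e
  let ?I = "{..<N} \<times> {..<N}"
  have A: "A e \<in> events" if "e \<in> ?I" for e
  proof -
    have [measurable]: "x N (fst e) (snd e) \<in> borel_measurable M" using that by (intro x_meas) auto
    show ?thesis unfolding A_def by measurable
  qed
  have UA: "(\<Union>e\<in>?I. A e) \<in> events" using A by (intro sets.finite_UN) auto
  have F01: "0 \<le> F x' \<omega> \<and> F x' \<omega> \<le> 1" for x' \<omega>
    unfolding F_def by (rule spectral_distribution_bounds[OF power_covariance_carrier[OF scaled_matrix_carrier]])
  have F_int: "integrable M (F x')" if "\<And>i j. i < N \<Longrightarrow> j < N \<Longrightarrow> x' N i j \<in> borel_measurable M" for x'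
  proof (rule integrable_const_bound[where B = 1])
    show "F x' \<in> borel_measurable M" unfolding F_def by (rule spectral_distribution_measurable[where x = x' and N = N and M = M, OF that m])
    show "AE \<omega> in M. norm (F x' \<omega>) \<le> 1" using F01 by (intro AE_I2) auto
  qed
  have le: "\<bar>F x \<omega> - F y \<omega>\<bar> \<le> indicator (\<Union>e\<in>?I. A e) \<omega>" if \<omega>: "\<omega> \<in> space M" for \<omega>
  proof (cases "\<omega> \<in> (\<Union>e\<in>?I. A e)")
    case True
    have "\<bar>F x \<omega> - F y \<omega>\<bar> \<le> 1" using F01[of x \<omega>] F01[of y \<omega>] by linarith
    then show ?thesis using True by simp
  next
    case False
    then have "cmod (x N i j \<omega>) \<le> ?r" if "i < N" "j < N" for i j
      using that \<omega> by (force simp: A_def)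
    then have "scaled_matrix x N \<omega> = scaled_matrix y N \<omega>"
      by (intro eq_matI) (auto simp: scaled_matrix_def y_def cutoff_array_def cutoff_def)
    then show ?thesis by (simp add: F_def)
  qed
  have "\<bar>expectation (F x) - expectation (F y)\<bar> = \<bar>expectation (\<lambda>\<omega>. F x \<omega> - F y \<omega>)\<bar>"
    using F_int[of x, OF x_meas] F_int[of y, OF y_meas] by simp
  also have "\<dots> \<le> expectation (\<lambda>\<omega>. \<bar>F x \<omega> - F y \<omega>\<bar>)" by (rule integral_abs_bound)
  also have "\<dots> \<le> expectation (indicator (\<Union>e\<in>?I. A e))"
  proof (rule integral_mono)
    show "integrable M (\<lambda>\<omega>. \<bar>F x \<omega> - F y \<omega>\<bar>)" using F_int[of x, OF x_meas] F_int[of y, OF y_meas] by simp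
    show "integrable M (indicator (\<Union>e\<in>?I. A e) :: 'a \<Rightarrow> real)"
      using UA by (intro integrable_real_indicator) (simp_all add: emeasure_eq_measure)
  qed (rule le)
  also have "\<dots> = prob (\<Union>e\<in>?I. A e)" using UA by simp
  also have "\<dots> \<le> (\<Sum>e\<in>?I. prob (A e))" by (rule finite_measure_subadditive_finite) (use A in auto)
  also have "\<dots> \<le> (\<Sum>e\<in>?I. expectation (\<lambda>\<omega>. cmod (x N (fst e) (snd e) \<omega>) ^ 4 *
      indicator {\<omega>. cmod (x N (fst e) (snd e) \<omega>) > ?r} \<omega>) / ?r ^ 4)"
    unfolding A_def by (intro sum_mono prob_gt_le[OF x_meas mean var int4 le_B cutoff_pos]) auto
  also have "\<dots> = (\<Sum>i<N. \<Sum>j<N. expectation (\<lambda>\<omega>. cmod (x N i j \<omega>) ^ 4 *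
        indicator {\<omega>. cmod (x N i j \<omega>) > ?r} \<omega>)) / ?r ^ 4"
    by (simp add: sum.cartesian_product split_def sum_divide_distrib)
  also have "?r ^ 4 = real N ^ 2 * \<alpha> ^ 4"
  proof -
    have "sqrt (real N) ^ 4 = (sqrt (real N) ^ 2) ^ 2" by (simp only: power_mult[symmetric]) simp
    also have "\<dots> = real N ^ 2" by simp
    finally show ?thesis by (simp add: power_mult_distrib mult.commute)
  qed
  finally show ?thesis unfolding F_def by simp
qed

lemma mean_spectral_measure:
  assumes m: "m \<ge> 1"
  obtains \<mu> where "real_distribution \<mu>"
    "\<And>t. cdf \<mu> t = expectation (\<lambda>\<omega>. spectral_distribution (power_covariance m (scaled_matrix y N \<omega>)) t)"
    "\<And>p. integrable \<mu> (\<lambda>u. u ^ p)"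
    "\<And>p. (\<integral>u. u ^ p \<partial>\<mu>) =
      expectation (\<lambda>\<omega>. (\<Sum>z\<in>#real_spectrum (power_covariance m (scaled_matrix y N \<omega>)). z ^ p) / real N)"
proof -
  let ?\<Lambda> = "\<lambda>\<omega>. real_spectrum (power_covariance m (scaled_matrix y N \<omega>))"
  have size: "size (?\<Lambda> \<omega>) = N" for \<omega>
    by (rule size_real_spectrum[OF power_covariance_carrier[OF scaled_matrix_carrier]])
  have meas: "(\<lambda>\<omega>. \<Sum>z\<in>#?\<Lambda> \<omega>. z ^ p) \<in> borel_measurable M" for p
    by (rule real_spectrum_moment_measurable[where x = y and N = N and M = M, OF y_meas m])
  have N0: "0 < N" using N by simp
  show ?thesis
    by (rule mean_empirical_distribution[of N ?\<Lambda>, OF N0 size meas spectrum_bound[OF m]])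
      (auto simp: spectral_distribution_eq[OF power_covariance_carrier[OF scaled_matrix_carrier]] intro: that)
qed

end


section \<open>Passage to the limit in N\<close>

theorem theorem1p1:
  fixes m :: nat
    and M :: "nat \<Rightarrow> 'a measure"
    and x :: "nat \<Rightarrow> nat \<Rightarrow> nat \<Rightarrow> 'a \<Rightarrow> complex"
    and B :: real
  assumes "m \<ge> 1"
    and "\<And>N. N \<ge> 1 \<Longrightarrow> prob_space (M N)"
    and "\<And>N. N \<ge> 1 \<Longrightarrow>
           prob_space.indep_vars (M N) (\<lambda>_. borel) (\<lambda>(i, j). x N i j) ({..<N} \<times> {..<N})"
    and "\<And>N i j. i < N \<Longrightarrow> j < N \<Longrightarrow> (\<integral>\<omega>. x N i j \<omega> \<partial>M N) = 0"
    and "\<And>N i j. i < N \<Longrightarrow> j < N \<Longrightarrow> (\<integral>\<omega>. cmod (x N i j \<omega>) ^ 2 \<partial>M N) = 1"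
    and "\<And>N i j. i < N \<Longrightarrow> j < N \<Longrightarrow> integrable (M N) (\<lambda>\<omega>. cmod (x N i j \<omega>) ^ 4)"
    and "\<And>N i j. i < N \<Longrightarrow> j < N \<Longrightarrow> (\<integral>\<omega>. cmod (x N i j \<omega>) ^ 4 \<partial>M N) \<le> B"
    and "\<And>\<alpha>. \<alpha> > 0 \<Longrightarrow> (\<lambda>N. lindeberg4 M x N \<alpha>) \<longlonglongrightarrow> 0"
  shows "\<exists>G :: real \<Rightarrow> real.
           (\<forall>t. (\<lambda>N. \<integral>\<omega>. spectral_distribution
                      (power_covariance m (scaled_matrix x N \<omega>)) t \<partial>M N) \<longlonglongrightarrow> G t) \<and>
           (\<exists>\<mu>. real_distribution \<mu> \<and> G = cdf \<mu> \<and>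
              (\<forall>p::nat. integrable \<mu> (\<lambda>t. t ^ p) \<and>
                 (\<integral>t. t ^ p \<partial>\<mu>) = 1 / real (m * p + 1) * real ((p * m + p) choose p)))"
proof -
  note m = assms(1)
  have B: "B \<ge> 0"
  proof -
    have "0 \<le> (\<integral>\<omega>. cmod (x 1 0 0 \<omega>) ^ 4 \<partial>M 1)" by (rule Bochner_Integration.integral_nonneg) simp
    also have "\<dots> \<le> B" by (intro assms(7)) auto
    finally show ?thesis .
  qed
  \<comment> \<open>The bounds that must vanish at cut-off level 1/k: probability of a change, error
    of the mean, error of the variance. Being non-negative they can be added, so that one diagonal
    sequence serves all three.\<close>
  define f where "f k N = real k ^ 4 * lindeberg4 M x N (1 / real k) + (B * real k ^ 3) * (1 / real N)
      + (B * real k ^ 2) * (1 / real N)" for k N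
  have f_lim: "f k \<longlonglongrightarrow> 0" if "k \<ge> 1" for k
    unfolding f_def using that
    by (intro tendsto_add_zero tendsto_mult_right_zero lim_1_over_n assms(8)) simp
  obtain \<kappa> where \<kappa>: "filterlim \<kappa> at_top sequentially" and f_\<kappa>: "(\<lambda>N. f (\<kappa> N) N) \<longlonglongrightarrow> 0"
    using diagonal_null_sequence[of f, OF f_lim] by blast
  define \<alpha> where "\<alpha> N = 1 / real (\<kappa> N)" for N
  have \<alpha>_lim: "\<alpha> \<longlonglongrightarrow> 0" unfolding \<alpha>_def by (rule filterlim_compose[OF lim_1_over_n \<kappa>])
  have L_nonneg: "lindeberg4 M x N a \<ge> 0" for N a
    unfolding lindeberg4_def by (intro divide_nonneg_nonneg sum_nonneg Bochner_Integration.integral_nonneg) auto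
  have parts: "0 \<le> real k ^ 4 * lindeberg4 M x N (1 / real k)" "0 \<le> (B * real k ^ 3) * (1 / real N)"
    "0 \<le> (B * real k ^ 2) * (1 / real N)" for k N
    using L_nonneg B by auto
  have L_lim: "(\<lambda>N. real (\<kappa> N) ^ 4 * lindeberg4 M x N (\<alpha> N)) \<longlonglongrightarrow> 0"
  proof (intro Lim_null_comparison[OF _ f_\<kappa>] always_eventually allI)
    show "norm (real (\<kappa> N) ^ 4 * lindeberg4 M x N (\<alpha> N)) \<le> f (\<kappa> N) N" for N
      using parts[of "\<kappa> N" N] unfolding f_def \<alpha>_def real_norm_def by linarith
  qed
  have b3_lim: "(\<lambda>N. (B * real (\<kappa> N) ^ 3) * (1 / real N)) \<longlonglongrightarrow> 0"
  proof (intro Lim_null_comparison[OF _ f_\<kappa>] always_eventually allI)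
    show "norm ((B * real (\<kappa> N) ^ 3) * (1 / real N)) \<le> f (\<kappa> N) N" for N
      using parts[of "\<kappa> N" N] unfolding f_def real_norm_def by linarith
  qed
  have b2_lim: "(\<lambda>N. (B * real (\<kappa> N) ^ 2) * (1 / real N)) \<longlonglongrightarrow> 0"
  proof (intro Lim_null_comparison[OF _ f_\<kappa>] always_eventually allI)
    show "norm ((B * real (\<kappa> N) ^ 2) * (1 / real N)) \<le> f (\<kappa> N) N" for N
      using parts[of "\<kappa> N" N] unfolding f_def real_norm_def by linarith
  qed
  define \<beta> where "\<beta> N = \<alpha> N + (B * real (\<kappa> N) ^ 3) * (1 / real N)" for N
  have \<beta>_lim: "\<beta> \<longlonglongrightarrow> 0" unfolding \<beta>_def by (intro tendsto_add_zero \<alpha>_lim b3_lim)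
  \<comment> \<open>\<kappa> \<ge> 1 gives 0 < \<alpha> \<le> 1, whereas \<kappa> = 0 would make
    \<alpha> = 1/0 = 0; the bound on \<beta> is a premise of the moment estimate.\<close>
  have "\<forall>\<^sub>F N in sequentially. N \<ge> 1 \<and> \<kappa> N \<ge> 1 \<and> \<beta> N < 1"
    using eventually_ge_at_top[of 1] \<kappa>[unfolded filterlim_at_top, rule_format, of 1] order_tendstoD(2)[OF \<beta>_lim, of 1]
    by (simp add: eventually_conj_iff)
  then obtain N0 where N0: "\<And>N. N \<ge> N0 \<Longrightarrow> N \<ge> 1 \<and> \<kappa> N \<ge> 1 \<and> \<beta> N < 1"
    unfolding eventually_sequentially by blast
  have arr: "entry_array (M N) x N B (\<alpha> N)" if "N \<ge> N0" for N
    unfolding entry_array_def entry_array_axioms_def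
    using N0[OF that] assms(2-7) by (auto simp: \<alpha>_def)
  define F where "F x' N t = (\<integral>\<omega>. spectral_distribution (power_covariance m (scaled_matrix x' N \<omega>)) t \<partial>M N)"
    for x' N t
  define c where "c N p = (\<integral>\<omega>. (\<Sum>z\<in>#real_spectrum (power_covariance m
      (scaled_matrix (cutoff_array (\<alpha> N) x) N \<omega>)). z ^ p) / real N \<partial>M N)" for N p
  have "\<exists>\<mu>. real_distribution \<mu> \<and> (\<forall>t. cdf \<mu> t = F (cutoff_array (\<alpha> N) x) N t) \<and>
      (\<forall>p. integrable \<mu> (\<lambda>u. u ^ p)) \<and> (\<forall>p. (\<integral>u. u ^ p \<partial>\<mu>) = c N p)" if "N \<ge> N0" for N
  proof -
    interpret entry_array "M N" x N B "\<alpha> N" by (rule arr[OF that])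
    show ?thesis
      by (rule mean_spectral_measure[OF m]) (unfold F_def c_def y_def, blast)
  qed
  then obtain \<mu> where \<mu>: "\<And>N. N \<ge> N0 \<Longrightarrow> real_distribution (\<mu> N)"
    "\<And>N t. N \<ge> N0 \<Longrightarrow> cdf (\<mu> N) t = F (cutoff_array (\<alpha> N) x) N t"
    "\<And>N p. N \<ge> N0 \<Longrightarrow> integrable (\<mu> N) (\<lambda>u. u ^ p)"
    "\<And>N p. N \<ge> N0 \<Longrightarrow> (\<integral>u. u ^ p \<partial>\<mu> N) = c N p"
    by metis
  have c_lim: "(\<lambda>N. c N p) \<longlonglongrightarrow> real (raney m p 1)" for p
  proof (cases "p = 0")
    case True
    have "c N 0 = 1" if "N \<ge> N0" for N
      unfolding \<mu>(4)[OF that, symmetric]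
      using prob_space.prob_space[OF real_distribution.axioms(1)[OF \<mu>(1)[OF that]]] by simp
    then have "\<forall>\<^sub>F N in sequentially. c N 0 = 1" using eventually_ge_at_top[of N0] by (rule eventually_mono[rotated])
    then show ?thesis using True by (simp add: tendsto_eventually)
  next
    case False
    then have p: "p \<ge> 1" by simp
    let ?T = "\<lambda>N. real (raney m p 1) * (\<Prod>i<m * p. real (N - 1 - i) / real N)"
    let ?b = "\<lambda>N. fact (2 * m * p) * (\<beta> N + 1 / real N) +
      real (2 * m * p) * ((B * real (\<kappa> N) ^ 2) * (1 / real N)) * real (raney m p 1)"
    have "(\<lambda>N. c N p - ?T N) \<longlonglongrightarrow> 0"
    proof (rule Lim_null_comparison)
      show "\<forall>\<^sub>F N in sequentially. norm (c N p - ?T N) \<le> ?b N"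
        using eventually_ge_at_top[of N0]
      proof eventually_elim
        case (elim N)
        interpret entry_array "M N" x N B "\<alpha> N" by (rule arr[OF elim])
        have k: "\<kappa> N \<ge> 1" using N0[OF elim] by simp
        have "\<bar>c N p - ?T N\<bar> \<le> fact (2 * m * p) * (\<beta> N + 1 / real N) +
            real (2 * m * p) * (B / (\<alpha> N ^ 2 * real N)) * real (raney m p 1)"
          unfolding c_def y_def[symmetric]
        proof (rule spectral_moment_estimate[OF m p])
          show "\<alpha> N \<le> \<beta> N" using parts(2) by (simp add: \<beta>_def)
          show "\<beta> N \<le> 1" using N0[OF elim] by simp
          show "B / (\<alpha> N ^ 3 * real N) \<le> \<beta> N" using k by (simp add: \<beta>_def \<alpha>_def power_divide)
        qed
        also have "B / (\<alpha> N ^ 2 * real N) = (B * real (\<kappa> N) ^ 2) * (1 / real N)"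
          using k by (simp add: \<alpha>_def power_divide)
        finally show ?case by simp
      qed
      have "(\<lambda>N. ?b N)
        \<longlonglongrightarrow> fact (2 * m * p) * (0 + 0) + real (2 * m * p) * 0 * real (raney m p 1)"
        by (intro tendsto_intros \<beta>_lim b2_lim lim_1_over_n)
      then show "(\<lambda>N. ?b N) \<longlonglongrightarrow> 0" by simp
    qed
    moreover have "?T \<longlonglongrightarrow> real (raney m p 1) * 1"
      by (intro tendsto_intros falling_ratio_tendsto)
    ultimately show ?thesis using tendsto_add[of "\<lambda>N. c N p - ?T N" 0 sequentially ?T] by simp
  qed
  \<comment> \<open>Shifted by N0, since below it \<open>\<mu>\<close> is an arbitrary
    choice.\<close>
  interpret converging_moments "\<lambda>n. \<mu> (n + N0)" "\<lambda>p. real (raney m p 1)" "2 ^ (m + 1)"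
  proof (rule converging_moments.intro)
    show "real_distribution (\<mu> (n + N0))" for n by (rule \<mu>) simp
    show "integrable (\<mu> (n + N0)) (\<lambda>x. x ^ p)" for n p by (rule \<mu>) simp
    show "(\<lambda>n. \<integral>x. x ^ p \<partial>\<mu> (n + N0)) \<longlonglongrightarrow> real (raney m p 1)" for p
      using LIMSEQ_ignore_initial_segment[OF c_lim[of p], of N0] by (simp add: \<mu>(4))
    show "\<bar>real (raney m p 1)\<bar> \<le> (2 ^ (m + 1)) ^ p" for p using raney_le[of m p] by simp
  qed
  obtain \<nu> where \<nu>: "real_distribution \<nu>" "weak_conv_m (\<lambda>n. \<mu> (n + N0)) \<nu>"
    "\<And>p. integrable \<nu> (\<lambda>x. x ^ p)" "\<And>p. (\<integral>x. x ^ p \<partial>\<nu>) = real (raney m p 1)"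
    using weak_limit by blast
  have law: "fuss_catalan_law \<nu> m"
    unfolding fuss_catalan_law_def fuss_catalan_law_axioms_def using \<nu> m by simp
  \<comment> \<open>Without atoms every t is a continuity point, so weak convergence yields the
    limit of the distribution functions everywhere.\<close>
  have cont: "isCont (cdf \<nu>) t" for t
  proof -
    interpret fuss_catalan_law \<nu> m by (rule law)
    show ?thesis using isCont_cdf no_atom by blast
  qed
  have "(\<lambda>N. F x N t) \<longlonglongrightarrow> cdf \<nu> t" for t
  proof -
    have "(\<lambda>n. cdf (\<mu> (n + N0)) t) \<longlonglongrightarrow> cdf \<nu> t"
      using \<nu>(2) cont[of t] by (simp add: weak_conv_m_def weak_conv_def)
    then have "(\<lambda>n. F (cutoff_array (\<alpha> (n + N0)) x) (n + N0) t) \<longlonglongrightarrow> cdf \<nu> t"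
      by (simp add: \<mu>(2))
    then have Fy: "(\<lambda>N. F (cutoff_array (\<alpha> N) x) N t) \<longlonglongrightarrow> cdf \<nu> t"
      by (rule LIMSEQ_offset)
    have "(\<lambda>N. F x N t - F (cutoff_array (\<alpha> N) x) N t) \<longlonglongrightarrow> 0"
    proof (rule Lim_null_comparison[OF _ L_lim])
      show "\<forall>\<^sub>F N in sequentially. norm (F x N t - F (cutoff_array (\<alpha> N) x) N t) \<le>
          real (\<kappa> N) ^ 4 * lindeberg4 M x N (\<alpha> N)"
        using eventually_ge_at_top[of N0]
      proof eventually_elim
        case (elim N)
        interpret entry_array "M N" x N B "\<alpha> N" by (rule arr[OF elim])
        have "\<bar>F x N t - F (cutoff_array (\<alpha> N) x) N t\<bar> \<le> lindeberg4 M x N (\<alpha> N) / \<alpha> N ^ 4"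
          unfolding F_def lindeberg4_def y_def[symmetric] by (rule spectral_cutoff_difference[OF m])
        also have "\<dots> = real (\<kappa> N) ^ 4 * lindeberg4 M x N (\<alpha> N)"
          using N0[OF elim] by (simp add: \<alpha>_def power_divide)
        finally show ?case by simp
      qed
    qed
    from tendsto_add[OF this Fy] show ?thesis by simp
  qed
  then show ?thesis
    unfolding F_def using \<nu>(1,3,4) raney_fuss_catalan[of m]
    by (intro exI[of _ "cdf \<nu>"] conjI exI[of _ \<nu>]) auto
qed

end
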